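(* Let $T$ be a continuous-logic theory with a sort $G$ expanding a group, and let $\varphi(x,z)$ be a left-invariant formula with $x$ of sort $G$ which is stable in $T$. For $M\models T$ let $C_\varphi(M)$ denote the unique minimal subflow of the $G(M)$-flow $S_\varphi(M)$. If $M,N\models T$ then $C_\varphi(M)$ is homeomorphic to $C_\varphi(N)$. In particular, if $M\preceq N$ then the restriction map $p\mapsto p|_M$ is a homeomorphism from $C_\varphi(N)$ to $C_\varphi(M)$, whose inverse is given by taking the $M$-definable extension.
   Context: Continuous logic is in the sense of Ben Yaacov–Berenstein–Henson–Usvyatsov. $\varphi(x,z)$ is left-invariant if in every model $M\models T$, for all $b\in M^z$ and $g\in G(M)$ there is $c\in M^z$ with $\varphi(gx,b)=\varphi(x,c)$ for all $x\in G(M)$. Then $G(M)$ acts by homeomorphisms on the space $S_\varphi(M)$ of complete $\varphi$-types over $M$, via $\varphi(gp,b)=\varphi(p,c)$ whenever $\varphi(gx,b)=\varphi(x,c)$, making $S_\varphi(M)$ a $G(M)$-flow. $\varphi$ is stable in $T$ if there is $\boldsymbol{k}\colon\mathbb{R}^+\to\mathbb{Z}^+$ such that for every $M\models T$ and $\epsilon>0$ there are no $a_1,\dots,a_k\in M^x$, $b_1,\dots,b_k\in M^z$ ($k=\boldsymbol{k}(\epsilon)$) with $|\varphi(a_i,b_j)-\varphi(a_j,b_i)|\geq\epsilon$ for all $i<j$. Under these assumptions $S_\varphi(M)$ has a unique minimal subflow. By stability each $p\in S_\varphi(M)$ is definable by a $\varphi^*$-formula $d_p(z)$ over $M$ (where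 $\varphi^*(z,x)=\varphi(x,z)$), and for $N\succeq M$ its $M$-definable extension is the type $p^*\in S_\varphi(N)$ with $\varphi(p^*,b)=d_p(\mathrm{tp}_{\varphi^*}(b/M))$ for $b\in N^z$.
   Formalization: The theory T is additionally assumed complete; otherwise the first claim fails (T = discrete groups of order 2 or 3, φ(x,z)=d(zx,e)). For M ≼ N with T incomplete, apply the result to Th(M). *)

theory Defs
  imports "HOL-Analysis.Analysis" "HOL-Algebra.Group"
begin

section \<open>Many-sorted continuous logic\<close>

text \<open>
  Metric signatures, structures and formulas follow Ben Yaacov, Berenstein, Henson and Usvyatsov:
  each sort carries a bound on its diameter, each symbol a modulus of uniform continuity, and
  each predicate symbol a compact interval of values. Structures are complete, bounded metric
  structures with nonempty sorts. The universes of the sorts are sets inside one type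
  \<open>'u\<close>; they may overlap.
\<close>

record ('s, 'f, 'p) lang =
  sorts :: "'s set"
  funs :: "'f set"
  preds :: "'p set"
  diam :: "'s \<Rightarrow> real"
  fdom :: "'f \<Rightarrow> 's list"
  fcod :: "'f \<Rightarrow> 's"
  fmod :: "'f \<Rightarrow> real \<Rightarrow> real"
  pdom :: "'p \<Rightarrow> 's list"
  pmod :: "'p \<Rightarrow> real \<Rightarrow> real"
  plow :: "'p \<Rightarrow> real"
  pupp :: "'p \<Rightarrow> real"

definition is_lang :: "('s, 'f, 'p) lang \<Rightarrow> bool" where
  "is_lang L \<longleftrightarrow>
     (\<forall>f\<in>funs L. set (fdom L f) \<subseteq> sorts L \<and> fcod L f \<in> sorts L \<and> (\<forall>\<epsilon>>0. fmod L f \<epsilon> > 0)) \<and>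
     (\<forall>P\<in>preds L. set (pdom L P) \<subseteq> sorts L \<and> plow L P \<le> pupp L P \<and> (\<forall>\<epsilon>>0. pmod L P \<epsilon> > 0))"

record ('s, 'f, 'p, 'u) struct =
  univ :: "'s \<Rightarrow> 'u set"
  dst :: "'s \<Rightarrow> 'u \<Rightarrow> 'u \<Rightarrow> real"
  fn :: "'f \<Rightarrow> 'u list \<Rightarrow> 'u"
  pr :: "'p \<Rightarrow> 'u list \<Rightarrow> real"

definition tuples :: "('s, 'f, 'p, 'u) struct \<Rightarrow> 's list \<Rightarrow> 'u list set" where
  "tuples M ss = {as. list_all2 (\<lambda>a s. a \<in> univ M s) as ss}"

definition tuple_close ::
  "('s, 'f, 'p, 'u) struct \<Rightarrow> 's list \<Rightarrow> real \<Rightarrow> 'u list \<Rightarrow> 'u list \<Rightarrow> bool" where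
  "tuple_close M ss \<delta> as bs \<longleftrightarrow> (\<forall>i<length ss. dst M (ss ! i) (as ! i) (bs ! i) < \<delta>)"

definition is_struct :: "('s, 'f, 'p) lang \<Rightarrow> ('s, 'f, 'p, 'u) struct \<Rightarrow> bool" where
  "is_struct L M \<longleftrightarrow>
     (\<forall>s\<in>sorts L. univ M s \<noteq> {} \<and> Metric_space (univ M s) (dst M s) \<and>
        Metric_space.mcomplete (univ M s) (dst M s) \<and>
        (\<forall>a\<in>univ M s. \<forall>b\<in>univ M s. dst M s a b \<le> diam L s)) \<and>
     (\<forall>f\<in>funs L. \<forall>as\<in>tuples M (fdom L f). fn M f as \<in> univ M (fcod L f) \<and>
        (\<forall>bs\<in>tuples M (fdom L f). \<forall>\<epsilon>>0. tuple_close M (fdom L f) (fmod L f \<epsilon>) as bs \<longrightarrow>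
           dst M (fcod L f) (fn M f as) (fn M f bs) \<le> \<epsilon>)) \<and>
     (\<forall>P\<in>preds L. \<forall>as\<in>tuples M (pdom L P). pr M P as \<in> {plow L P..pupp L P} \<and>
        (\<forall>bs\<in>tuples M (pdom L P). \<forall>\<epsilon>>0. tuple_close M (pdom L P) (pmod L P \<epsilon>) as bs \<longrightarrow>
           \<bar>pr M P as - pr M P bs\<bar> \<le> \<epsilon>))"

text \<open>
  Variables are de Bruijn indices into a context, which is a list of sorts. An \<open>n\<close>-ary connective
  is a continuous function of \<open>n\<close> real variables; it is represented by a function on real
  sequences, continuous for the product topology, that is applied to the \<open>n\<close> values
  padded with zeros. Every continuous function of \<open>n\<close> real variables arises in this way.
\<close>

datatype 'f tm = Var nat | Fn 'f "'f tm list"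

datatype ('s, 'f, 'p) fm =
    Dist 's "'f tm" "'f tm"
  | Pred 'p "'f tm list"
  | Conn "(nat \<Rightarrow> real) \<Rightarrow> real" "('s, 'f, 'p) fm list"
  | Infm 's "('s, 'f, 'p) fm"
  | Supm 's "('s, 'f, 'p) fm"

inductive is_tm :: "('s, 'f, 'p) lang \<Rightarrow> 's list \<Rightarrow> 'f tm \<Rightarrow> 's \<Rightarrow> bool" for L \<Gamma> where
  "i < length \<Gamma> \<Longrightarrow> is_tm L \<Gamma> (Var i) (\<Gamma> ! i)"
| "f \<in> funs L \<Longrightarrow> list_all2 (is_tm L \<Gamma>) ts (fdom L f) \<Longrightarrow> is_tm L \<Gamma> (Fn f ts) (fcod L f)"

inductive is_fm :: "('s, 'f, 'p) lang \<Rightarrow> 's list \<Rightarrow> ('s, 'f, 'p) fm \<Rightarrow> bool" for L where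
  "s \<in> sorts L \<Longrightarrow> is_tm L \<Gamma> t s \<Longrightarrow> is_tm L \<Gamma> t' s \<Longrightarrow> is_fm L \<Gamma> (Dist s t t')"
| "P \<in> preds L \<Longrightarrow> list_all2 (is_tm L \<Gamma>) ts (pdom L P) \<Longrightarrow> is_fm L \<Gamma> (Pred P ts)"
| "continuous_on UNIV u \<Longrightarrow> \<forall>\<psi>\<in>set \<psi>s. is_fm L \<Gamma> \<psi> \<Longrightarrow> is_fm L \<Gamma> (Conn u \<psi>s)"
| "s \<in> sorts L \<Longrightarrow> is_fm L (s # \<Gamma>) \<psi> \<Longrightarrow> is_fm L \<Gamma> (Infm s \<psi>)"
| "s \<in> sorts L \<Longrightarrow> is_fm L (s # \<Gamma>) \<psi> \<Longrightarrow> is_fm L \<Gamma> (Supm s \<psi>)"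

fun tval :: "('s, 'f, 'p, 'u) struct \<Rightarrow> 'u list \<Rightarrow> 'f tm \<Rightarrow> 'u" where
  "tval M e (Var i) = e ! i"
| "tval M e (Fn f ts) = fn M f (map (tval M e) ts)"

fun fval :: "('s, 'f, 'p, 'u) struct \<Rightarrow> 'u list \<Rightarrow> ('s, 'f, 'p) fm \<Rightarrow> real" where
  "fval M e (Dist s t t') = dst M s (tval M e t) (tval M e t')"
| "fval M e (Pred P ts) = pr M P (map (tval M e) ts)"
| "fval M e (Conn u \<psi>s) = u (\<lambda>i. if i < length \<psi>s then map (fval M e) \<psi>s ! i else 0)"
| "fval M e (Infm s \<psi>) = (INF a\<in>univ M s. fval M (a # e) \<psi>)"
| "fval M e (Supm s \<psi>) = (SUP a\<in>univ M s. fval M (a # e) \<psi>)"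

text \<open>A theory is a set of sentences; a sentence \<open>\<sigma>\<close> in it stands for the condition \<open>\<sigma> = 0\<close>.\<close>

definition is_theory :: "('s, 'f, 'p) lang \<Rightarrow> ('s, 'f, 'p) fm set \<Rightarrow> bool" where
  "is_theory L T \<longleftrightarrow> (\<forall>\<sigma>\<in>T. is_fm L [] \<sigma>)"

definition is_model ::
  "('s, 'f, 'p) lang \<Rightarrow> ('s, 'f, 'p) fm set \<Rightarrow> ('s, 'f, 'p, 'u) struct \<Rightarrow> bool" where
  "is_model L T M \<longleftrightarrow> is_struct L M \<and> (\<forall>\<sigma>\<in>T. fval M [] \<sigma> = 0)"

definition elem_equiv ::
  "('s, 'f, 'p) lang \<Rightarrow> ('s, 'f, 'p, 'u) struct \<Rightarrow> ('s, 'f, 'p, 'u) struct \<Rightarrow> bool" where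
  "elem_equiv L M N \<longleftrightarrow> (\<forall>\<sigma>. is_fm L [] \<sigma> \<longrightarrow> fval M [] \<sigma> = fval N [] \<sigma>)"

definition substruct ::
  "('s, 'f, 'p) lang \<Rightarrow> ('s, 'f, 'p, 'u) struct \<Rightarrow> ('s, 'f, 'p, 'u) struct \<Rightarrow> bool" where
  "substruct L M N \<longleftrightarrow>
     (\<forall>s\<in>sorts L. univ M s \<subseteq> univ N s \<and> (\<forall>a\<in>univ M s. \<forall>b\<in>univ M s. dst M s a b = dst N s a b)) \<and>
     (\<forall>f\<in>funs L. \<forall>as\<in>tuples M (fdom L f). fn M f as = fn N f as) \<and>
     (\<forall>P\<in>preds L. \<forall>as\<in>tuples M (pdom L P). pr M P as = pr N P as)"

definition elem_substruct ::
  "('s, 'f, 'p) lang \<Rightarrow> ('s, 'f, 'p, 'u) struct \<Rightarrow> ('s, 'f, 'p, 'u) struct \<Rightarrow> bool" where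
  "elem_substruct L M N \<longleftrightarrow> substruct L M N \<and>
     (\<forall>\<Gamma> \<psi>. set \<Gamma> \<subseteq> sorts L \<longrightarrow> is_fm L \<Gamma> \<psi> \<longrightarrow> (\<forall>e\<in>tuples M \<Gamma>. fval M e \<psi> = fval N e \<psi>))"

text \<open>
  Notions that refer to all models of a theory take the type of elements of these models as
  a parameter, since HOL cannot quantify over types.
\<close>

definition complete_theory ::
  "'u itself \<Rightarrow> ('s, 'f, 'p) lang \<Rightarrow> ('s, 'f, 'p) fm set \<Rightarrow> bool" where
  "complete_theory _ L T \<longleftrightarrow>
     (\<exists>M :: ('s, 'f, 'p, 'u) struct. is_model L T M) \<and>
     (\<forall>M N :: ('s, 'f, 'p, 'u) struct. is_model L T M \<longrightarrow> is_model L T N \<longrightarrow> elem_equiv L M N)"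

text \<open>
  Only the multiplication is required to be a symbol of the language. The identity is not a
  symbol, and is supplied existentially to form a group record.
\<close>

definition expands_group ::
  "'u itself \<Rightarrow> ('s, 'f, 'p) lang \<Rightarrow> ('s, 'f, 'p) fm set \<Rightarrow> 's \<Rightarrow> 'f \<Rightarrow> bool" where
  "expands_group _ L T G m \<longleftrightarrow>
     m \<in> funs L \<and> fdom L m = [G, G] \<and> fcod L m = G \<and>
     (\<forall>M :: ('s, 'f, 'p, 'u) struct. is_model L T M \<longrightarrow>
        (\<exists>e. group \<lparr>carrier = univ M G, mult = (\<lambda>g h. fn M m [g, h]), one = e\<rparr>))"


section \<open>Left-invariant and stable formulas\<close>

text \<open>
  A formula \<open>\<phi>(x, z)\<close> with \<open>x\<close> of sort \<open>G\<close> and \<open>z\<close> a tuple of variables of sorts \<open>zs\<close> is a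
  formula in the context \<open>G # zs\<close>.
\<close>

abbreviation phi_val ::
  "('s, 'f, 'p, 'u) struct \<Rightarrow> ('s, 'f, 'p) fm \<Rightarrow> 'u \<Rightarrow> 'u list \<Rightarrow> real" where
  "phi_val M \<phi> a b \<equiv> fval M (a # b) \<phi>"

definition is_translate ::
  "('s, 'f, 'p, 'u) struct \<Rightarrow> 's \<Rightarrow> 'f \<Rightarrow> ('s, 'f, 'p) fm \<Rightarrow> 'u \<Rightarrow> 'u list \<Rightarrow> 'u list \<Rightarrow> bool" where
  "is_translate M G m \<phi> g b c \<longleftrightarrow> (\<forall>x\<in>univ M G. phi_val M \<phi> (fn M m [g, x]) b = phi_val M \<phi> x c)"

definition left_invariant ::
  "'u itself \<Rightarrow> ('s, 'f, 'p) lang \<Rightarrow> ('s, 'f, 'p) fm set \<Rightarrow> 's \<Rightarrow> 'f \<Rightarrow> 's list \<Rightarrow>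
     ('s, 'f, 'p) fm \<Rightarrow> bool" where
  "left_invariant _ L T G m zs \<phi> \<longleftrightarrow>
     (\<forall>M :: ('s, 'f, 'p, 'u) struct. is_model L T M \<longrightarrow>
        (\<forall>b\<in>tuples M zs. \<forall>g\<in>univ M G. \<exists>c\<in>tuples M zs. is_translate M G m \<phi> g b c))"

definition stable_in ::
  "'u itself \<Rightarrow> ('s, 'f, 'p) lang \<Rightarrow> ('s, 'f, 'p) fm set \<Rightarrow> 's \<Rightarrow> 's list \<Rightarrow>
     ('s, 'f, 'p) fm \<Rightarrow> bool" where
  "stable_in _ L T G zs \<phi> \<longleftrightarrow>
     (\<exists>k :: real \<Rightarrow> nat. (\<forall>\<epsilon>>0. k \<epsilon> > 0) \<and>
       (\<forall>M :: ('s, 'f, 'p, 'u) struct. is_model L T M \<longrightarrow> (\<forall>\<epsilon>>0.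
          \<not> (\<exists>a b. (\<forall>i\<in>{1..k \<epsilon>}. a i \<in> univ M G \<and> b i \<in> tuples M zs) \<and>
                (\<forall>i\<in>{1..k \<epsilon>}. \<forall>j\<in>{1..k \<epsilon>}. i < j \<longrightarrow>
                   \<bar>phi_val M \<phi> (a i) (b j) - phi_val M \<phi> (a j) (b i)\<bar> \<ge> \<epsilon>)))))"


section \<open>Local type spaces\<close>

text \<open>
  For \<open>f : A \<times> B \<rightarrow> \<real>\<close>, a complete local type is identified with the function \<open>p\<close> on \<open>B\<close> that gives
  the value \<open>f(p, b)\<close>, i.e. with the set of conditions \<open>f(x, b) = p b\<close>. Consistency of this set
  with the elementary diagram means, as usual in continuous logic, that every finite part of
  it is satisfied in \<open>A\<close> up to every \<open>\<epsilon> > 0\<close>. The logic topology is the coarsest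
  one that makes all evaluations \<open>p \<mapsto> p b\<close> continuous.
\<close>

definition local_types :: "'a set \<Rightarrow> 'b set \<Rightarrow> ('a \<Rightarrow> 'b \<Rightarrow> real) \<Rightarrow> ('b \<Rightarrow> real) set" where
  "local_types A B f =
     {p \<in> extensional B. \<forall>F \<epsilon>. finite F \<longrightarrow> F \<subseteq> B \<longrightarrow> \<epsilon> > 0 \<longrightarrow> (\<exists>a\<in>A. \<forall>b\<in>F. \<bar>f a b - p b\<bar> < \<epsilon>)}"

definition local_type_space ::
  "'a set \<Rightarrow> 'b set \<Rightarrow> ('a \<Rightarrow> 'b \<Rightarrow> real) \<Rightarrow> ('b \<Rightarrow> real) topology" where
  "local_type_space A B f = subtopology (powertop_real B) (local_types A B f)"

definition S_phi ::
  "('s, 'f, 'p, 'u) struct \<Rightarrow> 's \<Rightarrow> 's list \<Rightarrow> ('s, 'f, 'p) fm \<Rightarrow> ('u list \<Rightarrow> real) topology" where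
  "S_phi M G zs \<phi> = local_type_space (univ M G) (tuples M zs) (phi_val M \<phi>)"

text \<open>The type space of the opposite formula \<open>\<phi>\<^sup>*(z, x) = \<phi>(x, z)\<close>.\<close>

definition S_phi_star ::
  "('s, 'f, 'p, 'u) struct \<Rightarrow> 's \<Rightarrow> 's list \<Rightarrow> ('s, 'f, 'p) fm \<Rightarrow> ('u \<Rightarrow> real) topology" where
  "S_phi_star M G zs \<phi> = local_type_space (tuples M zs) (univ M G) (\<lambda>b a. phi_val M \<phi> a b)"

text \<open>The \<open>\<phi>\<^sup>*\<close>-type over \<open>M\<close> of a tuple \<open>b\<close> from an elementary extension \<open>N\<close> of \<open>M\<close>.\<close>

definition tp_star ::
  "('s, 'f, 'p, 'u) struct \<Rightarrow> ('s, 'f, 'p, 'u) struct \<Rightarrow> 's \<Rightarrow> ('s, 'f, 'p) fm \<Rightarrow> 'u list \<Rightarrow>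
     ('u \<Rightarrow> real)" where
  "tp_star N M G \<phi> b = (\<lambda>a\<in>univ M G. phi_val N \<phi> a b)"

definition restr_type ::
  "('s, 'f, 'p, 'u) struct \<Rightarrow> 's list \<Rightarrow> ('u list \<Rightarrow> real) \<Rightarrow> ('u list \<Rightarrow> real)" where
  "restr_type M zs p = restrict p (tuples M zs)"


section \<open>The flow of local types and its minimal subflow\<close>

text \<open>
  \<open>\<phi>(gp, b) = \<phi>(p, c)\<close>; for a type \<open>p\<close> the value \<open>p c\<close> does not depend on the choice of the
  translate \<open>c\<close>.
\<close>

definition type_act ::
  "('s, 'f, 'p, 'u) struct \<Rightarrow> 's \<Rightarrow> 'f \<Rightarrow> 's list \<Rightarrow> ('s, 'f, 'p) fm \<Rightarrow> 'u \<Rightarrow>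
     ('u list \<Rightarrow> real) \<Rightarrow> ('u list \<Rightarrow> real)" where
  "type_act M G m zs \<phi> g p =
     (\<lambda>b\<in>tuples M zs. p (SOME c. c \<in> tuples M zs \<and> is_translate M G m \<phi> g b c))"

definition subflow ::
  "('s, 'f, 'p, 'u) struct \<Rightarrow> 's \<Rightarrow> 'f \<Rightarrow> 's list \<Rightarrow> ('s, 'f, 'p) fm \<Rightarrow>
     ('u list \<Rightarrow> real) set \<Rightarrow> bool" where
  "subflow M G m zs \<phi> C \<longleftrightarrow> C \<noteq> {} \<and> closedin (S_phi M G zs \<phi>) C \<and>
     (\<forall>g\<in>univ M G. \<forall>p\<in>C. type_act M G m zs \<phi> g p \<in> C)"

definition minimal_subflow ::
  "('s, 'f, 'p, 'u) struct \<Rightarrow> 's \<Rightarrow> 'f \<Rightarrow> 's list \<Rightarrow> ('s, 'f, 'p) fm \<Rightarrow>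
     ('u list \<Rightarrow> real) set \<Rightarrow> bool" where
  "minimal_subflow M G m zs \<phi> C \<longleftrightarrow> subflow M G m zs \<phi> C \<and>
     (\<forall>D. subflow M G m zs \<phi> D \<longrightarrow> D \<subseteq> C \<longrightarrow> D = C)"

definition C_phi ::
  "('s, 'f, 'p, 'u) struct \<Rightarrow> 's \<Rightarrow> 'f \<Rightarrow> 's list \<Rightarrow> ('s, 'f, 'p) fm \<Rightarrow>
     ('u list \<Rightarrow> real) topology" where
  "C_phi M G m zs \<phi> = subtopology (S_phi M G zs \<phi>) (THE C. minimal_subflow M G m zs \<phi> C)"


section \<open>Definable extensions\<close>

text \<open>
  A \<open>\<phi>\<^sup>*\<close>-formula over \<open>M\<close> is a continuous real-valued function on the space of
  \<open>\<phi>\<^sup>*\<close>-types over \<open>M\<close>. It defines \<open>p\<close> if it takes the value \<open>\<phi>(p, b)\<close> at the type of every \<open>b\<close> in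
  \<open>M\<close>. As these types are dense, two such functions agree on the whole space, so the choice in
  the definition of the extension is immaterial.
\<close>

definition defines_type ::
  "('s, 'f, 'p, 'u) struct \<Rightarrow> 's \<Rightarrow> 's list \<Rightarrow> ('s, 'f, 'p) fm \<Rightarrow> ('u list \<Rightarrow> real) \<Rightarrow>
     (('u \<Rightarrow> real) \<Rightarrow> real) \<Rightarrow> bool" where
  "defines_type M G zs \<phi> p d \<longleftrightarrow> continuous_map (S_phi_star M G zs \<phi>) euclideanreal d \<and>
     (\<forall>b\<in>tuples M zs. p b = d (tp_star M M G \<phi> b))"

definition def_ext ::
  "('s, 'f, 'p, 'u) struct \<Rightarrow> ('s, 'f, 'p, 'u) struct \<Rightarrow> 's \<Rightarrow> 's list \<Rightarrow> ('s, 'f, 'p) fm \<Rightarrow>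
     ('u list \<Rightarrow> real) \<Rightarrow> ('u list \<Rightarrow> real)" where
  "def_ext M N G zs \<phi> p =
     (\<lambda>b\<in>tuples N zs. (SOME d. defines_type M G zs \<phi> p d) (tp_star N M G \<phi> b))"

end

theory Submission
  imports Defs "HOL-Library.Ramsey"
begin

text \<open>
  A stable family of types is fragmented by the sup metric: every nonempty set of types has a
  nonempty relatively open subset of small diameter. Since \<open>G\<close> acts by isometries of this metric,
  a minimal subflow is covered by finitely many translates of such a set, so it is compact for the
  sup metric. Applied to the opposite group, this yields almost periodic points, and an
  interchange of limits shows that any two subflows meet; hence the minimal subflow is unique, and a
  type belongs to it iff all its neighbourhoods are generic, i.e. covered by finitely many translates.
  Genericity with a given number of translates is expressible by a formula. Thus finite metric
  configurations in \<open>C_phi M\<close> are approximated, without decreasing distances, in \<open>C_phi N\<close> and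
  vice versa, which forces the two compact metric spaces to be isometric. If \<open>M\<close> is an elementary
  substructure of \<open>N\<close>, finitely many elements of \<open>M\<close> determine the values of all types in \<open>C_phi N\<close>
  up to \<open>\<epsilon>\<close>, so these types are definable over \<open>M\<close>.
\<close>

section \<open>Local types and stability\<close>

text \<open>All models have elements in the one type \<open>'u\<close>; two of them need not have a
  common elementary extension in this type, and saturation cannot be assumed. So the first claim is
  not deduced from the second: types are limits of realized types of a single model, and models are
  compared through sentences only. Stability is accordingly used as a statement on infinite
  sequences in one model, which each application builds step by step in order to contradict it. What
  a sentence can transfer are strict inequalities about finitely many parameters, with a number of
  translates fixed beforehand. This bounds distances of types from below, at the transferred
  parameters, but not from above, since the other model has further parameters. Hence the comparison
  gives only expanding maps, in both directions, and it takes compactness to make them isometric. On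
  a minimal subflow the sup metric induces the logic topology, which turns the isometry into the
  homeomorphism that is claimed.\<close>

lemma powertop_nbhd:
  assumes "openin (powertop_real B) V" "p \<in> V"
  obtains F \<epsilon> where "finite F" "F \<subseteq> B" "\<epsilon> > 0"
    "\<And>q. q \<in> extensional B \<Longrightarrow> \<forall>b\<in>F. \<bar>q b - p b\<bar> < \<epsilon> \<Longrightarrow> q \<in> V"
proof -
  obtain U where U: "finite {i\<in>B. U i \<noteq> UNIV}" "\<And>i. i \<in> B \<Longrightarrow> open (U i)"
      "p \<in> Pi\<^sub>E B U" "Pi\<^sub>E B U \<subseteq> V"
    using assms unfolding openin_product_topology_alt by fastforce
  define F where "F = {i\<in>B. U i \<noteq> UNIV}"
  have "\<forall>i\<in>F. \<exists>e>0. \<forall>y. \<bar>y - p i\<bar> < e \<longrightarrow> y \<in> U i"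
    using U(2,3) unfolding F_def open_dist dist_real_def by (auto simp: PiE_iff)
  then obtain e where e: "\<And>i. i \<in> F \<Longrightarrow> e i > 0" "\<And>i y. i \<in> F \<Longrightarrow> \<bar>y - p i\<bar> < e i \<Longrightarrow> y \<in> U i"
    by metis
  define \<epsilon> where "\<epsilon> = Min (insert 1 (e ` F))"
  have fin: "finite F" using U(1) by (simp add: F_def)
  have "\<epsilon> > 0" using fin e(1) by (auto simp: \<epsilon>_def)
  moreover have "\<epsilon> \<le> e i" if "i \<in> F" for i using fin that by (auto simp: \<epsilon>_def)
  moreover have "q \<in> V" if "q \<in> extensional B" "\<forall>b\<in>F. \<bar>q b - p b\<bar> < \<epsilon>" for q
  proof -
    have "q i \<in> U i" if i: "i \<in> B" for i
    proof (cases "i \<in> F")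
      case True
      then show ?thesis using e(2)[of i] \<open>\<forall>b\<in>F. \<bar>q b - p b\<bar> < \<epsilon>\<close> calculation(2)[of i] by force
    qed (use i in \<open>auto simp: F_def\<close>)
    then have "q \<in> Pi\<^sub>E B U" using that(1) by (simp add: PiE_iff)
    then show ?thesis using U(4) by blast
  qed
  ultimately show ?thesis using fin by (intro that[of F \<epsilon>]) (auto simp: F_def)
qed

lemma openin_powertop_cut:
  assumes "b \<in> B" "open W"
  shows "openin (powertop_real B) {q \<in> extensional B. q b \<in> W}"
proof -
  have "openin (powertop_real B) {q \<in> topspace (powertop_real B). q b \<in> W}"
    using continuous_map_product_coordinates[of b B "\<lambda>_. euclideanreal"] assms
    by (intro openin_continuous_map_preimage[where Y = euclideanreal]) auto
  then show ?thesis by (simp add: PiE_UNIV_domain PiE_def)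
qed

lemma openin_powertop_box:
  assumes "finite F" "F \<subseteq> B"
  shows "openin (powertop_real B) {q \<in> extensional B. \<forall>b\<in>F. \<bar>q b - r b\<bar> < \<epsilon>}"
proof (cases "F = {}")
  case True
  then show ?thesis using openin_topspace[of "powertop_real B"] by (simp add: PiE_def)
next
  case False
  have "openin (powertop_real B) (\<Inter>b\<in>F. {q \<in> extensional B. q b \<in> ball (r b) \<epsilon>})"
    using assms False by (intro openin_Inter) (auto simp del: mem_ball intro: openin_powertop_cut)
  moreover have "(\<Inter>b\<in>F. {q \<in> extensional B. q b \<in> ball (r b) \<epsilon>}) = {q \<in> extensional B. \<forall>b\<in>F. \<bar>q b - r b\<bar> < \<epsilon>}"
    using False by (auto simp: dist_real_def abs_minus_commute)
  ultimately show ?thesis by simp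
qed

text \<open>Finite satisfiability up to every \<epsilon> is exactly density of the realized types.
  Closedness of the type space, and its compactness for bounded \<open>f\<close>, thus come from the
  product topology alone.\<close>

lemma local_types_closure_of:
  "local_types A B f = powertop_real B closure_of (\<lambda>a. restrict (f a) B) ` A"
proof (intro subset_antisym subsetI)
  fix p assume p: "p \<in> local_types A B f"
  then have "p \<in> extensional B" by (simp add: local_types_def)
  moreover have "\<exists>a\<in>A. restrict (f a) B \<in> V" if V: "openin (powertop_real B) V" "p \<in> V" for V
  proof -
    obtain F \<epsilon> where F: "finite F" "F \<subseteq> B" "\<epsilon> > 0"
        "\<And>q. q \<in> extensional B \<Longrightarrow> \<forall>b\<in>F. \<bar>q b - p b\<bar> < \<epsilon> \<Longrightarrow> q \<in> V"
      by (rule powertop_nbhd[OF V]) blast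
    have "\<exists>a\<in>A. \<forall>b\<in>F. \<bar>f a b - p b\<bar> < \<epsilon>"
      using p F(1-3) unfolding local_types_def by simp
    then obtain a where "a \<in> A" "\<forall>b\<in>F. \<bar>f a b - p b\<bar> < \<epsilon>" by (rule bexE)
    with F show ?thesis by (intro bexI[of _ a] F(4)) auto
  qed
  ultimately show "p \<in> powertop_real B closure_of (\<lambda>a. restrict (f a) B) ` A"
    unfolding in_closure_of by (auto simp: PiE_def)
next
  fix p assume p: "p \<in> powertop_real B closure_of (\<lambda>a. restrict (f a) B) ` A"
  then have e: "p \<in> extensional B" by (auto simp: in_closure_of PiE_def)
  moreover have "\<exists>a\<in>A. \<forall>b\<in>F. \<bar>f a b - p b\<bar> < \<epsilon>" if F: "finite F" "F \<subseteq> B" "\<epsilon> > 0" for F \<epsilon>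
  proof -
    define V where "V = {q \<in> extensional B. \<forall>b\<in>F. \<bar>q b - p b\<bar> < \<epsilon>}"
    have PV: "p \<in> V \<and> openin (powertop_real B) V"
      unfolding V_def using e F openin_powertop_box[OF F(1,2), of p \<epsilon>] by simp
    have CL: "\<forall>V. p \<in> V \<and> openin (powertop_real B) V \<longrightarrow> (\<exists>y. y \<in> (\<lambda>a. restrict (f a) B) ` A \<and> y \<in> V)"
      using p unfolding in_closure_of by (rule conjunct2)
    obtain y where y: "y \<in> (\<lambda>a. restrict (f a) B) ` A" "y \<in> V"
      using mp[OF spec[OF CL] PV] by (elim exE conjE) (rule that)
    from y(1) obtain a where "a \<in> A" "y = restrict (f a) B" by (rule imageE)
    with y(2) have "a \<in> A" "restrict (f a) B \<in> V" by simp_all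
    then have "\<bar>f a b - p b\<bar> < \<epsilon>" if "b \<in> F" for b
      using subsetD[OF F(2) that] that unfolding V_def by auto
    then show ?thesis using \<open>a \<in> A\<close> by blast
  qed
  ultimately show "p \<in> local_types A B f" by (auto simp: local_types_def)
qed

lemma local_types_approx:
  assumes "p \<in> local_types A B f" "finite F" "F \<subseteq> B" "\<epsilon> > 0"
  obtains a where "a \<in> A" "\<And>b. b \<in> F \<Longrightarrow> \<bar>f a b - p b\<bar> < \<epsilon>"
proof -
  have "\<exists>a\<in>A. \<forall>b\<in>F. \<bar>f a b - p b\<bar> < \<epsilon>"
    using assms unfolding local_types_def by simp
  then show ?thesis using that by (elim bexE) simp
qed

lemma local_types_ext: "p \<in> local_types A B f \<Longrightarrow> p \<in> extensional B"
  by (simp add: local_types_def)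

lemma realized_local_type: "a \<in> A \<Longrightarrow> restrict (f a) B \<in> local_types A B f"
  unfolding local_types_def
proof (intro CollectI conjI allI impI bexI[of _ a] ballI)
  fix F :: "'b set" and \<epsilon> :: real and b
  assume "F \<subseteq> B" "b \<in> F" "\<epsilon> > 0"
  then show "\<bar>f a b - restrict (f a) B b\<bar> < \<epsilon>" using subsetD[of F B b] by simp
qed simp_all

lemma closedin_local_types: "closedin (powertop_real B) (local_types A B f)"
  by (simp add: local_types_closure_of)

lemma local_types_bounded:
  assumes "\<And>a b. a \<in> A \<Longrightarrow> b \<in> B \<Longrightarrow> \<bar>f a b\<bar> \<le> c" "p \<in> local_types A B f" "b \<in> B"
  shows "\<bar>p b\<bar> \<le> c"
proof (rule field_le_epsilon)
  fix e :: real assume "e > 0"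
  with local_types_approx[OF assms(2), of "{b}" e] assms(3) obtain a
    where a: "a \<in> A" "\<bar>f a b - p b\<bar> < e" by auto
  then show "\<bar>p b\<bar> \<le> c + e" using assms(1)[OF a(1) assms(3)] by linarith
qed

lemma compactin_local_types:
  assumes "\<And>a b. a \<in> A \<Longrightarrow> b \<in> B \<Longrightarrow> \<bar>f a b\<bar> \<le> c"
  shows "compactin (powertop_real B) (local_types A B f)"
proof (rule closed_compactin[OF _ _ closedin_local_types])
  show "compactin (powertop_real B) (Pi\<^sub>E B (\<lambda>_. {-c..c}))"
    by (auto simp: compactin_PiE)
  show "local_types A B f \<subseteq> Pi\<^sub>E B (\<lambda>_. {-c..c})"
  proof
    fix p assume p: "p \<in> local_types A B f"
    have "\<bar>p b\<bar> \<le> c" if "b \<in> B" for b by (rule local_types_bounded[OF assms p that])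
    then show "p \<in> Pi\<^sub>E B (\<lambda>_. {-c..c})"
      using local_types_ext[OF p] by (simp add: PiE_iff abs_le_iff) (meson minus_le_iff)
  qed
qed

section \<open>Consequences of stability\<close>

text \<open>Infinite sequences are the form in which the arguments below contradict stability;
  \<open>stable_in\<close> excludes them already through finitely many of their terms.\<close>

definition stable_fun :: "'a set \<Rightarrow> 'b set \<Rightarrow> ('a \<Rightarrow> 'b \<Rightarrow> real) \<Rightarrow> bool" where
  "stable_fun A B f \<longleftrightarrow> (\<forall>\<epsilon>>0. \<not> (\<exists>a b. range a \<subseteq> A \<and> range b \<subseteq> B \<and>
     (\<forall>i j :: nat. i < j \<longrightarrow> \<epsilon> \<le> \<bar>f (a i) (b j) - f (a j) (b i)\<bar>)))"

lemma stable_funD: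
  assumes "stable_fun A B f" "\<epsilon> > 0" "\<And>i. a i \<in> A" "\<And>i. b i \<in> B"
  obtains i j :: nat where "i < j" "\<bar>f (a i) (b j) - f (a j) (b i)\<bar> < \<epsilon>"
proof -
  have "\<not> (\<forall>i j. i < j \<longrightarrow> \<epsilon> \<le> \<bar>f (a i) (b j) - f (a j) (b i)\<bar>)"
    using assms unfolding stable_fun_def by blast
  then show ?thesis using that by force
qed

text \<open>Induction on the colours: if colour \<open>i\<close> fails at some \<open>U\<close>,
  then by \<open>mono\<close> it fails at all smaller sets, so below \<open>U\<close> the remaining
  colours suffice.\<close>

lemma hereditary_color:
  assumes "finite I" "U0 \<in> T" "\<And>U. U \<in> T \<Longrightarrow> U \<subseteq> U0 \<Longrightarrow> \<exists>i\<in>I. Q i U"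
    and mono: "\<And>i U V. Q i V \<Longrightarrow> V \<subseteq> U \<Longrightarrow> Q i U"
  shows "\<exists>i\<in>I. \<exists>U\<in>T. U \<subseteq> U0 \<and> (\<forall>V\<in>T. V \<subseteq> U \<longrightarrow> Q i V)"
  using assms(1-3)
proof (induction I arbitrary: U0 rule: finite_induct)
  case empty
  then show ?case by auto
next
  case (insert i I)
  show ?case
  proof (cases "\<forall>V\<in>T. V \<subseteq> U0 \<longrightarrow> Q i V")
    case True
    then show ?thesis using insert.prems(1) by (intro bexI[of _ i] bexI[of _ U0]) auto
  next
    case False
    then obtain U where U: "U \<in> T" "U \<subseteq> U0" "\<not> Q i U" by blast
    have H: "\<exists>j\<in>I. Q j V" if W: "V \<in> T" "V \<subseteq> U" for V
    proof -
      obtain j where j: "j \<in> insert i I" "Q j V"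
        using insert.prems(2)[OF W(1) subset_trans[OF W(2) U(2)]] by (rule bexE)
      have "j \<noteq> i"
      proof
        assume "j = i"
        with j(2) have "Q i U" using mono[OF _ W(2), of i] by simp
        with U(3) show False by (rule notE)
      qed
      with j show ?thesis by (intro bexI[of _ j]) simp_all
    qed
    have "\<exists>j\<in>I. \<exists>V\<in>T. V \<subseteq> U \<and> (\<forall>W\<in>T. W \<subseteq> V \<longrightarrow> Q j W)"
      by (rule insert.IH[OF U(1) H])
    then obtain j V where "j \<in> I" "V \<in> T" "V \<subseteq> U" "\<forall>W\<in>T. W \<subseteq> V \<longrightarrow> Q j W"
      by (elim bexE conjE) (rule that)
    then show ?thesis using U(2) by (intro bexI[of _ j] bexI[of _ V]) auto
  qed
qed

text \<open>
  Otherwise some threshold interval is crossed, inside every open set meeting \<open>Z\<close>, by the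
  evaluation at some \<open>b\<close>. Choose \<open>a\<close> near a point of the current open set, restrict the \<open>b\<close> allowed
  later to those with \<open>f a b\<close> on one fixed side, pick such a \<open>b\<close>, and shrink the open set to
  points that are on the other side at \<open>b\<close>. Iterating this contradicts stability.
\<close>

lemma stable_fragmented:
  assumes st: "stable_fun A B f" and bd: "\<And>a b. a \<in> A \<Longrightarrow> b \<in> B \<Longrightarrow> \<bar>f a b\<bar> \<le> c"
    and Z: "Z \<subseteq> local_types A B f" "Z \<noteq> {}" and "\<epsilon> > 0"
  shows "\<exists>U. openin (powertop_real B) U \<and> U \<inter> Z \<noteq> {} \<and>
    (\<forall>p\<in>U \<inter> Z. \<forall>q\<in>U \<inter> Z. \<forall>b\<in>B. \<bar>p b - q b\<bar> \<le> \<epsilon>)"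
proof (rule ccontr)
  assume neg: "\<not> ?thesis"
  define T where "T = {U. openin (powertop_real B) U \<and> U \<inter> Z \<noteq> {}}"
  \<comment> \<open>Two values more than \<open>4 * e\<close> apart have a whole grid interval from
    \<open>k * e\<close> to \<open>(k + 1) * e\<close> strictly between them. By boundedness
    finitely many \<open>k\<close> occur, so \<open>hereditary_color\<close> can fix one of
    them.\<close>
  define e where "e = \<epsilon> / 4"
  have e: "e > 0" using \<open>\<epsilon> > 0\<close> by (simp add: e_def)
  define Sp where "Sp = (\<lambda>(k::int) U b. (\<exists>z\<in>U \<inter> Z. z b < k * e) \<and> (\<exists>z\<in>U \<inter> Z. z b > (real_of_int k + 1) * e))"
  have Zext: "z \<in> extensional B" if "z \<in> Z" for z using Z(1) that local_types_ext by blast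
  have Zbd: "\<bar>z b\<bar> \<le> c" if "z \<in> Z" "b \<in> B" for z b
    by (rule local_types_bounded[OF bd subsetD[OF Z(1) that(1)] that(2)])
  define K where "K = \<lceil>c / e\<rceil> + 1"
  have split: "\<exists>k\<in>{-K..K}. \<exists>b\<in>B. Sp k U b" if U: "U \<in> T" for U
  proof -
    have "\<exists>p\<in>U \<inter> Z. \<exists>q\<in>U \<inter> Z. \<exists>b\<in>B. \<not> \<bar>p b - q b\<bar> \<le> \<epsilon>"
      using neg U unfolding T_def by blast
    then obtain p q b where pq: "p \<in> U \<inter> Z" "q \<in> U \<inter> Z" "b \<in> B" "\<bar>p b - q b\<bar> > \<epsilon>"
      by (meson not_le)
    obtain p q where pq: "p \<in> U \<inter> Z" "q \<in> U \<inter> Z" "q b - p b > \<epsilon>"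
    proof (cases "q b > p b")
      case True then show ?thesis using pq by (intro that[of p q]) auto
    next
      case False then show ?thesis using pq by (intro that[of q p]) auto
    qed
    define k where "k = \<lfloor>p b / e\<rfloor> + 1"
    have "p b / e < k" "real_of_int k \<le> p b / e + 1" unfolding k_def by linarith+
    then have k: "p b < k * e" "k * e \<le> p b + e"
      using e by (auto simp: field_simps)
    moreover have "q b > (real_of_int k + 1) * e"
      using k(2) pq(3) e by (simp add: e_def algebra_simps)
    ultimately have "Sp k U b"
      unfolding Sp_def using pq by (intro conjI bexI[of _ p] bexI[of _ q]) auto
    moreover have "k \<in> {-K..K}"
    proof -
      have "\<bar>p b / e\<bar> \<le> c / e" using Zbd[of p b] pq \<open>b \<in> B\<close> e by (simp add: divide_right_mono)
      then have "- (c / e) \<le> p b / e" "p b / e \<le> c / e" by linarith+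
      then show ?thesis unfolding k_def K_def atLeastAtMost_iff by linarith
    qed
    ultimately show ?thesis using \<open>b \<in> B\<close> by blast
  qed
  have Spmono: "Sp k U b" if "Sp k V b" "V \<subseteq> U" for k U V b using that unfolding Sp_def by blast
  have "topspace (powertop_real B) \<in> T"
    using Z(2) Zext openin_topspace[of "powertop_real B"] unfolding T_def by (auto simp: PiE_def)
  then have "\<exists>k\<in>{-K..K}. \<exists>U\<in>T. U \<subseteq> topspace (powertop_real B) \<and>
      (\<forall>V\<in>T. V \<subseteq> U \<longrightarrow> (\<exists>b\<in>B. Sp k V b))"
  proof (rule hereditary_color[rotated])
    show "\<exists>k\<in>{-K..K}. \<exists>b\<in>B. Sp k U b" if "U \<in> T" for U by (rule split[OF that])
    show "\<exists>b\<in>B. Sp k U b" if "\<exists>b\<in>B. Sp k V b" "V \<subseteq> U" for k U V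
      using that Spmono by blast
  qed simp
  then obtain k U0 where U0: "U0 \<in> T" and k: "\<And>V. V \<in> T \<Longrightarrow> V \<subseteq> U0 \<Longrightarrow> \<exists>b\<in>B. Sp k V b"
    by blast
  define mid where "mid = (k + 1/2) * e"
  \<comment> \<open>The invariant of the iteration: every smaller member of \<open>T\<close> is
    still split by some parameter in \<open>B'\<close>. It has to survive the shrinking of both the
    open set and the set of allowed parameters.\<close>
  define good where "good = (\<lambda>U B'. U \<in> T \<and> B' \<subseteq> B \<and> (\<forall>V\<in>T. V \<subseteq> U \<longrightarrow> (\<exists>b\<in>B'. Sp k V b)))"
  define R where "R = (\<lambda>(a, b, U, B'). good U B' \<and> a \<in> A \<and> b \<in> B \<and>
     ((\<forall>b'\<in>B'. f a b' \<le> mid) \<and> (\<forall>q\<in>U. q b > (real_of_int k + 1) * e) \<or>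
      (\<forall>b'\<in>B'. f a b' \<ge> mid) \<and> (\<forall>q\<in>U. q b < k * e)))"
  have step: "\<exists>a b U' B''. R (a, b, U', B'') \<and> U' \<subseteq> U \<and> B'' \<subseteq> B' \<and> restrict (f a) B \<in> U \<and> b \<in> B'"
    if G: "good U B'" for U B'
  proof -
    obtain z where z: "z \<in> U" "z \<in> Z" "openin (powertop_real B) U"
      using G unfolding good_def T_def by blast
    have "\<forall>V. z \<in> V \<and> openin (powertop_real B) V \<longrightarrow> (\<exists>y\<in>(\<lambda>a. restrict (f a) B) ` A. y \<in> V)"
      using subsetD[OF Z(1) z(2)] unfolding local_types_closure_of in_closure_of by blast
    then obtain a where a: "a \<in> A" "restrict (f a) B \<in> U"
      using z(1,3) by blast
    have U: "U \<in> T" using G by (simp add: good_def)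
    \<comment> \<open>Splitting parameters are coloured by the side of \<open>mid\<close> on which
      \<open>f a b\<close> lies. \<open>B''\<close> keeps a side \<open>s\<close> that persists, and
      \<open>U'\<close> is cut to the opposite side, which leaves a gap of at least
      \<open>e / 2\<close>.\<close>
    define Q where "Q = (\<lambda>s V. \<exists>b\<in>B'. Sp k V b \<and> (f a b \<le> mid) = s)"
    have "\<exists>s\<in>UNIV. Q s V" if "V \<in> T" "V \<subseteq> U" for V
    proof -
      obtain b where "b \<in> B'" "Sp k V b" using G \<open>V \<in> T\<close> \<open>V \<subseteq> U\<close> unfolding good_def by blast
      then have "Q (f a b \<le> mid) V" unfolding Q_def by blast
      then show ?thesis by blast
    qed
    then have "\<exists>s\<in>UNIV. \<exists>U1\<in>T. U1 \<subseteq> U \<and> (\<forall>V\<in>T. V \<subseteq> U1 \<longrightarrow> Q s V)"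
    proof (rule hereditary_color[OF finite_class.finite_UNIV U])
      show "Q s V" if "Q s W" "W \<subseteq> V" for s V W
        using that Spmono unfolding Q_def by blast
    qed
    then obtain s U1 where s: "U1 \<in> T" "U1 \<subseteq> U" "\<And>V. V \<in> T \<Longrightarrow> V \<subseteq> U1 \<Longrightarrow> Q s V"
      by blast
    define B'' where "B'' = {b\<in>B'. (f a b \<le> mid) = s}"
    have "Q s U1" using s(1,3) by blast
    then obtain b where b: "b \<in> B''" "Sp k U1 b" unfolding B''_def Q_def by blast
    have bB: "b \<in> B" using b G by (auto simp: B''_def good_def)
    define U' where "U' = U1 \<inter> {q \<in> extensional B. q b \<in> (if s then {(real_of_int k + 1) * e<..} else {..<k * e})}"
    have "openin (powertop_real B) U'"
      unfolding U'_def using s(1) bB by (intro openin_Int openin_powertop_cut) (auto simp: T_def)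
    moreover have "U' \<inter> Z \<noteq> {}"
    proof (cases s)
      case True
      have "\<exists>z\<in>U1 \<inter> Z. z b > (real_of_int k + 1) * e" using b(2) unfolding Sp_def by (rule conjunct2)
      then obtain q where "q \<in> U1 \<inter> Z" "q b > (real_of_int k + 1) * e" by (rule bexE)
      then have "q \<in> U' \<inter> Z" using Zext[of q] True by (simp add: U'_def)
      then show ?thesis by blast
    next
      case False
      have "\<exists>z\<in>U1 \<inter> Z. z b < k * e" using b(2) unfolding Sp_def by (rule conjunct1)
      then obtain q where "q \<in> U1 \<inter> Z" "q b < k * e" by (rule bexE)
      then have "q \<in> U' \<inter> Z" using Zext[of q] False by (simp add: U'_def)
      then show ?thesis by blast
    qed
    ultimately have "U' \<in> T" by (simp add: T_def)
    moreover have "U' \<subseteq> U1" by (auto simp: U'_def)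
    moreover have "\<exists>b\<in>B''. Sp k V b" if "V \<in> T" "V \<subseteq> U'" for V
    proof -
      have "Q s V" using s(3)[OF that(1)] that(2) \<open>U' \<subseteq> U1\<close> by blast
      then show ?thesis unfolding Q_def B''_def by blast
    qed
    ultimately have "good U' B''"
      using G unfolding good_def B''_def by blast
    then have "R (a, b, U', B'')"
      using a bB unfolding R_def U'_def B''_def by (cases s) auto
    then show ?thesis using \<open>U' \<subseteq> U1\<close> s(2) a(2) b(1) unfolding B''_def by blast
  qed
  have "good U0 B" using U0 k by (auto simp: good_def)
  from step[OF this] have 1: "\<exists>x. R x" by blast
  define S where "S = (\<lambda>(a :: 'a, b :: 'b, U, B' :: 'b set) (a' :: 'a, b' :: 'b, U', B'' :: 'b set).
      U' \<subseteq> U \<and> B'' \<subseteq> B' \<and> restrict (f a') B \<in> U \<and> b' \<in> B')"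
  have 2: "\<exists>y. R y \<and> S x y" if "R x" for x
  proof -
    obtain a b U B' where x: "x = (a, b, U, B')" by (cases x)
    then have "good U B'" using that by (simp add: R_def)
    from step[OF this] show ?thesis unfolding x S_def by auto
  qed
  obtain h where h: "\<And>n. R (h n)" "\<And>n. S (h n) (h (Suc n))"
    using dependent_nat_choice[of "\<lambda>_. R" "\<lambda>_. S"] 1 2 by metis
  define a b U B' where "a = (\<lambda>n. fst (h n))" and "b = (\<lambda>n. fst (snd (h n)))"
    and "U = (\<lambda>n. fst (snd (snd (h n))))" and "B' = (\<lambda>n. snd (snd (snd (h n))))"
  have hn: "h n = (a n, b n, U n, B' n)" for n by (simp add: a_def b_def U_def B'_def)
  have R: "R (a n, b n, U n, B' n)" for n using h(1)[of n] by (simp add: hn)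
  have S: "U (Suc n) \<subseteq> U n" "B' (Suc n) \<subseteq> B' n" "restrict (f (a (Suc n))) B \<in> U n" "b (Suc n) \<in> B' n" for n
    using h(2)[of n] by (simp_all add: hn S_def)
  have dU: "U n \<subseteq> U m" "B' n \<subseteq> B' m" if "m \<le> n" for m n
    using that lift_Suc_antimono_le[of U] lift_Suc_antimono_le[of B'] S by blast+
  have AB: "a n \<in> A" "b n \<in> B" for n using R[of n] by (auto simp: R_def)
  obtain i j where ij: "i < j" "\<bar>f (a i) (b j) - f (a j) (b i)\<bar> < e / 2"
    using stable_funD[OF st, of "e / 2" a b] AB e by auto
  \<comment> \<open>\<open>S\<close> relates consecutive stages only: the data of stage
    \<open>j\<close> lie in the sets of stage \<open>j'\<close>, its predecessor, and these are
    nested in those of stage \<open>i\<close>.\<close>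
  then obtain j' where j': "j = Suc j'" "i \<le> j'" by (cases j) auto
  have "b j \<in> B' i" "restrict (f (a j)) B \<in> U i" using S[of j'] dU[OF j'(2)] j' by auto
  moreover have "restrict (f (a j)) B (b i) = f (a j) (b i)" using AB by simp
  ultimately have "f (a i) (b j) \<le> mid \<and> f (a j) (b i) > (real_of_int k + 1) * e \<or>
       f (a i) (b j) \<ge> mid \<and> f (a j) (b i) < k * e"
    using R[of i] unfolding R_def by fastforce
  moreover have "mid = k * e + e / 2" "(real_of_int k + 1) * e = k * e + e"
    by (simp_all add: mid_def algebra_simps)
  ultimately show False using ij(2) by argo
qed

lemma floor_divide_eq_imp_close:
  fixes x y e :: real
  assumes "\<lfloor>x / e\<rfloor> = \<lfloor>y / e\<rfloor>" "e > 0"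
  shows "\<bar>x - y\<bar> < e"
proof -
  have "\<bar>x / e - y / e\<bar> < 1" using assms(1) by linarith
  then have "\<bar>(x - y) / e\<bar> < 1" by (simp add: diff_divide_distrib)
  then show ?thesis using assms(2) by (simp add: abs_divide)
qed

lemma floor_divide_bounded:
  fixes x e C :: real
  assumes "\<bar>x\<bar> \<le> C" "e > 0"
  shows "\<lfloor>x / e\<rfloor> \<in> {- \<lceil>C / e\<rceil> - 1..\<lceil>C / e\<rceil>}"
proof -
  have "\<bar>x / e\<bar> \<le> C / e" using assms by (simp add: abs_divide divide_right_mono)
  then have "- (C / e) \<le> x / e" "x / e \<le> C / e" by linarith+
  then show ?thesis unfolding atLeastAtMost_iff by linarith
qed

text \<open>Grothendieck's double limit argument, for finitely many indices at once. If it fails,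
  choose alternately \<open>a n\<close> realizing \<open>p\<close> on the earlier tuples and
  \<open>bs n\<close> approximating \<open>Q\<close> on the elements found so far. For stages
  \<open>i < j\<close>, \<open>f (a i)\<close> at \<open>bs j\<close> is close to
  \<open>Q (a i)\<close>, and \<open>f (a j)\<close> at \<open>bs i\<close> is close to
  \<open>p\<close> at \<open>bs i\<close>; stability brings these two together for some such
  pair.\<close>

lemma stable_interchange:
  fixes f :: "'a \<Rightarrow> 'b \<Rightarrow> real" and Q :: "'a \<Rightarrow> 'i \<Rightarrow> real"
  assumes st: "stable_fun A B f" and bd: "\<And>a b. a \<in> A \<Longrightarrow> b \<in> B \<Longrightarrow> \<bar>f a b\<bar> \<le> c"
    and p: "p \<in> local_types A B f" and I: "finite I"
    and BB: "\<And>bs i. bs \<in> BB \<Longrightarrow> i \<in> I \<Longrightarrow> bs i \<in> B"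
    and ap: "\<And>A0 \<delta>. finite A0 \<Longrightarrow> A0 \<subseteq> A \<Longrightarrow> \<delta> > 0 \<Longrightarrow>
      \<exists>bs\<in>BB. \<forall>a\<in>A0. \<forall>i\<in>I. \<bar>f a (bs i) - Q a i\<bar> < \<delta>"
    and eps: "\<epsilon> > 0"
  shows "\<exists>a\<in>A. \<exists>bs\<in>BB. \<forall>i\<in>I. \<bar>Q a i - p (bs i)\<bar> \<le> \<epsilon>"
proof (rule ccontr)
  assume neg: "\<not> ?thesis"
  have far: "\<exists>i\<in>I. \<bar>Q a i - p (bs i)\<bar> > \<epsilon>" if "a \<in> A" "bs \<in> BB" for a bs
  proof (rule ccontr)
    assume "\<not> (\<exists>i\<in>I. \<bar>Q a i - p (bs i)\<bar> > \<epsilon>)"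
    then have "\<forall>i\<in>I. \<bar>Q a i - p (bs i)\<bar> \<le> \<epsilon>" by (simp add: not_less)
    with that have "\<exists>a\<in>A. \<exists>bs\<in>BB. \<forall>i\<in>I. \<bar>Q a i - p (bs i)\<bar> \<le> \<epsilon>"
      by (intro bexI[of _ a] bexI[of _ bs])
    with neg show False by (rule notE)
  qed
  define e where "e = \<epsilon> / 8"
  have e: "e > 0" "\<epsilon> = 8 * e" using eps by (simp_all add: e_def)
  \<comment> \<open>The membership guards let the construction continue after an arbitrary history
    \<open>h\<close>; along the resulting sequence they hold. The last conjunct serves to bound
    \<open>Q (a n)\<close> for the rounding below.\<close>
  define P where "P = (\<lambda>(h :: nat \<Rightarrow> 'a \<times> ('i \<Rightarrow> 'b)) n x. fst x \<in> A \<and> snd x \<in> BB \<and>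
      (\<forall>m<n. snd (h m) \<in> BB \<longrightarrow> (\<forall>i\<in>I. \<bar>f (fst x) (snd (h m) i) - p (snd (h m) i)\<bar> < e)) \<and>
      (\<forall>m<n. fst (h m) \<in> A \<longrightarrow> (\<forall>i\<in>I. \<bar>f (fst (h m)) (snd x i) - Q (fst (h m)) i\<bar> < e)) \<and>
      (\<forall>i\<in>I. \<bar>f (fst x) (snd x i) - Q (fst x) i\<bar> < e))"
  have "\<exists>h. \<forall>n. P h n (h n)"
  proof (rule dependent_wellorder_choice)
    fix r and h h' :: "nat \<Rightarrow> 'a \<times> ('i \<Rightarrow> 'b)" and n
    assume "\<And>y. y < n \<Longrightarrow> h y = h' y"
    then show "P h n r = P h' n r" unfolding P_def by simp
  next
    fix n and h :: "nat \<Rightarrow> 'a \<times> ('i \<Rightarrow> 'b)"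
    define F where "F = (\<Union>m\<in>{m. m < n \<and> snd (h m) \<in> BB}. snd (h m) ` I)"
    have F: "finite F" "F \<subseteq> B" unfolding F_def using I by (auto intro: BB)
    obtain a where a: "a \<in> A" "\<And>b. b \<in> F \<Longrightarrow> \<bar>f a b - p b\<bar> < e"
      using local_types_approx[OF p F e(1)] by metis
    define A0 where "A0 = insert a (fst ` h ` {..<n} \<inter> A)"
    have "finite A0" "A0 \<subseteq> A" using a(1) by (auto simp: A0_def)
    from ap[OF this e(1)] obtain bs where bs: "bs \<in> BB" "\<forall>a\<in>A0. \<forall>i\<in>I. \<bar>f a (bs i) - Q a i\<bar> < e"
      by (rule bexE)
    have "P h n (a, bs)"
      unfolding P_def fst_conv snd_conv
    proof (intro conjI allI impI ballI)
      fix m i assume "m < n" "snd (h m) \<in> BB" "i \<in> I"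
      then have "snd (h m) i \<in> F" by (auto simp: F_def)
      then show "\<bar>f a (snd (h m) i) - p (snd (h m) i)\<bar> < e" by (rule a(2))
    next
      fix m i assume "m < n" "fst (h m) \<in> A" "i \<in> I"
      then have "fst (h m) \<in> A0" by (auto simp: A0_def)
      with bs(2) \<open>i \<in> I\<close> show "\<bar>f (fst (h m)) (bs i) - Q (fst (h m)) i\<bar> < e" by simp
    next
      fix i assume "i \<in> I"
      with bs(2) show "\<bar>f a (bs i) - Q a i\<bar> < e" by (simp add: A0_def)
    qed (use a bs in simp_all)
    then show "\<exists>r. P h n r" by (rule exI)
  qed
  then obtain h where h: "\<forall>n. P h n (h n)" by (rule exE)
  define a bs where "a = (\<lambda>n. fst (h n))" and "bs = (\<lambda>n. snd (h n))"
  have P: "P h n (h n)" for n using h by (rule spec)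
  have mem: "a n \<in> A" "bs n \<in> BB" for n using P[of n] unfolding P_def a_def bs_def by simp_all
  have ap1: "\<bar>f (a n) (bs m i) - p (bs m i)\<bar> < e" if "m < n" "i \<in> I" for m n i
    using P[of n] that mem(2)[of m] unfolding P_def a_def bs_def by simp
  have ap2: "\<bar>f (a m) (bs n i) - Q (a m) i\<bar> < e" if "m < n" "i \<in> I" for m n i
    using P[of n] that mem(1)[of m] unfolding P_def a_def bs_def by simp
  have ap3: "\<bar>f (a n) (bs n i) - Q (a n) i\<bar> < e" if "i \<in> I" for n i
    using P[of n] that unfolding P_def a_def bs_def by simp
  \<comment> \<open>Stability handles one index at a time, but the index that goes wrong may vary
    with the stage. Rounded values take finitely many patterns, so on a subsequence all values agree
    up to \<open>e\<close> with those of stage \<open>n0\<close>, and one index \<open>i0\<close> is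
    bad throughout.\<close>
  define col where "col = (\<lambda>n. (\<lambda>i\<in>I. (\<lfloor>Q (a n) i / e\<rfloor>, \<lfloor>p (bs n i) / e\<rfloor>)))"
  define K where "K = {- \<lceil>(c + e) / e\<rceil> - 1..\<lceil>(c + e) / e\<rceil>}"
  have "col n \<in> Pi\<^sub>E I (\<lambda>_. K \<times> K)" for n
  proof (unfold col_def, rule restrict_PiE_iff[THEN iffD2], intro ballI)
    fix i assume i: "i \<in> I"
    have "\<bar>f (a n) (bs n i)\<bar> \<le> c" using bd[OF mem(1) BB[OF mem(2) i]] .
    then have "\<bar>Q (a n) i\<bar> \<le> c + e" using ap3[OF i, of n] by linarith
    moreover have "\<bar>p (bs n i)\<bar> \<le> c + e"
      using local_types_bounded[OF bd p BB[OF mem(2) i], of n] e(1) by linarith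
    ultimately show "(\<lfloor>Q (a n) i / e\<rfloor>, \<lfloor>p (bs n i) / e\<rfloor>) \<in> K \<times> K"
      unfolding K_def using floor_divide_bounded[OF _ e(1)] by (intro SigmaI) blast+
  qed
  then have "finite (range col)"
    using I by (intro finite_subset[of "range col" "Pi\<^sub>E I (\<lambda>_. K \<times> K)"]) (auto simp: K_def intro!: finite_PiE)
  from pigeonhole_infinite[OF infinite_UNIV_nat this]
  obtain n0 where "infinite {n \<in> UNIV. col n = col n0}" by auto
  then obtain r :: "nat \<Rightarrow> nat" where r: "strict_mono r" "\<And>k. col (r k) = col n0"
    using infinite_enumerate by blast
  obtain i0 where i0: "i0 \<in> I" "\<bar>Q (a n0) i0 - p (bs n0 i0)\<bar> > \<epsilon>" using far[OF mem] by (rule bexE)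
  have close: "\<bar>Q (a (r k)) i0 - Q (a n0) i0\<bar> < e" "\<bar>p (bs (r k) i0) - p (bs n0 i0)\<bar> < e" for k
    using fun_cong[OF r(2)[of k], of i0] i0(1) floor_divide_eq_imp_close[OF _ e(1)]
    unfolding col_def by simp_all
  obtain i j where ij: "i < j"
      "\<bar>f (a (r i)) (bs (r j) i0) - f (a (r j)) (bs (r i) i0)\<bar> < e"
    using stable_funD[OF st e(1), of "\<lambda>k. a (r k)" "\<lambda>k. bs (r k) i0"] mem(1) BB[OF mem(2) i0(1)] by metis
  have "r i < r j" using r(1) ij(1) by (simp add: strict_mono_less)
  from ap1[OF this i0(1)] ap2[OF this i0(1)] ij(2) close(1)[of i] close(2)[of i] i0(2) e(2)
  show False by argo
qed

text \<open>Otherwise choose \<open>a n\<close> realizing \<open>p\<close> on earlier parameters,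
  and pairs \<open>b n\<close>, \<open>b' n\<close> on which the earlier elements agree although
  \<open>p\<close> separates them. For \<open>i < j\<close> the values of \<open>f (a i)\<close> at
  \<open>b j\<close> and \<open>b' j\<close> are close, while those of \<open>f (a j)\<close> at
  \<open>b i\<close> and \<open>b' i\<close> are close to the separated values of \<open>p\<close>.
  Stability for both sequences at the same pair \<open>i < j\<close> is then contradictory.\<close>

lemma stable_type_determined:
  fixes f :: "'a \<Rightarrow> 'b \<Rightarrow> real"
  assumes st: "stable_fun A B f" and p: "p \<in> local_types A B f" and eps: "\<epsilon> > 0"
  shows "\<exists>A0 \<delta>. finite A0 \<and> A0 \<subseteq> A \<and> \<delta> > 0 \<and>
    (\<forall>b\<in>B. \<forall>b'\<in>B. (\<forall>a\<in>A0. \<bar>f a b - f a b'\<bar> < \<delta>) \<longrightarrow> \<bar>p b - p b'\<bar> \<le> \<epsilon>)"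
proof (rule ccontr)
  assume neg: "\<not> ?thesis"
  define e where "e = \<epsilon> / 8"
  have e: "e > 0" "\<epsilon> = 8 * e" using eps by (simp_all add: e_def)
  have far: "\<exists>b\<in>B. \<exists>b'\<in>B. (\<forall>a\<in>A0. \<bar>f a b - f a b'\<bar> < e) \<and> \<bar>p b - p b'\<bar> > \<epsilon>"
    if "finite A0" "A0 \<subseteq> A" for A0
  proof (rule ccontr)
    assume "\<not> (\<exists>b\<in>B. \<exists>b'\<in>B. (\<forall>a\<in>A0. \<bar>f a b - f a b'\<bar> < e) \<and> \<bar>p b - p b'\<bar> > \<epsilon>)"
    then have "\<forall>b\<in>B. \<forall>b'\<in>B. (\<forall>a\<in>A0. \<bar>f a b - f a b'\<bar> < e) \<longrightarrow> \<bar>p b - p b'\<bar> \<le> \<epsilon>"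
      by (meson not_less)
    with that e(1) have "\<exists>A0 \<delta>. finite A0 \<and> A0 \<subseteq> A \<and> \<delta> > 0 \<and>
        (\<forall>b\<in>B. \<forall>b'\<in>B. (\<forall>a\<in>A0. \<bar>f a b - f a b'\<bar> < \<delta>) \<longrightarrow> \<bar>p b - p b'\<bar> \<le> \<epsilon>)"
      by (intro exI[of _ A0] exI[of _ e] conjI)
    with neg show False by (rule notE)
  qed
  define P where "P = (\<lambda>(h :: nat \<Rightarrow> 'a \<times> 'b \<times> 'b) n (a, b, b'). a \<in> A \<and> b \<in> B \<and> b' \<in> B \<and>
      \<bar>p b - p b'\<bar> > \<epsilon> \<and>
      (\<forall>m<n. fst (h m) \<in> A \<longrightarrow> \<bar>f (fst (h m)) b - f (fst (h m)) b'\<bar> < e) \<and>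
      (\<forall>m<n. fst (snd (h m)) \<in> B \<longrightarrow> \<bar>f a (fst (snd (h m))) - p (fst (snd (h m)))\<bar> < e) \<and>
      (\<forall>m<n. snd (snd (h m)) \<in> B \<longrightarrow> \<bar>f a (snd (snd (h m))) - p (snd (snd (h m)))\<bar> < e))"
  have "\<exists>h. \<forall>n. P h n (h n)"
  proof (rule dependent_wellorder_choice)
    fix r and h h' :: "nat \<Rightarrow> 'a \<times> 'b \<times> 'b" and n
    assume "\<And>y. y < n \<Longrightarrow> h y = h' y"
    then show "P h n r = P h' n r" unfolding P_def by (cases r) simp
  next
    fix n and h :: "nat \<Rightarrow> 'a \<times> 'b \<times> 'b"
    define A0 where "A0 = fst ` h ` {..<n} \<inter> A"
    have "finite A0" "A0 \<subseteq> A" by (auto simp: A0_def)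
    from far[OF this] obtain b b' where b: "b \<in> B" "b' \<in> B"
        "\<forall>a\<in>A0. \<bar>f a b - f a b'\<bar> < e" "\<bar>p b - p b'\<bar> > \<epsilon>"
      by (elim bexE conjE) (rule that)
    define F where "F = ((\<lambda>x. fst (snd x)) ` h ` {..<n} \<union> (\<lambda>x. snd (snd x)) ` h ` {..<n}) \<inter> B"
    have F: "finite F" "F \<subseteq> B" by (auto simp: F_def)
    obtain a where a: "a \<in> A" "\<And>b. b \<in> F \<Longrightarrow> \<bar>f a b - p b\<bar> < e"
      using local_types_approx[OF p F e(1)] by metis
    have "P h n (a, b, b')"
      unfolding P_def prod.case
    proof (intro conjI allI impI)
      fix m assume "m < n" "fst (h m) \<in> A"
      then have "fst (h m) \<in> A0" by (auto simp: A0_def)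
      with b(3) show "\<bar>f (fst (h m)) b - f (fst (h m)) b'\<bar> < e" by simp
    next
      fix m assume "m < n" "fst (snd (h m)) \<in> B"
      then have "fst (snd (h m)) \<in> F" by (auto simp: F_def)
      then show "\<bar>f a (fst (snd (h m))) - p (fst (snd (h m)))\<bar> < e" by (rule a(2))
    next
      fix m assume "m < n" "snd (snd (h m)) \<in> B"
      then have "snd (snd (h m)) \<in> F" by (auto simp: F_def)
      then show "\<bar>f a (snd (snd (h m))) - p (snd (snd (h m)))\<bar> < e" by (rule a(2))
    qed (use a b in simp_all)
    then show "\<exists>r. P h n r" by (rule exI)
  qed
  then obtain h where h: "\<forall>n. P h n (h n)" by (rule exE)
  define a b b' where "a = (\<lambda>n. fst (h n))" and "b = (\<lambda>n. fst (snd (h n)))" and "b' = (\<lambda>n. snd (snd (h n)))"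
  have hn: "fst (h m) = a m" "fst (snd (h m)) = b m" "snd (snd (h m)) = b' m" for m
    by (simp_all add: a_def b_def b'_def)
  have P: "P h n (a n, b n, b' n)" for n using spec[OF h, of n] by (simp add: a_def b_def b'_def)
  have mem: "a n \<in> A" "b n \<in> B" "b' n \<in> B" and gap: "\<bar>p (b n) - p (b' n)\<bar> > \<epsilon>" for n
    using P[of n] unfolding P_def by simp_all
  have ap: "\<bar>f (a m) (b n) - f (a m) (b' n)\<bar> < e" "\<bar>f (a n) (b m) - p (b m)\<bar> < e"
      "\<bar>f (a n) (b' m) - p (b' m)\<bar> < e" if "m < n" for m n
    using P[of n] that mem[of m] unfolding P_def prod.case hn by simp_all
  \<comment> \<open>Stability yields a pair for \<open>b\<close> and a pair for \<open>b'\<close>,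
    possibly different ones. On a Ramsey-homogeneous set one good pair for \<open>b\<close> makes
    all pairs good for \<open>b\<close>, so a good pair for \<open>b'\<close> serves both.\<close>
  define g where "g = (\<lambda>X. if \<bar>f (a (Min X)) (b (Max X)) - f (a (Max X)) (b (Min X))\<bar> < e then (1::nat) else 0)"
  have g: "g {i, j} = (if \<bar>f (a i) (b j) - f (a j) (b i)\<bar> < e then 1 else 0)" if "i < j" for i j
    using that by (simp add: g_def min_def max_def)
  have "\<forall>x\<in>UNIV. \<forall>y\<in>UNIV. x \<noteq> y \<longrightarrow> g {x, y} < 2" by (simp add: g_def)
  from Ramsey2[OF infinite_UNIV_nat this]
  obtain Y t where Y: "infinite Y" "\<forall>x\<in>Y. \<forall>y\<in>Y. x \<noteq> y \<longrightarrow> g {x, y} = t" by metis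
  obtain r :: "nat \<Rightarrow> nat" where r: "strict_mono r" "\<And>k. r k \<in> Y"
    using infinite_enumerate[OF Y(1)] by metis
  have gr: "g {r i, r j} = t" "r i < r j" if "i < j" for i j
  proof -
    show *: "r i < r j" using r(1) that by (simp add: strict_mono_less)
    show "g {r i, r j} = t" using Y(2) r(2)[of i] r(2)[of j] * by simp
  qed
  obtain i j where "i < j" "\<bar>f (a (r i)) (b (r j)) - f (a (r j)) (b (r i))\<bar> < e"
    using stable_funD[OF st e(1), of "\<lambda>k. a (r k)" "\<lambda>k. b (r k)"] mem by metis
  then have t: "t = 1" using gr(1)[of i j] unfolding g[OF gr(2)[OF \<open>i < j\<close>]] by simp
  obtain i j where ij: "i < j" "\<bar>f (a (r i)) (b' (r j)) - f (a (r j)) (b' (r i))\<bar> < e"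
    using stable_funD[OF st e(1), of "\<lambda>k. a (r k)" "\<lambda>k. b' (r k)"] mem by metis
  have "\<bar>f (a (r i)) (b (r j)) - f (a (r j)) (b (r i))\<bar> < e"
    using gr(1)[OF ij(1)] unfolding g[OF gr(2)[OF ij(1)]] t
    by (cases "\<bar>f (a (r i)) (b (r j)) - f (a (r j)) (b (r i))\<bar> < e") simp_all
  with ap[OF gr(2)[OF ij(1)]] ij(2) gap[of "r i"] e(2) show False by argo
qed

section \<open>Flows of local types\<close>

lemma finite_chain_Inter_mem:
  assumes "finite F" "F \<noteq> {}" "\<And>S T. S \<in> F \<Longrightarrow> T \<in> F \<Longrightarrow> S \<subseteq> T \<or> T \<subseteq> S"
  shows "\<Inter>F \<in> F"
  using assms
proof (induction F rule: finite_ne_induct)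
  case (insert S F)
  have "\<Inter>F \<in> F" using insert.IH insert.prems by simp
  then have "S \<subseteq> \<Inter>F \<or> \<Inter>F \<subseteq> S" using insert.prems by simp
  then show ?case using \<open>\<Inter>F \<in> F\<close> by (auto simp: Int_absorb1 Int_absorb2)
qed simp

text \<open>Kept abstract because it is instantiated twice: by the group of a model with parameters
  \<open>tuples M zs\<close>, and by the opposite group with parameters
  \<open>carrier Gp \<times> F\<close>.\<close>

locale stable_flow = group Gp for Gp :: "('a, 'm) monoid_scheme" (structure) +
  fixes B :: "'b set" and f :: "'a \<Rightarrow> 'b \<Rightarrow> real" and c :: real
  assumes bounded: "a \<in> carrier Gp \<Longrightarrow> b \<in> B \<Longrightarrow> \<bar>f a b\<bar> \<le> c"
    and translate: "b \<in> B \<Longrightarrow> g \<in> carrier Gp \<Longrightarrow> \<exists>b'\<in>B. \<forall>x\<in>carrier Gp. f (g \<otimes> x) b = f x b'"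
    and stable: "stable_fun (carrier Gp) B f"
begin

abbreviation "X \<equiv> local_types (carrier Gp) B f"

text \<open>The same choice as in \<open>type_act\<close>, so that in a model \<open>act\<close> is
  literally \<open>type_act\<close>; by \<open>type_cong\<close> the choice does not affect values
  of types.\<close>

definition tr :: "'a \<Rightarrow> 'b \<Rightarrow> 'b" where
  "tr g b = (SOME b'. b' \<in> B \<and> (\<forall>x\<in>carrier Gp. f (g \<otimes> x) b = f x b'))"

definition act :: "'a \<Rightarrow> ('b \<Rightarrow> real) \<Rightarrow> 'b \<Rightarrow> real" where
  "act g p = (\<lambda>b\<in>B. p (tr g b))"

definition flow :: "('b \<Rightarrow> real) set \<Rightarrow> bool" where
  "flow C \<longleftrightarrow> C \<noteq> {} \<and> closedin (local_type_space (carrier Gp) B f) C \<and>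
     (\<forall>g\<in>carrier Gp. \<forall>p\<in>C. act g p \<in> C)"

definition minimal_flow :: "('b \<Rightarrow> real) set \<Rightarrow> bool" where
  "minimal_flow C \<longleftrightarrow> flow C \<and> (\<forall>D. flow D \<longrightarrow> D \<subseteq> C \<longrightarrow> D = C)"

lemma tr:
  assumes "g \<in> carrier Gp" "b \<in> B"
  shows tr_in: "tr g b \<in> B" and f_tr: "x \<in> carrier Gp \<Longrightarrow> f x (tr g b) = f (g \<otimes> x) b"
proof -
  have "\<exists>b'. b' \<in> B \<and> (\<forall>x\<in>carrier Gp. f (g \<otimes> x) b = f x b')"
    using translate[OF assms(2,1)] by blast
  from someI_ex[OF this, folded tr_def]
  show "tr g b \<in> B" "x \<in> carrier Gp \<Longrightarrow> f x (tr g b) = f (g \<otimes> x) b"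
    by simp_all
qed

lemma type_cong:
  assumes p: "p \<in> X" and b: "b \<in> B" "b' \<in> B" and eq: "\<And>x. x \<in> carrier Gp \<Longrightarrow> f x b = f x b'"
  shows "p b = p b'"
proof (rule ccontr)
  assume "p b \<noteq> p b'"
  then have "\<bar>p b - p b'\<bar> / 2 > 0" by simp
  then obtain a where a: "a \<in> carrier Gp" "\<And>d. d \<in> {b, b'} \<Longrightarrow> \<bar>f a d - p d\<bar> < \<bar>p b - p b'\<bar> / 2"
    using local_types_approx[OF p, of "{b, b'}" "\<bar>p b - p b'\<bar> / 2"] b by auto
  from a(2)[of b] a(2)[of b'] eq[OF a(1)] show False by (simp add: abs_if split: if_splits)
qed

lemma act_apply: "b \<in> B \<Longrightarrow> act g p b = p (tr g b)"
  by (simp add: act_def)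

lemma act_ext: "act g p \<in> extensional B"
  by (simp add: act_def)

lemma act_eqI:
  assumes "p \<in> X" "g \<in> carrier Gp" "b \<in> B" "b' \<in> B"
    "\<And>x. x \<in> carrier Gp \<Longrightarrow> f (g \<otimes> x) b = f x b'"
  shows "act g p b = p b'"
  using assms by (simp add: act_apply) (rule type_cong, simp_all add: tr)

lemma act_in:
  assumes g: "g \<in> carrier Gp" and p: "p \<in> X"
  shows "act g p \<in> X"
  unfolding local_types_def
proof (intro CollectI conjI allI impI)
  show "act g p \<in> extensional B" by (rule act_ext)
  fix F :: "'b set" and \<epsilon> :: real
  assume F: "finite F" "F \<subseteq> B" "\<epsilon> > 0"
  have "finite (tr g ` F)" "tr g ` F \<subseteq> B" using F tr_in[OF g] by auto
  from local_types_approx[OF p this F(3)]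
  obtain a where a: "a \<in> carrier Gp" "\<And>b. b \<in> tr g ` F \<Longrightarrow> \<bar>f a b - p b\<bar> < \<epsilon>" by metis
  have "\<bar>f (g \<otimes> a) b - act g p b\<bar> < \<epsilon>" if b: "b \<in> F" for b
  proof -
    have "b \<in> B" using b F(2) by (rule rev_subsetD)
    then show ?thesis using a(2)[of "tr g b"] b by (simp add: act_apply f_tr[OF g _ a(1)])
  qed
  then show "\<exists>a\<in>carrier Gp. \<forall>b\<in>F. \<bar>f a b - act g p b\<bar> < \<epsilon>"
    using g a(1) by (intro bexI[of _ "g \<otimes> a"]) simp_all
qed

lemma act_mult:
  assumes g: "g \<in> carrier Gp" and h: "h \<in> carrier Gp" and p: "p \<in> X"
  shows "act g (act h p) = act (g \<otimes> h) p"
proof (rule extensionalityI[OF act_ext act_ext])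
  fix b assume b: "b \<in> B"
  have "act (g \<otimes> h) p b = p (tr h (tr g b))"
    using g h b by (intro act_eqI[OF p]) (simp_all add: tr m_assoc)
  then show "act g (act h p) b = act (g \<otimes> h) p b"
    using b tr_in[OF g b] by (simp add: act_apply)
qed

lemma act_one:
  assumes p: "p \<in> X"
  shows "act \<one> p = p"
proof (rule extensionalityI[OF act_ext local_types_ext[OF p]])
  show "act \<one> p b = p b" if "b \<in> B" for b using that by (intro act_eqI[OF p]) simp_all
qed

lemma act_inv:
  assumes "g \<in> carrier Gp" "p \<in> X"
  shows "act (inv g) (act g p) = p"
  using assms by (simp add: act_mult act_one)

text \<open>Each value of \<open>p\<close> is a value of \<open>act g p\<close>, namely at a
  translate of the parameter by \<open>inv g\<close>. This is the isometry of the action, stated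
  without a supremum.\<close>

lemma act_dist_le:
  assumes g: "g \<in> carrier Gp" and pq: "p \<in> X" "q \<in> X"
    and le: "\<And>b. b \<in> B \<Longrightarrow> \<bar>act g p b - act g q b\<bar> \<le> \<epsilon>" and b: "b \<in> B"
  shows "\<bar>p b - q b\<bar> \<le> \<epsilon>"
proof -
  have i: "inv g \<in> carrier Gp" using g by simp
  have "p b = act g p (tr (inv g) b)" "q b = act g q (tr (inv g) b)"
    using act_inv[OF g pq(1)] act_inv[OF g pq(2)] act_apply[OF b, of "inv g"] by metis+
  then show ?thesis using le[OF tr_in[OF i b]] by simp
qed

lemma continuous_map_act:
  assumes "g \<in> carrier Gp"
  shows "continuous_map (powertop_real B) (powertop_real B) (act g)"
  unfolding continuous_map_componentwise
proof (intro conjI ballI)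
  show "act g ` topspace (powertop_real B) \<subseteq> extensional B" using act_ext by auto
  fix b assume b: "b \<in> B"
  have "continuous_map (powertop_real B) euclideanreal (\<lambda>p. p (tr g b))"
    using continuous_map_product_coordinates[OF tr_in[OF assms b], of "\<lambda>_. euclideanreal"] .
  then show "continuous_map (powertop_real B) euclideanreal (\<lambda>p. act g p b)"
    by (simp add: act_apply[OF b])
qed

lemma compactin_X: "compactin (powertop_real B) X"
  by (rule compactin_local_types) (rule bounded)

lemma flow_iff:
  "flow C \<longleftrightarrow> C \<noteq> {} \<and> closedin (powertop_real B) C \<and> C \<subseteq> X \<and> (\<forall>g\<in>carrier Gp. \<forall>p\<in>C. act g p \<in> C)"
  unfolding flow_def local_type_space_def closedin_closed_subtopology[OF closedin_local_types] by blast

lemma flow_compactin: "flow C \<Longrightarrow> compactin (powertop_real B) C"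
  unfolding flow_iff using closed_compactin[OF compactin_X] by blast

lemma flow_X: "flow X"
  unfolding flow_iff using closedin_local_types act_in realized_local_type[OF one_closed, of f B] by auto

section \<open>Minimal subflows and their total boundedness\<close>

lemma flow_Inter_chain:
  assumes ne: "\<D> \<noteq> {}" and fl: "\<And>D. D \<in> \<D> \<Longrightarrow> flow D"
    and ch: "\<And>S T. S \<in> \<D> \<Longrightarrow> T \<in> \<D> \<Longrightarrow> S \<subseteq> T \<or> T \<subseteq> S"
  shows "flow (\<Inter>\<D>)"
proof -
  obtain D where D: "D \<in> \<D>" using ne by blast
  have cl: "closedin (powertop_real B) S" if "S \<in> \<D>" for S using fl[OF that] by (simp add: flow_iff)
  have "X \<inter> \<Inter>\<D> \<noteq> {}"
  proof -
    have "X \<inter> \<Inter>\<F> \<noteq> {}" if F: "finite \<F>" "\<F> \<subseteq> \<D>" for \<F>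
    proof (cases "\<F> = {}")
      case True
      then show ?thesis using flow_X by (simp add: flow_iff)
    next
      case False
      have "\<Inter>\<F> \<in> \<F>" using F ch by (intro finite_chain_Inter_mem[OF F(1) False]) blast
      then have "flow (\<Inter>\<F>)" using F(2) fl by blast
      then show ?thesis unfolding flow_iff by blast
    qed
    then show ?thesis using compactin_X cl unfolding compactin_fip by simp
  qed
  moreover have "\<Inter>\<D> \<subseteq> X" using fl[OF D] D unfolding flow_iff by blast
  moreover have "closedin (powertop_real B) (\<Inter>\<D>)" using ne cl by (rule closedin_Inter)
  moreover have "act g p \<in> \<Inter>\<D>" if "g \<in> carrier Gp" "p \<in> \<Inter>\<D>" for g p
    using that fl unfolding flow_iff by (intro InterI) simp
  ultimately show ?thesis unfolding flow_iff by blast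
qed

lemma minimal_flow_exists:
  assumes D: "flow D"
  obtains C where "minimal_flow C" "C \<subseteq> D"
proof -
  \<comment> \<open>Complements turn the minimality sought into the maximality that Zorn's lemma
    provides.\<close>
  define \<A> where "\<A> = {- C |C. flow C \<and> C \<subseteq> D}"
  have "\<exists>M\<in>\<A>. \<forall>X\<in>\<A>. M \<subseteq> X \<longrightarrow> X = M"
  proof (rule subset_Zorn_nonempty)
    show "\<A> \<noteq> {}" using D by (auto simp: \<A>_def)
    fix \<C> assume C: "\<C> \<noteq> {}" "subset.chain \<A> \<C>"
    define \<D> where "\<D> = uminus ` \<C>"
    have sub: "\<C> \<subseteq> \<A>" using C(2) by (simp add: subset_chain_def)
    have fl: "flow S \<and> S \<subseteq> D" if "S \<in> \<D>" for S
      using that sub by (auto simp: \<D>_def \<A>_def)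
    have "flow (\<Inter>\<D>)"
    proof (rule flow_Inter_chain)
      show "\<D> \<noteq> {}" using C(1) by (simp add: \<D>_def)
      show "flow S" if "S \<in> \<D>" for S using fl[OF that] by simp
      show "S \<subseteq> T \<or> T \<subseteq> S" if "S \<in> \<D>" "T \<in> \<D>" for S T
        using that C(2) unfolding \<D>_def subset_chain_def by auto
    qed
    moreover have "\<Inter>\<D> \<subseteq> D" using fl C(1) unfolding \<D>_def by blast
    moreover have "\<Union>\<C> = - \<Inter>\<D>" by (auto simp: \<D>_def)
    ultimately show "\<Union>\<C> \<in> \<A>" by (auto simp: \<A>_def)
  qed
  then obtain C where C: "flow C" "C \<subseteq> D" "\<forall>X\<in>\<A>. - C \<subseteq> X \<longrightarrow> X = - C"
    unfolding \<A>_def by blast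
  have "E = C" if E: "flow E" "E \<subseteq> C" for E
  proof -
    have "- E \<in> \<A>" using E C(2) by (auto simp: \<A>_def)
    then have "- E = - C" using C(3) E(2) by blast
    then show ?thesis by simp
  qed
  then have "minimal_flow C" using C(1) by (simp add: minimal_flow_def)
  then show ?thesis using that C(2) by blast
qed

text \<open>The points whose orbit misses \<open>U\<close> form a subflow as soon as there is one.
  When \<open>U\<close> meets the minimal flow this is impossible, so every orbit enters
  \<open>U\<close>, and compactness then gives covers by finitely many translates.\<close>

lemma flow_avoiding:
  assumes C: "flow C" and U: "openin (powertop_real B) U"
  shows "closedin (powertop_real B) {p \<in> C. \<forall>g\<in>carrier Gp. act g p \<notin> U}"
    and "g \<in> carrier Gp \<Longrightarrow> p \<in> {p \<in> C. \<forall>g\<in>carrier Gp. act g p \<notin> U} \<Longrightarrow>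
      act g p \<in> {p \<in> C. \<forall>g\<in>carrier Gp. act g p \<notin> U}"
proof -
  have CX: "p \<in> X" if "p \<in> C" for p using C that unfolding flow_iff by blast
  have Cc: "closedin (powertop_real B) C" using C unfolding flow_iff by blast
  have op: "openin (powertop_real B) {p \<in> topspace (powertop_real B). act g p \<in> U}"
    if "g \<in> carrier Gp" for g
    using openin_continuous_map_preimage[OF continuous_map_act[OF that] U] .
  have "closedin (powertop_real B) (C - (\<Union>g\<in>carrier Gp. {p \<in> topspace (powertop_real B). act g p \<in> U}))"
    using op by (intro closedin_diff[OF Cc] openin_Union) auto
  moreover have "C - (\<Union>g\<in>carrier Gp. {p \<in> topspace (powertop_real B). act g p \<in> U})
      = {p \<in> C. \<forall>g\<in>carrier Gp. act g p \<notin> U}"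
    using closedin_subset[OF Cc] by auto
  ultimately show "closedin (powertop_real B) {p \<in> C. \<forall>g\<in>carrier Gp. act g p \<notin> U}" by simp
  show "act g p \<in> {p \<in> C. \<forall>g\<in>carrier Gp. act g p \<notin> U}"
    if g: "g \<in> carrier Gp" and p: "p \<in> {p \<in> C. \<forall>g\<in>carrier Gp. act g p \<notin> U}"
  proof -
    have "p \<in> C" using p by simp
    then have "act g p \<in> C" using C g unfolding flow_iff by simp
    moreover have "act h (act g p) \<notin> U" if "h \<in> carrier Gp" for h
      using p that g act_mult[OF that g CX[OF \<open>p \<in> C\<close>]] by simp
    ultimately show ?thesis by simp
  qed
qed

lemma flow_finite_cover:
  assumes C: "flow C" and U: "openin (powertop_real B) U"
    and cov: "\<And>p. p \<in> C \<Longrightarrow> \<exists>g\<in>carrier Gp. act g p \<in> U"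
  obtains K where "finite K" "K \<subseteq> carrier Gp" "\<And>p. p \<in> C \<Longrightarrow> \<exists>g\<in>K. act g p \<in> U"
proof -
  define V where "V = (\<lambda>g. {p \<in> topspace (powertop_real B). act g p \<in> U})"
  have op: "openin (powertop_real B) (V g)" if "g \<in> carrier Gp" for g
    unfolding V_def using openin_continuous_map_preimage[OF continuous_map_act[OF that] U] .
  have sub: "C \<subseteq> topspace (powertop_real B)" using C closedin_subset unfolding flow_iff by blast
  have "C \<subseteq> \<Union>(V ` carrier Gp)" using cov sub unfolding V_def by auto
  then obtain \<F> where F: "finite \<F>" "\<F> \<subseteq> V ` carrier Gp" "C \<subseteq> \<Union>\<F>"
    using compactinD[OF flow_compactin[OF C], of "V ` carrier Gp"] op by auto
  obtain K where K: "K \<subseteq> carrier Gp" "finite K" "\<F> = V ` K"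
    using finite_subset_image[OF F(1,2)] by blast
  show ?thesis
  proof (rule that[OF K(2,1)])
    fix p assume "p \<in> C"
    then have "p \<in> \<Union>(V ` K)" using F(3) K(3) by blast
    then show "\<exists>g\<in>K. act g p \<in> U" unfolding V_def by auto
  qed
qed

text \<open>
  The group acts by isometries of the sup metric and finitely many translates of a nonempty open
  set cover a minimal subflow, so one open set of small diameter suffices.
\<close>

lemma minimal_flow_totally_bounded:
  assumes C: "minimal_flow C" and eps: "\<epsilon> > 0"
  obtains P where "finite P" "P \<subseteq> C" "\<And>p. p \<in> C \<Longrightarrow> \<exists>q\<in>P. \<forall>b\<in>B. \<bar>p b - q b\<bar> \<le> \<epsilon>"
proof -
  have fl: "flow C" using C by (simp add: minimal_flow_def)
  then have CX: "C \<subseteq> X" "C \<noteq> {}" by (simp_all add: flow_iff)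
  have "\<exists>U. openin (powertop_real B) U \<and> U \<inter> C \<noteq> {} \<and>
      (\<forall>p\<in>U \<inter> C. \<forall>q\<in>U \<inter> C. \<forall>b\<in>B. \<bar>p b - q b\<bar> \<le> \<epsilon>)"
    by (rule stable_fragmented[OF stable _ CX eps]) (rule bounded)
  then obtain U where U: "openin (powertop_real B) U" "U \<inter> C \<noteq> {}"
      "\<forall>p\<in>U \<inter> C. \<forall>q\<in>U \<inter> C. \<forall>b\<in>B. \<bar>p b - q b\<bar> \<le> \<epsilon>"
    by (elim exE conjE) (rule that)
  define D where "D = {p \<in> C. \<forall>g\<in>carrier Gp. act g p \<notin> U}"
  have "D = {}"
  proof (rule ccontr)
    assume "D \<noteq> {}"
    then have "flow D"
      unfolding flow_iff using flow_avoiding[OF fl U(1)] CX(1) unfolding D_def by auto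
    then have "D = C" using C unfolding minimal_flow_def D_def by blast
    obtain p where p: "p \<in> U" "p \<in> C" using U(2) by blast
    then have "act \<one> p \<in> U" using act_one CX(1) by (simp add: subset_iff)
    then show False using p \<open>D = C\<close> unfolding D_def by blast
  qed
  then have "\<exists>g\<in>carrier Gp. act g p \<in> U" if "p \<in> C" for p using that unfolding D_def by blast
  then obtain K where K: "finite K" "K \<subseteq> carrier Gp" "\<And>p. p \<in> C \<Longrightarrow> \<exists>g\<in>K. act g p \<in> U"
    using flow_finite_cover[OF fl U(1)] by metis
  \<comment> \<open>One net point for each \<open>g \<in> K\<close> is enough: points of
    \<open>C\<close> that \<open>g\<close> moves into \<open>U\<close> are as close to each other as
    their images, since \<open>g\<close> acts isometrically.\<close>
  define s where "s = (\<lambda>g. SOME p. p \<in> C \<and> act g p \<in> U)"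
  define P where "P = s ` {g \<in> K. \<exists>p. p \<in> C \<and> act g p \<in> U}"
  have s: "s g \<in> C \<and> act g (s g) \<in> U" if "\<exists>p. p \<in> C \<and> act g p \<in> U" for g
    unfolding s_def using someI_ex[OF that] .
  show ?thesis
  proof (rule that[of P])
    show "finite P" using K(1) by (simp add: P_def)
    show "P \<subseteq> C" unfolding P_def using s by auto
    fix p assume p: "p \<in> C"
    then obtain g where g: "g \<in> K" "act g p \<in> U" using K(3) by (metis (no_types))
    then have sg: "s g \<in> C" "act g (s g) \<in> U" using s[of g] p by (simp_all add: exI[of _ p])
    have gA: "g \<in> carrier Gp" using g(1) K(2) by blast
    have "act g p \<in> U \<inter> C" "act g (s g) \<in> U \<inter> C"
      using g(2) sg fl p gA unfolding flow_iff by simp_all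
    then have "\<bar>act g p b - act g (s g) b\<bar> \<le> \<epsilon>" if "b \<in> B" for b using U(3) that by simp
    then have "\<forall>b\<in>B. \<bar>p b - s g b\<bar> \<le> \<epsilon>"
      using act_dist_le[OF gA subsetD[OF CX(1) p] subsetD[OF CX(1) sg(1)]] by simp
    moreover have "s g \<in> P" unfolding P_def using g p by blast
    ultimately show "\<exists>q\<in>P. \<forall>b\<in>B. \<bar>p b - q b\<bar> \<le> \<epsilon>" by (rule rev_bexI[rotated])
  qed
qed

end

section \<open>Uniqueness of the minimal subflow and generic conditions\<close>

context stable_flow
begin

definition opp :: "'a monoid" where
  "opp = \<lparr>carrier = carrier Gp, mult = (\<lambda>x y. y \<otimes> x), one = \<one>\<rparr>"

lemma opp_simps [simp]: "carrier opp = carrier Gp" "mult opp = (\<lambda>x y. y \<otimes> x)" "one opp = \<one>"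
  by (simp_all add: opp_def)

lemma group_opp: "group opp"
proof (rule groupI)
  fix x assume "x \<in> carrier opp"
  then show "\<exists>y\<in>carrier opp. y \<otimes>\<^bsub>opp\<^esub> x = \<one>\<^bsub>opp\<^esub>"
    by (intro bexI[of _ "inv x"]) simp_all
qed (simp_all add: m_assoc)

text \<open>As \<open>F\<close> is finite, one \<open>b\<close> occurs infinitely often among the
  parameters. For this \<open>b\<close> the value \<open>f (a \<otimes> x) b\<close> is
  \<open>f x (tr a b)\<close>, so the condition becomes stability of \<open>f\<close> itself with
  the roles of the two sequences exchanged; it is symmetric in them.\<close>

lemma stable_fun_translates:
  assumes F: "finite F" "F \<subseteq> B"
  shows "stable_fun (carrier Gp) (carrier Gp \<times> F) (\<lambda>g (x, b). f (g \<otimes> x) b)"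
  unfolding stable_fun_def
proof (intro allI impI notI)
  fix \<epsilon> :: real
  assume eps: "\<epsilon> > 0" and "\<exists>a d. range a \<subseteq> carrier Gp \<and> range d \<subseteq> carrier Gp \<times> F \<and>
     (\<forall>i j :: nat. i < j \<longrightarrow> \<epsilon> \<le> \<bar>(case d j of (x, b) \<Rightarrow> f (a i \<otimes> x) b) - (case d i of (x, b) \<Rightarrow> f (a j \<otimes> x) b)\<bar>)"
  then obtain a d where ad: "range a \<subseteq> carrier Gp" "range d \<subseteq> carrier Gp \<times> F"
     "\<forall>i j :: nat. i < j \<longrightarrow> \<epsilon> \<le> \<bar>(case d j of (x, b) \<Rightarrow> f (a i \<otimes> x) b) - (case d i of (x, b) \<Rightarrow> f (a j \<otimes> x) b)\<bar>"
    by (elim exE conjE) (rule that)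
  have a: "a i \<in> carrier Gp" for i using ad(1) by blast
  have "d i \<in> carrier Gp \<times> F" for i using ad(2) by blast
  then have d: "fst (d i) \<in> carrier Gp" "snd (d i) \<in> F" for i by (simp_all add: mem_Times_iff)
  have "finite (range (\<lambda>i. snd (d i)))" using d(2) by (intro finite_subset[OF _ F(1)]) auto
  from pigeonhole_infinite[OF infinite_UNIV_nat this]
  obtain n0 where "infinite {n \<in> UNIV. snd (d n) = snd (d n0)}" by auto
  from infinite_enumerate[OF this] obtain r :: "nat \<Rightarrow> nat"
    where r: "strict_mono r" "\<forall>k. r k \<in> {n \<in> UNIV. snd (d n) = snd (d n0)}"
    by (elim exE conjE) (rule that)
  define b where "b = snd (d n0)"
  have dr: "d (r k) = (fst (d (r k)), b)" for k using spec[OF r(2), of k] by (simp add: b_def prod_eq_iff)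
  have b: "b \<in> B" using d(2)[of n0] F(2) by (auto simp: b_def)
  have "tr (a (r k)) b \<in> B" for k by (rule tr_in[OF a b])
  then obtain i j where ij: "i < j"
      "\<bar>f (fst (d (r i))) (tr (a (r j)) b) - f (fst (d (r j))) (tr (a (r i)) b)\<bar> < \<epsilon>"
    using stable_funD[OF stable eps, of "\<lambda>k. fst (d (r k))" "\<lambda>k. tr (a (r k)) b"] d(1) by metis
  have lt: "r i < r j" using r(1) ij(1) by (simp add: strict_mono_less)
  have "\<epsilon> \<le> \<bar>(case (fst (d (r j)), b) of (x, b) \<Rightarrow> f (a (r i) \<otimes> x) b) -
      (case (fst (d (r i)), b) of (x, b) \<Rightarrow> f (a (r j) \<otimes> x) b)\<bar>"
    using ad(3)[rule_format, OF lt] unfolding dr[symmetric] .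
  then show False using ij(2) unfolding f_tr[OF a b d(1)] prod.case by linarith
qed

text \<open>Left multiplication in \<open>opp\<close> is right multiplication in the group, and
  associativity absorbs it into the parameter: \<open>(y, b)\<close> moves to
  \<open>(g \<otimes> y, b)\<close>.\<close>

lemma opposite_flow:
  assumes F: "finite F" "F \<subseteq> B"
  shows "stable_flow opp (carrier Gp \<times> F) (\<lambda>g (x, b). f (g \<otimes> x) b) c"
proof (intro stable_flow.intro stable_flow_axioms.intro group_opp)
  show "\<bar>case d of (x, b) \<Rightarrow> f (a \<otimes> x) b\<bar> \<le> c" if "a \<in> carrier opp" "d \<in> carrier Gp \<times> F" for a d
    using that F(2) by (auto intro!: bounded)
  show "stable_fun (carrier opp) (carrier Gp \<times> F) (\<lambda>g (x, b). f (g \<otimes> x) b)"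
    using stable_fun_translates[OF F] by simp
  show "\<exists>d'\<in>carrier Gp \<times> F. \<forall>x\<in>carrier opp.
      (case d of (y, b) \<Rightarrow> f (g \<otimes>\<^bsub>opp\<^esub> x \<otimes> y) b) = (case d' of (y, b) \<Rightarrow> f (x \<otimes> y) b)"
    if "d \<in> carrier Gp \<times> F" "g \<in> carrier opp" for d g
    using that by (intro bexI[of _ "(g \<otimes> fst d, snd d)"]) (auto simp: m_assoc)
qed

text \<open>
  The translates of \<open>b \<in> F\<close> generate a flow for the opposite group, and \<open>v b\<close> is the value at the
  identity of a point \<open>y\<close> of a minimal subflow of it. This \<open>y\<close> is almost periodic, so up to a small
  error only finitely many translates \<open>h\<close> matter; then the order of the limits that produce \<open>y\<close>
  and \<open>p \<in> C\<close> can be interchanged simultaneously for all of them.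
\<close>

lemma flow_common_value:
  assumes F: "finite F" "F \<subseteq> B" and eps: "\<epsilon> > 0"
  obtains v where "\<And>C. flow C \<Longrightarrow> \<exists>p\<in>C. \<forall>b\<in>F. \<bar>p b - v b\<bar> \<le> \<epsilon>"
proof -
  define e where "e = \<epsilon> / 3"
  have e: "e > 0" "\<epsilon> = 3 * e" using eps by (simp_all add: e_def)
  interpret O: stable_flow opp "carrier Gp \<times> F" "\<lambda>g (x, b). f (g \<otimes> x) b" c
    by (rule opposite_flow[OF F])
  obtain D where D: "O.minimal_flow D" using O.minimal_flow_exists[OF O.flow_X] by metis
  then have Dfl: "O.flow D" by (simp add: O.minimal_flow_def)
  then obtain y where y: "y \<in> D" "y \<in> O.X" unfolding O.flow_iff by blast
  have ya: "O.act g y (x, b) = y (g \<otimes> x, b)" if "g \<in> carrier Gp" "x \<in> carrier Gp" "b \<in> F" for g x b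
    using that by (intro O.act_eqI[OF y(2)]) (simp_all add: m_assoc)
  have yD: "O.act g y \<in> D" if "g \<in> carrier Gp" for g
    using Dfl y(1) that unfolding O.flow_iff by simp
  obtain P where P: "finite P" "P \<subseteq> D"
      "\<And>p. p \<in> D \<Longrightarrow> \<exists>q\<in>P. \<forall>d\<in>carrier Gp \<times> F. \<bar>p d - q d\<bar> \<le> e"
    using O.minimal_flow_totally_bounded[OF D e(1)] by metis
  \<comment> \<open>Points of the finite net \<open>P\<close> need not be translates of
    \<open>y\<close>; replacing each by a nearby translate, where there is one, doubles the error
    and yields finitely many group elements \<open>H\<close>.\<close>
  define N where "N = (\<lambda>g q. g \<in> carrier Gp \<and> (\<forall>d\<in>carrier Gp \<times> F. \<bar>O.act g y d - q d\<bar> \<le> e))"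
  define s where "s = (\<lambda>q. SOME g. N g q)"
  define H where "H = s ` {q \<in> P. \<exists>g. N g q}"
  have s: "N (s q) q" if "\<exists>g. N g q" for q unfolding s_def using someI_ex[OF that] .
  have H: "finite H" "H \<subseteq> carrier Gp" using P(1) s by (auto simp: H_def N_def)
  have near: "\<exists>h\<in>H. \<forall>x\<in>carrier Gp. \<forall>b\<in>F. \<bar>y (g \<otimes> x, b) - y (h \<otimes> x, b)\<bar> \<le> 2 * e"
    if g: "g \<in> carrier Gp" for g
  proof -
    obtain q where q: "q \<in> P" "N g q" using P(3)[OF yD[OF g]] g unfolding N_def by metis
    have N: "N (s q) q" using q(2) by (intro s exI)
    have "s q \<in> H" unfolding H_def using q by blast
    moreover have "\<bar>y (g \<otimes> x, b) - y (s q \<otimes> x, b)\<bar> \<le> 2 * e" if "x \<in> carrier Gp" "b \<in> F" for x b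
    proof -
      have "(x, b) \<in> carrier Gp \<times> F" using that by simp
      then have "\<bar>O.act g y (x, b) - q (x, b)\<bar> \<le> e" "\<bar>O.act (s q) y (x, b) - q (x, b)\<bar> \<le> e"
        using q(2) N unfolding N_def by simp_all
      moreover have "s q \<in> carrier Gp" using N by (simp add: N_def)
      ultimately show ?thesis using ya[OF g that] ya[OF _ that, of "s q"] by simp
    qed
    ultimately show ?thesis by (intro bexI[of _ "s q"] ballI)
  qed
  show ?thesis
  proof (rule that[of "\<lambda>b. y (\<one>, b)"])
    fix C assume C: "flow C"
    then obtain p where p: "p \<in> C" "p \<in> X" unfolding flow_iff by blast
    \<comment> \<open>All entries of one \<open>bs\<close> come from the same \<open>g\<close>, so
      that for fixed \<open>h\<close> they can be read off from the single point
      \<open>act (g \<otimes> h) p\<close> of \<open>C\<close>.\<close>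
    define BB where "BB = {bs. \<exists>g\<in>carrier Gp. \<forall>h\<in>H. \<forall>b\<in>F. bs (h, b) = tr (g \<otimes> h) b}"
    have "\<exists>a\<in>carrier Gp. \<exists>bs\<in>BB. \<forall>i\<in>H \<times> F. \<bar>(case i of (h, b) \<Rightarrow> y (h \<otimes> a, b)) - p (bs i)\<bar> \<le> e"
    proof (rule stable_interchange[OF stable _ p(2) _ _ _ e(1)])
      show "\<bar>f a b\<bar> \<le> c" if "a \<in> carrier Gp" "b \<in> B" for a b using that by (rule bounded)
      show "finite (H \<times> F)" using H F by simp
      show "bs i \<in> B" if "bs \<in> BB" and iHF: "i \<in> H \<times> F" for bs i
      proof -
        have "\<exists>g\<in>carrier Gp. \<forall>h\<in>H. \<forall>b\<in>F. bs (h, b) = tr (g \<otimes> h) b"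
          using \<open>bs \<in> BB\<close> unfolding BB_def by (rule CollectD)
        then obtain g where g: "g \<in> carrier Gp" "\<forall>h\<in>H. \<forall>b\<in>F. bs (h, b) = tr (g \<otimes> h) b"
          by (rule bexE)
        obtain h b where i: "i = (h, b)" "h \<in> H" "b \<in> F" using iHF by (rule SigmaE) simp
        then have "h \<in> carrier Gp" "b \<in> B" using H(2) F(2) by auto
        then show ?thesis using g i by (simp add: tr_in)
      qed
      fix A0 and \<delta> :: real
      assume A0: "finite A0" "A0 \<subseteq> carrier Gp" "\<delta> > 0"
      define E where "E = (\<lambda>(h, b, a). (h \<otimes> a, b)) ` (H \<times> F \<times> A0)"
      have "finite E" "E \<subseteq> carrier Gp \<times> F" using A0 H F unfolding E_def by auto
      from local_types_approx[OF y(2) this A0(3)]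
      obtain g where g: "g \<in> carrier Gp"
        "\<And>d. d \<in> E \<Longrightarrow> \<bar>(case d of (x, b) \<Rightarrow> f (g \<otimes> x) b) - y d\<bar> < \<delta>" by (metis opp_simps(1))
      define bs where "bs = (\<lambda>(h, b). tr (g \<otimes> h) b)"
      have "bs \<in> BB" unfolding BB_def bs_def using g(1) by auto
      moreover have "\<bar>f a (bs i) - (case i of (h, b) \<Rightarrow> y (h \<otimes> a, b))\<bar> < \<delta>"
        if "a \<in> A0" and iHF: "i \<in> H \<times> F" for a i
      proof -
        obtain h b where i: "i = (h, b)" "h \<in> H" "b \<in> F" using iHF by (rule SigmaE) simp
        have mem: "h \<in> carrier Gp" "a \<in> carrier Gp" "b \<in> B" using i \<open>a \<in> A0\<close> H(2) A0(2) F(2) by auto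
        have "(h \<otimes> a, b) \<in> E" unfolding E_def using i \<open>a \<in> A0\<close> by (intro image_eqI[of _ _ "(h, b, a)"]) simp_all
        from g(2)[OF this] show ?thesis
          using mem g(1) by (simp add: i(1) bs_def f_tr m_assoc)
      qed
      ultimately show "\<exists>bs\<in>BB. \<forall>a\<in>A0. \<forall>i\<in>H \<times> F. \<bar>f a (bs i) - (case i of (h, b) \<Rightarrow> y (h \<otimes> a, b))\<bar> < \<delta>"
        by (intro bexI[of _ bs] ballI)
    qed
    then obtain a bs where a: "a \<in> carrier Gp" "bs \<in> BB"
        "\<forall>i\<in>H \<times> F. \<bar>(case i of (h, b) \<Rightarrow> y (h \<otimes> a, b)) - p (bs i)\<bar> \<le> e"
      by (elim bexE) (rule that)
    have "\<exists>g\<in>carrier Gp. \<forall>h\<in>H. \<forall>b\<in>F. bs (h, b) = tr (g \<otimes> h) b"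
      using a(2) unfolding BB_def by (rule CollectD)
    then obtain g where g: "g \<in> carrier Gp" "\<And>h b. h \<in> H \<Longrightarrow> b \<in> F \<Longrightarrow> bs (h, b) = tr (g \<otimes> h) b"
      by auto
    \<comment> \<open>\<open>h\<close> replaces \<open>inv a\<close>: the value of \<open>y\<close>
      at \<open>h \<otimes> a\<close> is within \<open>2 * e\<close> of that at
      \<open>inv a \<otimes> a\<close>, the identity. Since \<open>a\<close> appears only after the
      interchange, the interchange had to cover all of \<open>H\<close>.\<close>
    obtain h where h: "h \<in> H" "\<forall>x\<in>carrier Gp. \<forall>b\<in>F. \<bar>y (inv a \<otimes> x, b) - y (h \<otimes> x, b)\<bar> \<le> 2 * e"
      using near[OF inv_closed[OF a(1)]] by (rule bexE)
    have "\<bar>act (g \<otimes> h) p b - y (\<one>, b)\<bar> \<le> \<epsilon>" if b: "b \<in> F" for b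
    proof -
      have "act (g \<otimes> h) p b = p (bs (h, b))" using b F(2) g(2)[OF h(1) b] by (auto simp: act_apply)
      moreover have "\<bar>y (h \<otimes> a, b) - p (bs (h, b))\<bar> \<le> e" using a(3) h(1) b by auto
      moreover have "\<bar>y (\<one>, b) - y (h \<otimes> a, b)\<bar> \<le> 2 * e" using h(2) a(1) b by fastforce
      ultimately show ?thesis using e(2) by linarith
    qed
    moreover have "act (g \<otimes> h) p \<in> C" using C p(1) g(1) h(1) H(2) unfolding flow_iff by auto
    ultimately show "\<exists>p\<in>C. \<forall>b\<in>F. \<bar>p b - y (\<one>, b)\<bar> \<le> \<epsilon>" by (intro bexI[of _ "act (g \<otimes> h) p"] ballI)
  qed
qed

text \<open>If they were disjoint, compactness of \<open>C\<close> would separate it from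
  \<open>D\<close> on finitely many parameters with a positive margin, against the common
  approximate value on these parameters.\<close>

lemma flows_meet:
  assumes C: "flow C" and D: "flow D"
  shows "C \<inter> D \<noteq> {}"
proof
  assume disj: "C \<inter> D = {}"
  have Cc: "compactin (powertop_real B) C" by (rule flow_compactin[OF C])
  have Cext: "p \<in> extensional B" if "p \<in> C" for p
    using C that local_types_ext unfolding flow_iff by blast
  have Dext: "p \<in> extensional B" if "p \<in> D" for p
    using D that local_types_ext unfolding flow_iff by blast
  have op: "openin (powertop_real B) (topspace (powertop_real B) - D)"
    using D unfolding flow_iff closedin_def by blast
  have "\<exists>E e. finite E \<and> E \<subseteq> B \<and> e > 0 \<and> (\<forall>q\<in>D. \<exists>b\<in>E. e \<le> \<bar>q b - p b\<bar>)" if p: "p \<in> C" for p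
  proof -
    have "p \<in> topspace (powertop_real B) - D" using p disj Cext[OF p] by (auto simp: PiE_def)
    from powertop_nbhd[OF op this] obtain E e where E: "finite E" "E \<subseteq> B" "e > 0"
        "\<And>q. q \<in> extensional B \<Longrightarrow> \<forall>b\<in>E. \<bar>q b - p b\<bar> < e \<Longrightarrow> q \<in> topspace (powertop_real B) - D" by metis
    have "\<exists>b\<in>E. e \<le> \<bar>q b - p b\<bar>" if q: "q \<in> D" for q
    proof (rule ccontr)
      assume "\<not> (\<exists>b\<in>E. e \<le> \<bar>q b - p b\<bar>)"
      then have "\<forall>b\<in>E. \<bar>q b - p b\<bar> < e" by (simp add: not_le)
      from E(4)[OF Dext[OF q] this] q show False by simp
    qed
    with E(1-3) show ?thesis by (intro exI[of _ E] exI[of _ e]) simp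
  qed
  then obtain E e where E: "\<And>p. p \<in> C \<Longrightarrow> finite (E p)" "\<And>p. p \<in> C \<Longrightarrow> E p \<subseteq> B" "\<And>p. p \<in> C \<Longrightarrow> e p > 0"
      "\<And>p q. p \<in> C \<Longrightarrow> q \<in> D \<Longrightarrow> \<exists>b\<in>E p. e p \<le> \<bar>q b - p b\<bar>" by metis
  define W where "W = (\<lambda>p. {q \<in> extensional B. \<forall>b\<in>E p. \<bar>q b - p b\<bar> < e p / 2})"
  have opW: "openin (powertop_real B) (W p)" if "p \<in> C" for p
    unfolding W_def by (rule openin_powertop_box[OF E(1,2)[OF that]])
  have "p \<in> W p" if "p \<in> C" for p unfolding W_def using Cext[OF that] E(3)[OF that] by simp
  then have "C \<subseteq> \<Union>(W ` C)" by blast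
  then obtain \<F> where FF: "finite \<F>" "\<F> \<subseteq> W ` C" "C \<subseteq> \<Union>\<F>"
    using compactinD[OF Cc, of "W ` C"] opW by auto
  obtain P where P: "P \<subseteq> C" "finite P" "\<F> = W ` P" using finite_subset_image[OF FF(1,2)] by metis
  define F where "F = \<Union>(E ` P)"
  have F: "finite F" "F \<subseteq> B" unfolding F_def using P(1,2) E(1,2) by auto
  \<comment> \<open>Half of each margin \<open>e p\<close> is the radius of \<open>W p\<close>; the
    other half has to absorb two errors \<epsilon> at \<open>v\<close>.\<close>
  define \<epsilon> where "\<epsilon> = Min (insert 1 (e ` P)) / 4"
  have "Min (insert 1 (e ` P)) > 0" using P(1,2) E(3) by auto
  then have eps: "\<epsilon> > 0" by (simp add: \<epsilon>_def)
  have eps_le: "4 * \<epsilon> \<le> e p" if "p \<in> P" for p unfolding \<epsilon>_def using P(2) that by auto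
  obtain v where v: "\<And>C. flow C \<Longrightarrow> \<exists>p\<in>C. \<forall>b\<in>F. \<bar>p b - v b\<bar> \<le> \<epsilon>"
    using flow_common_value[OF F eps] by metis
  obtain p where p: "p \<in> C" "\<forall>b\<in>F. \<bar>p b - v b\<bar> \<le> \<epsilon>" using v[OF C] by (rule bexE)
  obtain q where q: "q \<in> D" "\<forall>b\<in>F. \<bar>q b - v b\<bar> \<le> \<epsilon>" using v[OF D] by (rule bexE)
  have "p \<in> \<Union>(W ` P)" using p(1) FF(3) P(3) by blast
  then obtain p0 where p0: "p0 \<in> P" "p \<in> W p0" by (rule UN_E)
  have p0C: "p0 \<in> C" using p0(1) P(1) by blast
  obtain b where b: "b \<in> E p0" "e p0 \<le> \<bar>q b - p0 b\<bar>" using E(4)[OF p0C q(1)] by (rule bexE)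
  have "b \<in> F" unfolding F_def using b(1) p0(1) by blast
  then have "\<bar>p b - v b\<bar> \<le> \<epsilon>" "\<bar>q b - v b\<bar> \<le> \<epsilon>" using p(2) q(2) by simp_all
  moreover have "\<bar>p b - p0 b\<bar> < e p0 / 2" using p0(2) b(1) by (simp add: W_def)
  ultimately show False using b(2) eps_le[OF p0(1)] by argo
qed

text \<open>\<open>D\<close> is an arbitrary flow: besides uniqueness, what is used later is that
  the minimal flow lies inside every flow.\<close>

lemma minimal_flow_unique:
  assumes C: "minimal_flow C" and D: "flow D"
  shows "C \<subseteq> D"
proof -
  have fC: "flow C" using C by (simp add: minimal_flow_def)
  have "flow (C \<inter> D)"
    using fC D flows_meet[OF fC D] unfolding flow_iff by auto
  then have "C \<inter> D = C" using C unfolding minimal_flow_def by simp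
  then show ?thesis by blast
qed

definition Cmin :: "('b \<Rightarrow> real) set" where
  "Cmin = (THE C. minimal_flow C)"

lemma minimal_flow_Cmin: "minimal_flow Cmin"
proof -
  obtain C where C: "minimal_flow C" using minimal_flow_exists[OF flow_X] by metis
  have "D = C" if "minimal_flow D" for D
  proof (rule subset_antisym)
    show "D \<subseteq> C" by (rule minimal_flow_unique[OF that]) (use C in \<open>simp add: minimal_flow_def\<close>)
    show "C \<subseteq> D" by (rule minimal_flow_unique[OF C]) (use that in \<open>simp add: minimal_flow_def\<close>)
  qed
  with C show ?thesis unfolding Cmin_def by (rule theI)
qed

lemma flow_Cmin: "flow Cmin"
  using minimal_flow_Cmin by (simp add: minimal_flow_def)

lemma Cmin_subset: "Cmin \<subseteq> X"
  using flow_Cmin by (simp add: flow_iff)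

section \<open>Generic conditions\<close>

text \<open>The set of group elements satisfying the conditions is syndetic. Only elements of the
  group are quantified, not types, which brings this within reach of formulas. Parameters are an
  indexed family because transferred ones may coincide.\<close>

definition generic :: "'i set \<Rightarrow> ('i \<Rightarrow> 'b) \<Rightarrow> ('i \<Rightarrow> real) \<Rightarrow> real \<Rightarrow> bool" where
  "generic J bs r \<epsilon> \<longleftrightarrow> (\<exists>K. finite K \<and> K \<subseteq> carrier Gp \<and>
     (\<forall>x\<in>carrier Gp. \<exists>h\<in>K. \<forall>j\<in>J. \<bar>f (h \<otimes> x) (bs j) - r j\<bar> < \<epsilon>))"

text \<open>Types whose orbit avoids the neighbourhood \<open>U\<close> of \<open>p\<close> would
  form a subflow, which would contain \<open>Cmin\<close> and hence \<open>p\<close>. So finitely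
  many translates of \<open>U\<close> cover the whole type space, in particular the realized
  types.\<close>

lemma generic_Cmin:
  assumes p: "p \<in> Cmin" and J: "finite J" "bs ` J \<subseteq> B" and eps: "\<epsilon> > 0"
  shows "generic J bs (\<lambda>j. p (bs j)) \<epsilon>"
proof -
  define F where "F = bs ` J"
  have F: "finite F" "F \<subseteq> B" using J by (simp_all add: F_def)
  define U where "U = {q \<in> extensional B. \<forall>b\<in>F. \<bar>q b - p b\<bar> < \<epsilon>}"
  have U: "openin (powertop_real B) U" unfolding U_def by (rule openin_powertop_box[OF F])
  have pX: "p \<in> X" using p Cmin_subset by blast
  then have pU: "p \<in> U" using eps local_types_ext[OF pX] by (simp add: U_def)
  define D where "D = {q \<in> X. \<forall>g\<in>carrier Gp. act g q \<notin> U}"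
  have "p \<notin> D" unfolding D_def using pU act_one[OF pX] one_closed by force
  have "D = {}"
  proof (rule ccontr)
    assume "D \<noteq> {}"
    then have "flow D" unfolding flow_iff using flow_avoiding[OF flow_X U] unfolding D_def by auto
    from minimal_flow_unique[OF minimal_flow_Cmin this] p \<open>p \<notin> D\<close> show False by blast
  qed
  then have "\<exists>g\<in>carrier Gp. act g q \<in> U" if "q \<in> X" for q using that unfolding D_def by blast
  then obtain K where K: "finite K" "K \<subseteq> carrier Gp" "\<And>q. q \<in> X \<Longrightarrow> \<exists>g\<in>K. act g q \<in> U"
    using flow_finite_cover[OF flow_X U] by metis
  have "\<exists>h\<in>K. \<forall>j\<in>J. \<bar>f (h \<otimes> x) (bs j) - p (bs j)\<bar> < \<epsilon>" if x: "x \<in> carrier Gp" for x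
  proof -
    obtain h where h: "h \<in> K" "act h (restrict (f x) B) \<in> U"
      using K(3)[OF realized_local_type[OF x]] by (rule bexE)
    have "\<bar>f (h \<otimes> x) b - p b\<bar> < \<epsilon>" if b: "b \<in> F" for b
    proof -
      have bB: "b \<in> B" and hA: "h \<in> carrier Gp" using b F(2) h(1) K(2) by auto
      have "act h (restrict (f x) B) b = f (h \<otimes> x) b"
        using tr_in[OF hA bB] f_tr[OF hA bB x] by (simp add: act_apply[OF bB])
      moreover have "\<bar>act h (restrict (f x) B) b - p b\<bar> < \<epsilon>" using h(2) b by (simp add: U_def)
      ultimately show ?thesis by simp
    qed
    with h(1) show ?thesis by (intro bexI[of _ h] ballI) (simp_all add: F_def)
  qed
  with K(1,2) show ?thesis unfolding generic_def by (intro exI[of _ K]) simp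
qed

text \<open>Take any \<open>q\<close> in the flow. If every \<open>h\<close> in the finite set
  \<open>K\<close> moved \<open>q\<close> to a type violating the bound, a group element
  approximating \<open>q\<close> at finitely many translated parameters would violate genericity.
  The strict bound weakens to \<le> in the limit.\<close>

lemma generic_imp_flow_value:
  assumes C: "flow C" and g: "generic J bs r \<epsilon>" and J: "finite J" "bs ` J \<subseteq> B"
  obtains p where "p \<in> C" "\<And>j. j \<in> J \<Longrightarrow> \<bar>p (bs j) - r j\<bar> \<le> \<epsilon>"
proof -
  obtain K where K: "finite K" "K \<subseteq> carrier Gp"
      "\<forall>x\<in>carrier Gp. \<exists>h\<in>K. \<forall>j\<in>J. \<bar>f (h \<otimes> x) (bs j) - r j\<bar> < \<epsilon>"
    using g unfolding generic_def by (elim exE conjE) (rule that)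
  obtain q where q: "q \<in> C" "q \<in> X" using C unfolding flow_iff by blast
  have "\<exists>h\<in>K. \<forall>j\<in>J. \<bar>act h q (bs j) - r j\<bar> \<le> \<epsilon>"
  proof (rule ccontr)
    assume "\<not> ?thesis"
    then have "\<forall>h\<in>K. \<exists>j\<in>J. \<bar>act h q (bs j) - r j\<bar> > \<epsilon>" by (simp add: not_le)
    then obtain \<beta> where \<beta>: "\<And>h. h \<in> K \<Longrightarrow> \<beta> h \<in> J" "\<And>h. h \<in> K \<Longrightarrow> \<bar>act h q (bs (\<beta> h)) - r (\<beta> h)\<bar> > \<epsilon>"
      by metis
    have KB: "h \<in> carrier Gp" "bs (\<beta> h) \<in> B" if "h \<in> K" for h using \<beta>(1)[OF that] that K(2) J(2) by auto
    define e where "e = Min (insert 1 ((\<lambda>h. \<bar>act h q (bs (\<beta> h)) - r (\<beta> h)\<bar> - \<epsilon>) ` K))"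
    have e: "e > 0" unfolding e_def using K(1) \<beta>(2) by auto
    have e_le: "e \<le> \<bar>act h q (bs (\<beta> h)) - r (\<beta> h)\<bar> - \<epsilon>" if "h \<in> K" for h
      unfolding e_def using K(1) that by auto
    define E where "E = (\<lambda>h. tr h (bs (\<beta> h))) ` K"
    have "finite E" "E \<subseteq> B" unfolding E_def using K(1) tr_in KB by auto
    from local_types_approx[OF q(2) this e]
    obtain x where x: "x \<in> carrier Gp" "\<And>b. b \<in> E \<Longrightarrow> \<bar>f x b - q b\<bar> < e" by metis
    obtain h where h: "h \<in> K" "\<forall>j\<in>J. \<bar>f (h \<otimes> x) (bs j) - r j\<bar> < \<epsilon>" using K(3) x(1) by metis
    have "\<bar>f x (tr h (bs (\<beta> h))) - q (tr h (bs (\<beta> h)))\<bar> < e" using h(1) by (intro x(2)) (auto simp: E_def)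
    then have "\<bar>f (h \<otimes> x) (bs (\<beta> h)) - act h q (bs (\<beta> h))\<bar> < e"
      using f_tr[OF KB[OF h(1)] x(1)] act_apply[OF KB(2)[OF h(1)]] by simp
    moreover have "\<bar>f (h \<otimes> x) (bs (\<beta> h)) - r (\<beta> h)\<bar> < \<epsilon>" using h(2) \<beta>(1)[OF h(1)] by simp
    ultimately show False using e_le[OF h(1)] by linarith
  qed
  then obtain h where h: "h \<in> K" "\<forall>j\<in>J. \<bar>act h q (bs j) - r j\<bar> \<le> \<epsilon>" by (rule bexE)
  have "act h q \<in> C" using C q(1) h(1) K(2) unfolding flow_iff by auto
  then show ?thesis using that[of "act h q"] h(2) by simp
qed

end

section \<open>Expanding maps between compact spaces\<close>

lemma expanding_iterate:
  assumes T: "\<And>x. x \<in> M \<Longrightarrow> T x \<in> M"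
    and ex: "\<And>x y. x \<in> M \<Longrightarrow> y \<in> M \<Longrightarrow> (d x y :: real) \<le> d (T x) (T y)"
    and xy: "x \<in> M" "y \<in> M"
  shows "(T ^^ n) x \<in> M \<and> (T ^^ n) y \<in> M \<and> d x y \<le> d ((T ^^ n) x) ((T ^^ n) y)"
proof (induction n)
  case (Suc n)
  with ex[of "(T ^^ n) x" "(T ^^ n) y"] show ?case by (auto simp: T)
qed (simp add: xy)

text \<open>Two iterates fall near the same point of a finite net, and expansion pulls their
  closeness back to the start. Pigeonhole on pairs of net points makes \<open>x\<close> and
  \<open>y\<close> return at the same time.\<close>

lemma expanding_recurrence:
  assumes M: "Metric_space M d" and tb: "Metric_space.mtotally_bounded M d M"
    and T: "\<And>x. x \<in> M \<Longrightarrow> T x \<in> M"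
    and ex: "\<And>x y. x \<in> M \<Longrightarrow> y \<in> M \<Longrightarrow> d x y \<le> d (T x) (T y)"
    and xy: "x \<in> M" "y \<in> M" and e: "\<epsilon> > 0"
  shows "\<exists>k. d x ((T ^^ Suc k) x) < \<epsilon> \<and> d y ((T ^^ Suc k) y) < \<epsilon>"
proof -
  interpret Metric_space M d by (rule M)
  obtain K where K: "finite K" "K \<subseteq> M" "M \<subseteq> (\<Union>x\<in>K. mball x (\<epsilon> / 2))"
    using tb e unfolding mtotally_bounded_def by (meson half_gt_zero)
  have Tn: "(T ^^ n) z \<in> M" if "z \<in> M" for n z by (induction n) (simp_all add: that T)
  have "\<forall>n. \<exists>c. c \<in> K \<times> K \<and> (T ^^ n) x \<in> mball (fst c) (\<epsilon> / 2) \<and> (T ^^ n) y \<in> mball (snd c) (\<epsilon> / 2)"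
  proof
    fix n
    obtain u where u: "u \<in> K" "(T ^^ n) x \<in> mball u (\<epsilon> / 2)" using K(3) Tn[OF xy(1), of n] by blast
    obtain v where v: "v \<in> K" "(T ^^ n) y \<in> mball v (\<epsilon> / 2)" using K(3) Tn[OF xy(2), of n] by blast
    from u v show "\<exists>c. c \<in> K \<times> K \<and> (T ^^ n) x \<in> mball (fst c) (\<epsilon> / 2) \<and> (T ^^ n) y \<in> mball (snd c) (\<epsilon> / 2)"
      by (intro exI[of _ "(u, v)"]) simp
  qed
  from choice[OF this] obtain \<kappa> where \<kappa>: "\<And>n. \<kappa> n \<in> K \<times> K"
      "\<And>n. (T ^^ n) x \<in> mball (fst (\<kappa> n)) (\<epsilon> / 2)" "\<And>n. (T ^^ n) y \<in> mball (snd (\<kappa> n)) (\<epsilon> / 2)" by auto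
  have "\<not> inj \<kappa>"
  proof
    assume "inj \<kappa>"
    then have "infinite (range \<kappa>)" using finite_imageD infinite_UNIV_nat by blast
    moreover have "finite (range \<kappa>)"
    proof (rule finite_subset)
      show "range \<kappa> \<subseteq> K \<times> K" using \<kappa>(1) by (rule image_subsetI)
      show "finite (K \<times> K)" using K(1) by simp
    qed
    ultimately show False by simp
  qed
  then obtain i j where ij: "i < j" "\<kappa> i = \<kappa> j" by (metis injI linorder_neqE_nat)
  \<comment> \<open>Shifted by one, so that the returning iterate \<open>Suc k\<close> applies
    \<open>T\<close> at least once.\<close>
  define k where "k = j - Suc i"
  have j: "j = i + Suc k" using ij(1) by (simp add: k_def)
  have near: "d z ((T ^^ Suc k) z) < \<epsilon>"
    if z: "z \<in> M" and u: "(T ^^ i) z \<in> mball u (\<epsilon> / 2)" "(T ^^ j) z \<in> mball u (\<epsilon> / 2)" for z u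
  proof -
    have "d z ((T ^^ Suc k) z) \<le> d ((T ^^ i) z) ((T ^^ i) ((T ^^ Suc k) z))"
      using expanding_iterate[of M T d, OF T ex z Tn[OF z], of i "Suc k"] by simp
    also have "(T ^^ i) ((T ^^ Suc k) z) = (T ^^ j) z" unfolding j funpow_add by simp
    also have "d ((T ^^ i) z) ((T ^^ j) z) < \<epsilon>"
      using triangle''[of "(T ^^ i) z" u "(T ^^ j) z"] u by simp
    finally show ?thesis .
  qed
  show ?thesis
    using near[OF xy(1) \<kappa>(2)[of i]] near[OF xy(2) \<kappa>(3)[of i]] \<kappa>(2,3)[of j] ij(2) by auto
qed

text \<open>The composites are expanding self-maps of compact spaces, hence isometries with dense image.\<close>

lemma mutually_expanding_homeomorphic:
  assumes M1: "Metric_space M1 d1" and M2: "Metric_space M2 d2"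
    and c1: "compact_space (Metric_space.mtopology M1 d1)"
    and c2: "compact_space (Metric_space.mtopology M2 d2)"
    and h: "\<And>x. x \<in> M1 \<Longrightarrow> h x \<in> M2"
    and hex: "\<And>x y. x \<in> M1 \<Longrightarrow> y \<in> M1 \<Longrightarrow> d1 x y \<le> d2 (h x) (h y)"
    and k: "\<And>x. x \<in> M2 \<Longrightarrow> k x \<in> M1"
    and kex: "\<And>x y. x \<in> M2 \<Longrightarrow> y \<in> M2 \<Longrightarrow> d2 x y \<le> d1 (k x) (k y)"
  shows "Metric_space.mtopology M1 d1 homeomorphic_space Metric_space.mtopology M2 d2"
proof -
  interpret M1: Metric_space M1 d1 by (rule M1)
  interpret M2: Metric_space M2 d2 by (rule M2)
  have tb2: "M2.mtotally_bounded M2"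
    using c2 M2.compactin_imp_mtotally_bounded by (simp add: compact_space_def)
  have tb1: "M1.mtotally_bounded M1"
    using c1 M1.compactin_imp_mtotally_bounded by (simp add: compact_space_def)
  have iso: "d2 (h x) (h y) = d1 x y" if xy: "x \<in> M1" "y \<in> M1" for x y
  proof (rule antisym)
    define T where "T = (\<lambda>u. k (h u))"
    have T: "T u \<in> M1" if "u \<in> M1" for u unfolding T_def using that h k by simp
    have Tex: "d1 u v \<le> d1 (T u) (T v)" if "u \<in> M1" "v \<in> M1" for u v
      unfolding T_def using hex[OF that] kex[OF h[OF that(1)] h[OF that(2)]] by (rule order_trans)
    show "d2 (h x) (h y) \<le> d1 x y"
    proof (rule field_le_epsilon)
      fix \<epsilon> :: real assume e: "\<epsilon> > 0"
      \<comment> \<open>Distances never decrease along the orbit of \<open>T\<close>, yet after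
        \<open>Suc n\<close> steps both points are back up to \<open>\<epsilon> / 2\<close>. So
        nothing was gained on the way, in particular not in the half step by
        \<open>h\<close>.\<close>
      obtain n where n: "d1 x ((T ^^ Suc n) x) < \<epsilon> / 2" "d1 y ((T ^^ Suc n) y) < \<epsilon> / 2"
        using expanding_recurrence[of M1 d1 T, OF M1 tb1 T Tex xy, of "\<epsilon> / 2"] e by auto
      have Tn: "(T ^^ Suc n) x \<in> M1" "(T ^^ Suc n) y \<in> M1"
        using expanding_iterate[of M1 T d1, OF T Tex xy, of "Suc n"] by simp_all
      have "d2 (h x) (h y) \<le> d1 (T x) (T y)" unfolding T_def by (rule kex[OF h[OF xy(1)] h[OF xy(2)]])
      also have "\<dots> \<le> d1 ((T ^^ n) (T x)) ((T ^^ n) (T y))"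
        using expanding_iterate[of M1 T d1, OF T Tex T[OF xy(1)] T[OF xy(2)], of n] by simp
      also have "\<dots> = d1 ((T ^^ Suc n) x) ((T ^^ Suc n) y)" by (simp add: funpow_swap1)
      also have "\<dots> \<le> d1 x y + \<epsilon>"
        using M1.triangle''[OF Tn(1) xy(1) Tn(2)] M1.triangle[OF xy Tn(2)] n by linarith
      finally show "d2 (h x) (h y) \<le> d1 x y + \<epsilon>" .
    qed
    show "d1 x y \<le> d2 (h x) (h y)" by (rule hex[OF xy])
  qed
  have cont: "continuous_map M1.mtopology M2.mtopology h"
    unfolding M1.metric_continuous_map[OF M2]
  proof (intro conjI ballI allI impI)
    show "h ` M1 \<subseteq> M2" using h by blast
    fix a and \<epsilon> :: real assume "a \<in> M1" "\<epsilon> > 0"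
    then show "\<exists>\<delta>>0. \<forall>x. x \<in> M1 \<and> d1 a x < \<delta> \<longrightarrow> d2 (h a) (h x) < \<epsilon>"
      by (intro exI[of _ \<epsilon>]) (simp add: iso)
  qed
  have "h ` M1 = M2"
  proof
    show "h ` M1 \<subseteq> M2" using h by blast
    have "compactin M2.mtopology (h ` M1)"
      using image_compactin[OF _ cont, of M1] c1 by (simp add: compact_space_def)
    then have cl: "closedin M2.mtopology (h ` M1)"
      by (rule compactin_imp_closedin[OF M2.Hausdorff_space_mtopology])
    show "M2 \<subseteq> h ` M1"
    proof
      fix y assume y: "y \<in> M2"
      have "\<exists>z\<in>h ` M1. z \<in> M2.mball y r" if r: "r > 0" for r
      proof -
        define T where "T = (\<lambda>u. h (k u))"
        have T: "T u \<in> M2" if "u \<in> M2" for u unfolding T_def using that h k by simp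
        have Tex: "d2 u v \<le> d2 (T u) (T v)" if "u \<in> M2" "v \<in> M2" for u v
          unfolding T_def using kex[OF that] hex[OF k[OF that(1)] k[OF that(2)]] by (rule order_trans)
        \<comment> \<open>Iterate \<open>Suc n\<close> lies in the image of \<open>h\<close>, so
          recurrence makes \<open>y\<close> a limit of this image, which is closed by
          compactness.\<close>
        obtain n where n: "d2 y ((T ^^ Suc n) y) < r"
          using expanding_recurrence[of M2 d2 T, OF M2 tb2 T Tex y y r] by auto
        have "(T ^^ n) y \<in> M2" using expanding_iterate[of M2 T d2, OF T Tex y y, of n] by simp
        then obtain x where "x \<in> M2" "d2 y (h (k x)) < r"
          using n that[of "(T ^^ n) y"] unfolding T_def by simp
        then show ?thesis using y h k by (intro bexI[of _ "h (k x)"]) simp_all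
      qed
      then have "y \<in> M2.mtopology closure_of (h ` M1)"
        using y by (simp add: M2.metric_closure_of)
      then show "y \<in> h ` M1" using cl by (simp add: closure_of_closedin)
    qed
  qed
  moreover have "inj_on h M1"
  proof (rule inj_onI)
    fix x y assume "x \<in> M1" "y \<in> M1" "h x = h y"
    then have "d1 x y = 0" using iso[of x y] h[of y] by simp
    then show "x = y" using \<open>x \<in> M1\<close> \<open>y \<in> M1\<close> by simp
  qed
  ultimately have "homeomorphic_map M1.mtopology M2.mtopology h"
    by (intro continuous_imp_homeomorphic_map[OF cont c1 M2.Hausdorff_space_mtopology]) simp_all
  then show ?thesis by (rule homeomorphic_map_imp_homeomorphic_space)
qed


text \<open>Tychonoff's theorem for the product of copies of \<open>M2\<close> indexed by the points
  of \<open>M1\<close>: each condition on a pair of points is closed, and \<open>ap\<close>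
  satisfies finitely many at a time. The map obtained need not be continuous a priori.\<close>

lemma expanding_map_exists:
  assumes M1: "Metric_space M1 d1" and M2: "Metric_space M2 d2"
    and c2: "compact_space (Metric_space.mtopology M2 d2)"
    and ap: "\<And>S \<epsilon>. finite S \<Longrightarrow> S \<subseteq> M1 \<Longrightarrow> \<epsilon> > 0 \<Longrightarrow>
      \<exists>h. \<forall>x\<in>S. h x \<in> M2 \<and> (\<forall>y\<in>S. d1 x y \<le> d2 (h x) (h y) + \<epsilon>)"
  shows "\<exists>h. \<forall>x\<in>M1. h x \<in> M2 \<and> (\<forall>y\<in>M1. d1 x y \<le> d2 (h x) (h y))"
proof (cases "M1 = {}")
  case False
  interpret M1: Metric_space M1 d1 by (rule M1)
  interpret M2: Metric_space M2 d2 by (rule M2)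
  obtain z where "z \<in> M1" using False by blast
  then obtain w where w: "w \<in> M2" using ap[of "{z}" 1] by auto
  define PT where "PT = product_topology (\<lambda>_::'a. M2.mtopology) M1"
  have top: "topspace PT = Pi\<^sub>E M1 (\<lambda>_. M2)" by (simp add: PT_def)
  have comp: "compact_space PT" unfolding PT_def compact_space_product_topology using c2 by simp
  define K where "K = (\<lambda>(x, y, e). {h \<in> topspace PT. d2 (h x) (h y) \<in> {d1 x y - e..}})"
  define I where "I = M1 \<times> M1 \<times> {e::real. e > 0}"
  have cl: "closedin PT (K i)" if i: "i \<in> I" for i
  proof -
    obtain x y e where i: "i = (x, y, e)" and xy: "x \<in> M1" "y \<in> M1" using i by (auto simp: I_def)
    have cx: "continuous_map PT M2.mtopology (\<lambda>h. h x)" if "x \<in> M1" for x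
      unfolding PT_def by (rule continuous_map_product_coordinates[OF that])
    have "continuous_map PT euclideanreal (\<lambda>h. d2 (h x) (h y))"
      using continuous_map_mdist[of PT "metric (M2, d2)" "\<lambda>h. h x" "\<lambda>h. h y"] cx[OF xy(1)] cx[OF xy(2)]
      by simp
    then show ?thesis unfolding K_def i prod.case
      by (rule closedin_continuous_map_preimage) simp
  qed
  have fip: "\<Inter>\<F> \<noteq> {}" if F: "finite \<F>" "\<F> \<subseteq> K ` I" for \<F>
  proof -
    obtain J where J: "J \<subseteq> I" "finite J" "\<F> = K ` J" using finite_subset_image[OF F] by metis
    define S where "S = fst ` J \<union> (\<lambda>i. fst (snd i)) ` J"
    have S: "finite S" "S \<subseteq> M1" using J(1,2) by (auto simp: S_def I_def)
    define e where "e = Min (insert 1 ((\<lambda>i. snd (snd i)) ` J))"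
    have e: "e > 0" unfolding e_def using J(1,2) by (auto simp: I_def)
    have e_le: "e \<le> snd (snd i)" if "i \<in> J" for i unfolding e_def using J(2) that by auto
    obtain h where h: "\<forall>x\<in>S. h x \<in> M2 \<and> (\<forall>y\<in>S. d1 x y \<le> d2 (h x) (h y) + e)"
      using ap[OF S e] by (rule exE)
    define h' where "h' = (\<lambda>x\<in>M1. if x \<in> S then h x else w)"
    have "h' \<in> Pi\<^sub>E M1 (\<lambda>_. M2)" using h w by (auto simp: h'_def)
    moreover have h'S: "h' x = h x" if "x \<in> S" for x using that S(2) by (auto simp: h'_def)
    ultimately have "h' \<in> K i" if i: "i \<in> J" for i
    proof -
      obtain x y d where xyd: "i = (x, y, d)" by (cases i)
      have "x \<in> S" "y \<in> S" using i xyd by (force simp: S_def)+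
      then have "d1 x y \<le> d2 (h' x) (h' y) + d" using h e_le[OF i] xyd h'S by fastforce
      then show ?thesis using \<open>h' \<in> Pi\<^sub>E M1 (\<lambda>_. M2)\<close> unfolding K_def xyd top by simp
    qed
    then have "h' \<in> \<Inter>\<F>" unfolding J(3) by blast
    then show ?thesis by blast
  qed
  have "\<Inter>(K ` I) \<noteq> {}"
  proof (rule mp[OF spec[OF comp[unfolded compact_space_fip]]], intro conjI ballI allI impI)
    show "closedin PT C" if "C \<in> K ` I" for C using that by (rule imageE) (simp add: cl)
    show "\<Inter>\<F> \<noteq> {}" if "finite \<F> \<and> \<F> \<subseteq> K ` I" for \<F>
      using that by (intro fip) simp_all
  qed
  then obtain h where h: "h \<in> \<Inter>(K ` I)" by blast
  have hK: "h \<in> K (x, y, e)" if "x \<in> M1" "y \<in> M1" "e > 0" for x y e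
    using h that unfolding I_def by blast
  have "h x \<in> M2" if "x \<in> M1" for x
    using hK[OF that that zero_less_one] that unfolding K_def prod.case top by (auto simp: PiE_iff)
  moreover have "d1 x y \<le> d2 (h x) (h y)" if "x \<in> M1" "y \<in> M1" for x y
  proof (rule field_le_epsilon)
    fix e :: real assume "e > 0"
    then show "d1 x y \<le> d2 (h x) (h y) + e" using hK[OF that, of e] unfolding K_def by simp
  qed
  ultimately show ?thesis by (intro exI[of _ h]) simp
qed simp

text \<open>The truncation at 1 keeps the supremum bounded for arbitrary functions.\<close>

definition sup_dist :: "'b set \<Rightarrow> ('b \<Rightarrow> real) \<Rightarrow> ('b \<Rightarrow> real) \<Rightarrow> real" where
  "sup_dist B p q = (SUP b\<in>B. min 1 \<bar>p b - q b\<bar>)"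

lemma sup_dist_upper: "b \<in> B \<Longrightarrow> min 1 \<bar>p b - q b\<bar> \<le> sup_dist B p q"
  unfolding sup_dist_def by (rule cSUP_upper) (auto intro: bdd_aboveI[of _ 1])

lemma sup_dist_least:
  "B \<noteq> {} \<Longrightarrow> (\<And>b. b \<in> B \<Longrightarrow> min 1 \<bar>p b - q b\<bar> \<le> e) \<Longrightarrow> sup_dist B p q \<le> e"
  unfolding sup_dist_def by (rule cSUP_least)

lemma sup_dist_attained:
  assumes "B \<noteq> {}" "e > 0"
  obtains b where "b \<in> B" "sup_dist B p q \<le> min 1 \<bar>p b - q b\<bar> + e"
proof -
  have "sup_dist B p q - e < sup_dist B p q" using assms(2) by simp
  then have "\<exists>b\<in>B. sup_dist B p q - e < min 1 \<bar>p b - q b\<bar>"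
    unfolding sup_dist_def
    by (subst (asm) less_cSUP_iff[OF assms(1)]) (auto intro: bdd_aboveI[of _ 1])
  then show ?thesis using that by fastforce
qed

lemma Metric_space_sup_dist:
  fixes B :: "'b set"
  assumes B: "B \<noteq> {}" and C: "C \<subseteq> extensional B"
  shows "Metric_space C (sup_dist B)"
proof
  fix p q r :: "'b \<Rightarrow> real"
  obtain b0 where "b0 \<in> B" using B by blast
  from sup_dist_upper[OF this, of p q] show "0 \<le> sup_dist B p q" by linarith
  show "sup_dist B p q = sup_dist B q p" unfolding sup_dist_def by (simp add: abs_minus_commute)
  show "sup_dist B p r \<le> sup_dist B p q + sup_dist B q r"
  proof (rule sup_dist_least[OF B])
    fix b assume "b \<in> B"
    from sup_dist_upper[OF this, of p q] sup_dist_upper[OF this, of q r]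
    show "min 1 \<bar>p b - r b\<bar> \<le> sup_dist B p q + sup_dist B q r" by (auto simp: min_def split: if_splits)
  qed
  assume pq: "p \<in> C" "q \<in> C"
  show "sup_dist B p q = 0 \<longleftrightarrow> p = q"
  proof
    assume 0: "sup_dist B p q = 0"
    show "p = q"
    proof (rule extensionalityI)
      show "p \<in> extensional B" "q \<in> extensional B" using pq C by auto
      show "p b = q b" if "b \<in> B" for b using sup_dist_upper[OF that, of p q] 0 by (auto simp: min_def split: if_splits)
    qed
  next
    assume "p = q"
    then have "sup_dist B p q \<le> 0" by (intro sup_dist_least[OF B]) simp
    with \<open>0 \<le> sup_dist B p q\<close> show "sup_dist B p q = 0" by simp
  qed
qed

section \<open>Totally bounded sets of types\<close>

definition sup_totally_bounded :: "'b set \<Rightarrow> ('b \<Rightarrow> real) set \<Rightarrow> bool" where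
  "sup_totally_bounded B C \<longleftrightarrow>
     (\<forall>\<epsilon>>0. \<exists>P. finite P \<and> P \<subseteq> C \<and> (\<forall>p\<in>C. \<exists>q\<in>P. \<forall>b\<in>B. \<bar>p b - q b\<bar> \<le> \<epsilon>))"

text \<open>\<open>F\<close> contains, for each pair of net points that differ by more than
  \<open>4 * e\<close> somewhere, one place where they do. Types agreeing on \<open>F\<close> up to
  \<open>e\<close> have net points that differ there by at most \<open>3 * e\<close>, hence by at
  most \<open>4 * e\<close> everywhere; the two distances to the net make this
  \<open>6 * e\<close>.\<close>

lemma sup_totally_bounded_finitely_determined:
  assumes tb: "sup_totally_bounded B C" and eps: "\<epsilon> > 0"
  obtains F \<delta> where "finite F" "F \<subseteq> B" "\<delta> > 0"
    "\<And>p q b. p \<in> C \<Longrightarrow> q \<in> C \<Longrightarrow> \<forall>b\<in>F. \<bar>p b - q b\<bar> < \<delta> \<Longrightarrow> b \<in> B \<Longrightarrow> \<bar>p b - q b\<bar> \<le> \<epsilon>"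
proof -
  define e where "e = \<epsilon> / 6"
  have e: "e > 0" "\<epsilon> = 6 * e" using eps by (simp_all add: e_def)
  obtain P where P: "finite P" "P \<subseteq> C" "\<forall>p\<in>C. \<exists>q\<in>P. \<forall>b\<in>B. \<bar>p b - q b\<bar> \<le> e"
    using tb e(1) unfolding sup_totally_bounded_def by meson
  define far where "far = (\<lambda>c b. b \<in> B \<and> \<bar>fst c b - snd c b\<bar> > 4 * e)"
  define w where "w = (\<lambda>c. SOME b. far c b)"
  define F where "F = w ` {c \<in> P \<times> P. \<exists>b. far c b}"
  have w: "far c (w c)" if "\<exists>b. far c b" for c unfolding w_def using someI_ex[OF that] .
  have F: "finite F" "F \<subseteq> B" using P(1) w by (auto simp: F_def far_def)
  have main: "\<bar>p b - q b\<bar> \<le> \<epsilon>"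
    if pq: "p \<in> C" "q \<in> C" and cl: "\<forall>b\<in>F. \<bar>p b - q b\<bar> < e" and b: "b \<in> B" for p q b
  proof -
    obtain p' where p': "p' \<in> P" "\<forall>b\<in>B. \<bar>p b - p' b\<bar> \<le> e" using bspec[OF P(3) pq(1)] by (rule bexE)
    obtain q' where q': "q' \<in> P" "\<forall>b\<in>B. \<bar>q b - q' b\<bar> \<le> e" using bspec[OF P(3) pq(2)] by (rule bexE)
    have "\<not> far (p', q') b"
    proof
      assume "far (p', q') b"
      then have ex: "\<exists>b. far (p', q') b" by (rule exI)
      from w[OF this] have wB: "w (p', q') \<in> B" and
        gap: "\<bar>p' (w (p', q')) - q' (w (p', q'))\<bar> > 4 * e" by (simp_all add: far_def)
      have "w (p', q') \<in> F" unfolding F_def using p'(1) q'(1) ex by (intro imageI) simp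
      with cl have "\<bar>p (w (p', q')) - q (w (p', q'))\<bar> < e" by simp
      with gap bspec[OF p'(2) wB] bspec[OF q'(2) wB] show False using e(1) by linarith
    qed
    then have "\<bar>p' b - q' b\<bar> \<le> 4 * e" using b by (simp add: far_def not_less)
    with bspec[OF p'(2) b] bspec[OF q'(2) b] e(2) show ?thesis by linarith
  qed
  show ?thesis by (rule that[OF F e(1)]) (rule main)
qed

text \<open>Uniform convergence always implies pointwise convergence; total boundedness gives the
  converse, because finitely many coordinates then control all others. So the logic topology is
  metrizable here, however many parameters there are.\<close>

lemma sup_dist_topology:
  assumes B: "B \<noteq> {}" and C: "C \<subseteq> extensional B" and tb: "sup_totally_bounded B C"
  shows "Metric_space.mtopology C (sup_dist B) = subtopology (powertop_real B) C"
proof -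
  interpret Metric_space C "sup_dist B" by (rule Metric_space_sup_dist[OF B C])
  have 1: "openin mtopology U" if U: "openin (subtopology (powertop_real B) C) U" for U
  proof -
    obtain V where V: "openin (powertop_real B) V" "U = V \<inter> C"
      using U unfolding openin_subtopology by metis
    have "\<exists>r>0. mball p r \<subseteq> U" if p: "p \<in> U" for p
    proof -
      have "p \<in> V" using p V(2) by simp
      from powertop_nbhd[OF V(1) this] obtain F \<epsilon> where F: "finite F" "F \<subseteq> B" "\<epsilon> > 0"
        "\<And>q. q \<in> extensional B \<Longrightarrow> \<forall>b\<in>F. \<bar>q b - p b\<bar> < \<epsilon> \<Longrightarrow> q \<in> V" by metis
      have "q \<in> U" if q: "q \<in> mball p (min 1 \<epsilon>)" for q
      proof -
        have qC: "q \<in> C" and lt: "sup_dist B p q < min 1 \<epsilon>" using q by simp_all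
        have "\<bar>q b - p b\<bar> < \<epsilon>" if "b \<in> F" for b
          using sup_dist_upper[OF subsetD[OF F(2) that], of p q] lt by (auto simp: min_def split: if_splits)
        then have "q \<in> V" using F(4)[of q] qC C by blast
        then show ?thesis using qC V(2) by simp
      qed
      then show ?thesis using F(3) by (intro exI[of _ "min 1 \<epsilon>"] conjI subsetI) simp_all
    qed
    then show ?thesis using V(2) unfolding openin_mtopology by simp
  qed
  have 2: "openin (subtopology (powertop_real B) C) U" if U: "openin mtopology U" for U
  proof -
    have UC: "U \<subseteq> C" using U by (simp add: openin_mtopology)
    have "\<exists>V. openin (powertop_real B) V \<and> p \<in> V \<and> V \<inter> C \<subseteq> U" if p: "p \<in> U" for p
    proof -
      have pC: "p \<in> C" using p UC by blast
      obtain r where r: "r > 0" "mball p r \<subseteq> U" using U p unfolding openin_mtopology by blast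
      have "r / 2 > 0" using r(1) by simp
      from sup_totally_bounded_finitely_determined[OF tb this]
      obtain F \<delta> where F: "finite F" "F \<subseteq> B" "\<delta> > 0"
        "\<And>p q b. p \<in> C \<Longrightarrow> q \<in> C \<Longrightarrow> \<forall>b\<in>F. \<bar>p b - q b\<bar> < \<delta> \<Longrightarrow> b \<in> B \<Longrightarrow> \<bar>p b - q b\<bar> \<le> r / 2"
        by metis
      define V where "V = {q \<in> extensional B. \<forall>b\<in>F. \<bar>q b - p b\<bar> < \<delta>}"
      have "openin (powertop_real B) V" unfolding V_def by (rule openin_powertop_box[OF F(1,2)])
      moreover have "p \<in> V" using pC C F(3) by (auto simp: V_def)
      moreover have "q \<in> U" if q: "q \<in> V \<inter> C" for q
      proof -
        have qC: "q \<in> C" and cl: "\<forall>b\<in>F. \<bar>p b - q b\<bar> < \<delta>"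
          using q by (simp_all add: V_def abs_minus_commute)
        have "sup_dist B p q \<le> r / 2"
          by (intro sup_dist_least[OF B] min.coboundedI2) (rule F(4)[OF pC qC cl])
        then have "q \<in> mball p r" using r(1) pC qC by simp
        then show ?thesis using r(2) by blast
      qed
      ultimately show ?thesis by (intro exI[of _ V]) blast
    qed
    then obtain V where V: "\<And>p. p \<in> U \<Longrightarrow> openin (powertop_real B) (V p)" "\<And>p. p \<in> U \<Longrightarrow> p \<in> V p"
        "\<And>p. p \<in> U \<Longrightarrow> V p \<inter> C \<subseteq> U" by metis
    have "U = (\<Union>p\<in>U. V p) \<inter> C" using V(2,3) UC by blast
    moreover have "openin (powertop_real B) (\<Union>p\<in>U. V p)" using V(1) by (intro openin_Union) auto
    ultimately show ?thesis unfolding openin_subtopology by (intro exI[of _ "\<Union>p\<in>U. V p"]) simp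
  qed
  show ?thesis unfolding topology_eq using 1 2 by metis
qed


lemma homeomorphic_by_approximate_expansions:
  assumes B: "B1 \<noteq> {}" "B2 \<noteq> {}" and ext: "C1 \<subseteq> extensional B1" "C2 \<subseteq> extensional B2"
    and tb: "sup_totally_bounded B1 C1" "sup_totally_bounded B2 C2"
    and c: "compactin (powertop_real B1) C1" "compactin (powertop_real B2) C2"
    and ap12: "\<And>S \<epsilon>. finite S \<Longrightarrow> S \<subseteq> C1 \<Longrightarrow> \<epsilon> > 0 \<Longrightarrow>
      \<exists>h. \<forall>p\<in>S. h p \<in> C2 \<and> (\<forall>q\<in>S. sup_dist B1 p q \<le> sup_dist B2 (h p) (h q) + \<epsilon>)"
    and ap21: "\<And>S \<epsilon>. finite S \<Longrightarrow> S \<subseteq> C2 \<Longrightarrow> \<epsilon> > 0 \<Longrightarrow>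
      \<exists>h. \<forall>p\<in>S. h p \<in> C1 \<and> (\<forall>q\<in>S. sup_dist B2 p q \<le> sup_dist B1 (h p) (h q) + \<epsilon>)"
  shows "subtopology (powertop_real B1) C1 homeomorphic_space subtopology (powertop_real B2) C2"
proof -
  note M1 = Metric_space_sup_dist[OF B(1) ext(1)] and M2 = Metric_space_sup_dist[OF B(2) ext(2)]
  note t1 = sup_dist_topology[OF B(1) ext(1) tb(1)] and t2 = sup_dist_topology[OF B(2) ext(2) tb(2)]
  have c1: "compact_space (Metric_space.mtopology C1 (sup_dist B1))"
    unfolding t1 by (rule compact_space_subtopology[OF c(1)])
  have c2: "compact_space (Metric_space.mtopology C2 (sup_dist B2))"
    unfolding t2 by (rule compact_space_subtopology[OF c(2)])
  obtain h where h: "\<forall>x\<in>C1. h x \<in> C2 \<and> (\<forall>y\<in>C1. sup_dist B1 x y \<le> sup_dist B2 (h x) (h y))"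
    using expanding_map_exists[OF M1 M2 c2 ap12] by (rule exE)
  obtain k where k: "\<forall>x\<in>C2. k x \<in> C1 \<and> (\<forall>y\<in>C2. sup_dist B2 x y \<le> sup_dist B1 (k x) (k y))"
    using expanding_map_exists[OF M2 M1 c1 ap21] by (rule exE)
  show ?thesis
    unfolding t1[symmetric] t2[symmetric]
    by (rule mutually_expanding_homeomorphic[OF M1 M2 c1 c2, of h k]) (use h k in simp_all)
qed

section \<open>Substitution and boundedness of formulas\<close>

primrec subst_tm :: "(nat \<Rightarrow> 'f tm) \<Rightarrow> 'f tm \<Rightarrow> 'f tm" where
  "subst_tm \<sigma> (Var i) = \<sigma> i"
| "subst_tm \<sigma> (Fn f ts) = Fn f (map (subst_tm \<sigma>) ts)"

definition lift_subst :: "(nat \<Rightarrow> 'f tm) \<Rightarrow> nat \<Rightarrow> 'f tm" where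
  "lift_subst \<sigma> = case_nat (Var 0) (\<lambda>i. subst_tm (\<lambda>j. Var (Suc j)) (\<sigma> i))"

text \<open>The result is a function of the substitution because a quantifier changes the latter to
  \<open>lift_subst \<sigma>\<close>.\<close>

primrec subst_fm :: "('s, 'f, 'p) fm \<Rightarrow> (nat \<Rightarrow> 'f tm) \<Rightarrow> ('s, 'f, 'p) fm" where
  "subst_fm (Dist s t t') = (\<lambda>\<sigma>. Dist s (subst_tm \<sigma> t) (subst_tm \<sigma> t'))"
| "subst_fm (Pred P ts) = (\<lambda>\<sigma>. Pred P (map (subst_tm \<sigma>) ts))"
| "subst_fm (Conn u \<psi>s) = (\<lambda>\<sigma>. Conn u (map (\<lambda>\<psi>. \<psi> \<sigma>) (map subst_fm \<psi>s)))"
| "subst_fm (Infm s \<psi>) = (\<lambda>\<sigma>. Infm s (subst_fm \<psi> (lift_subst \<sigma>)))"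
| "subst_fm (Supm s \<psi>) = (\<lambda>\<sigma>. Supm s (subst_fm \<psi> (lift_subst \<sigma>)))"

lemma tval_shift: "tval M (a # e) (subst_tm (\<lambda>j. Var (Suc j)) t) = tval M e t"
  by (induction t) (simp_all cong: map_cong)

lemma tval_subst:
  "is_tm L \<Gamma> t s \<Longrightarrow> tval M e (subst_tm \<sigma> t) = tval M (map (\<lambda>i. tval M e (\<sigma> i)) [0..<length \<Gamma>]) t"
proof (induction rule: is_tm.induct)
  case (2 f ts)
  then have "map (\<lambda>t. tval M e (subst_tm \<sigma> t)) ts = map (tval M (map (\<lambda>i. tval M e (\<sigma> i)) [0..<length \<Gamma>])) ts"
    by (auto simp: list_all2_conv_all_nth in_set_conv_nth)
  then show ?case unfolding subst_tm.simps tval.simps map_map comp_def by (rule arg_cong)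
qed simp

lemma is_tm_subst:
  "is_tm L \<Gamma> t s \<Longrightarrow> (\<And>i. i < length \<Gamma> \<Longrightarrow> is_tm L \<Delta> (\<sigma> i) (\<Gamma> ! i)) \<Longrightarrow> is_tm L \<Delta> (subst_tm \<sigma> t) s"
proof (induction rule: is_tm.induct)
  case (2 f ts)
  have "list_all2 (is_tm L \<Delta>) (map (subst_tm \<sigma>) ts) (fdom L f)"
    using 2(2) 2(3) by (auto simp: list_all2_conv_all_nth)
  then show ?case using 2(1) by (simp add: is_tm.intros)
qed simp

lemma is_tm_shift: "is_tm L \<Gamma> t s \<Longrightarrow> is_tm L (s' # \<Gamma>) (subst_tm (\<lambda>j. Var (Suc j)) t) s"
proof (rule is_tm_subst)
  fix i assume "i < length \<Gamma>"
  then show "is_tm L (s' # \<Gamma>) (Var (Suc i)) (\<Gamma> ! i)"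
    using is_tm.intros(1)[of "Suc i" "s' # \<Gamma>" L] by simp
qed

lemma is_tm_lift_subst:
  assumes "\<And>i. i < length \<Gamma> \<Longrightarrow> is_tm L \<Delta> (\<sigma> i) (\<Gamma> ! i)" "i < length (s # \<Gamma>)"
  shows "is_tm L (s # \<Delta>) (lift_subst \<sigma> i) ((s # \<Gamma>) ! i)"
proof (cases i)
  case 0
  then show ?thesis using is_tm.intros(1)[of 0 "s # \<Delta>" L] by (simp add: lift_subst_def)
next
  case (Suc j)
  then show ?thesis using assms by (simp add: lift_subst_def is_tm_shift)
qed

lemma is_fm_subst:
  "is_fm L \<Gamma> \<psi> \<Longrightarrow> (\<And>i. i < length \<Gamma> \<Longrightarrow> is_tm L \<Delta> (\<sigma> i) (\<Gamma> ! i)) \<Longrightarrow> is_fm L \<Delta> (subst_fm \<psi> \<sigma>)"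
proof (induction arbitrary: \<Delta> \<sigma> rule: is_fm.induct)
  case (1 s \<Gamma> t t')
  then show ?case by (simp add: is_fm.intros(1) is_tm_subst)
next
  case (2 P \<Gamma> ts)
  then have "list_all2 (is_tm L \<Delta>) (map (subst_tm \<sigma>) ts) (pdom L P)"
    by (auto simp: list_all2_conv_all_nth is_tm_subst)
  then show ?case using 2(1) by (simp add: is_fm.intros(2))
next
  case (3 u \<psi>s \<Gamma>)
  then show ?case by (auto intro!: is_fm.intros(3))
next
  case (4 s \<Gamma> \<psi>)
  have "is_fm L (s # \<Delta>) (subst_fm \<psi> (lift_subst \<sigma>))"
    by (rule 4(3)) (rule is_tm_lift_subst[OF 4(4)])
  then show ?case using 4(1) by (simp add: is_fm.intros(4))
next
  case (5 s \<Gamma> \<psi>)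
  have "is_fm L (s # \<Delta>) (subst_fm \<psi> (lift_subst \<sigma>))"
    by (rule 5(3)) (rule is_tm_lift_subst[OF 5(4)])
  then show ?case using 5(1) by (simp add: is_fm.intros(5))
qed

lemma map_tval_lift_subst:
  "map (\<lambda>i. tval M (a # e) (lift_subst \<sigma> i)) [0..<length (s # \<Gamma>)] =
   a # map (\<lambda>i. tval M e (\<sigma> i)) [0..<length \<Gamma>]"
proof -
  have "[0..<length (s # \<Gamma>)] = 0 # map Suc [0..<length \<Gamma>]"
    by (simp add: map_Suc_upt upt_conv_Cons del: upt_Suc)
  then show ?thesis by (simp add: lift_subst_def tval_shift comp_def del: upt_Suc)
qed

lemma fval_subst:
  "is_fm L \<Gamma> \<psi> \<Longrightarrow>
   fval M e (subst_fm \<psi> \<sigma>) = fval M (map (\<lambda>i. tval M e (\<sigma> i)) [0..<length \<Gamma>]) \<psi>"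
proof (induction arbitrary: e \<sigma> rule: is_fm.induct)
  case (1 s \<Gamma> t t')
  then show ?case by (simp add: tval_subst[of L \<Gamma>])
next
  case (2 P \<Gamma> ts)
  have "map (\<lambda>t. tval M e (subst_tm \<sigma> t)) ts = map (tval M (map (\<lambda>i. tval M e (\<sigma> i)) [0..<length \<Gamma>])) ts"
  proof (rule map_cong[OF refl])
    fix t assume "t \<in> set ts"
    then obtain s where "is_tm L \<Gamma> t s" using 2(2) by (auto simp: list_all2_conv_all_nth in_set_conv_nth)
    then show "tval M e (subst_tm \<sigma> t) = tval M (map (\<lambda>i. tval M e (\<sigma> i)) [0..<length \<Gamma>]) t"
      by (rule tval_subst)
  qed
  then show ?case unfolding subst_fm.simps fval.simps map_map comp_def by (rule arg_cong)
next
  case (3 u \<psi>s \<Gamma>)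
  have eq: "map (fval M e) (map (\<lambda>\<psi>. subst_fm \<psi> \<sigma>) \<psi>s) = map (fval M (map (\<lambda>i. tval M e (\<sigma> i)) [0..<length \<Gamma>])) \<psi>s"
    using 3(2) by simp
  show ?case
    by (simp only: subst_fm.simps fval.simps map_map comp_def length_map eq[unfolded map_map comp_def])
next
  case (4 s \<Gamma> \<psi>)
  show ?case unfolding subst_fm.simps fval.simps 4(3) map_tval_lift_subst ..
next
  case (5 s \<Gamma> \<psi>)
  show ?case unfolding subst_fm.simps fval.simps 5(3) map_tval_lift_subst ..
qed

section \<open>Tuples and bounds for the values of formulas\<close>

lemma tuples_Nil [simp]: "as \<in> tuples M [] \<longleftrightarrow> as = []"
  by (simp add: tuples_def)

lemma tuples_Cons: "as \<in> tuples M (s # ss) \<longleftrightarrow> (\<exists>a bs. as = a # bs \<and> a \<in> univ M s \<and> bs \<in> tuples M ss)"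
  by (simp add: tuples_def list_all2_Cons2)

lemma Cons_in_tuples [simp]: "a # as \<in> tuples M (s # ss) \<longleftrightarrow> a \<in> univ M s \<and> as \<in> tuples M ss"
  by (simp add: tuples_def)

lemma tuples_append: "as \<in> tuples M ss \<Longrightarrow> bs \<in> tuples M ss' \<Longrightarrow> as @ bs \<in> tuples M (ss @ ss')"
  by (simp add: tuples_def list_all2_appendI)

lemma tuples_length: "as \<in> tuples M ss \<Longrightarrow> length as = length ss"
  by (simp add: tuples_def list_all2_lengthD)

lemma tuples_nth: "as \<in> tuples M ss \<Longrightarrow> i < length ss \<Longrightarrow> as ! i \<in> univ M (ss ! i)"
  by (simp add: tuples_def list_all2_conv_all_nth)

lemma tval_in:
  assumes "is_struct L M" "is_tm L \<Gamma> t s" "e \<in> tuples M \<Gamma>"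
  shows "tval M e t \<in> univ M s"
  using assms(2)
proof (induction rule: is_tm.induct)
  case (1 i)
  then show ?case using tuples_nth[OF assms(3)] by simp
next
  case (2 f ts)
  have "map (tval M e) ts \<in> tuples M (fdom L f)"
    using 2(2) by (auto simp: tuples_def list_all2_conv_all_nth)
  then show ?case using assms(1) 2(1) unfolding is_struct_def by simp
qed

lemma continuous_cube_bounded:
  fixes u :: "(nat \<Rightarrow> real) \<Rightarrow> real"
  assumes "continuous_on UNIV u"
  obtains K where "\<And>s. (\<And>i. \<bar>s i\<bar> \<le> c) \<Longrightarrow> \<bar>u s\<bar> \<le> K"
proof -
  have "compactin (product_topology (\<lambda>_::nat. euclideanreal) UNIV) (Pi\<^sub>E UNIV (\<lambda>_. {-c..c}))"
    unfolding compactin_PiE by simp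
  then have "compact (Pi\<^sub>E (UNIV :: nat set) (\<lambda>_. {-c..c}))"
    unfolding euclidean_product_topology by simp
  then have "bounded (u ` Pi\<^sub>E UNIV (\<lambda>_. {-c..c}))"
    using continuous_on_subset[OF assms] by (intro compact_imp_bounded compact_continuous_image) auto
  then obtain K where K: "\<And>y. y \<in> u ` Pi\<^sub>E UNIV (\<lambda>_. {-c..c}) \<Longrightarrow> norm y \<le> K"
    unfolding bounded_iff by auto
  show ?thesis
  proof (rule that[of K])
    fix s :: "nat \<Rightarrow> real" assume "\<And>i. \<bar>s i\<bar> \<le> c"
    then have "s \<in> Pi\<^sub>E UNIV (\<lambda>_. {-c..c})" by (simp add: PiE_iff abs_le_iff) (meson minus_le_iff)
    then show "\<bar>u s\<bar> \<le> K" using K by fastforce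
  qed
qed

text \<open>Infima and suprema of reals are meaningful over bounded families only, so the reading of
  quantifiers rests on this. For a connective, the arguments stay in a compact cube of
  sequences.\<close>

lemma fval_bounded:
  assumes M: "is_struct L M"
  shows "is_fm L \<Gamma> \<psi> \<Longrightarrow> \<exists>c. \<forall>e\<in>tuples M \<Gamma>. \<bar>fval M e \<psi>\<bar> \<le> c"
proof (induction rule: is_fm.induct)
  case (1 s \<Gamma> t t')
  have ms: "Metric_space (univ M s) (dst M s)"
    and dm: "\<And>a b. a \<in> univ M s \<Longrightarrow> b \<in> univ M s \<Longrightarrow> dst M s a b \<le> diam L s"
    using M 1(1) unfolding is_struct_def by simp_all
  have "\<bar>fval M e (Dist s t t')\<bar> \<le> diam L s" if "e \<in> tuples M \<Gamma>" for e
    using dm[OF tval_in[OF M 1(2) that] tval_in[OF M 1(3) that]] Metric_space.nonneg[OF ms] by simp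
  then show ?case by blast
next
  case (2 P \<Gamma> ts)
  have "\<bar>fval M e (Pred P ts)\<bar> \<le> max \<bar>plow L P\<bar> \<bar>pupp L P\<bar>" if e: "e \<in> tuples M \<Gamma>" for e
  proof -
    have "map (tval M e) ts \<in> tuples M (pdom L P)"
      using 2(2) tval_in[OF M _ e] by (auto simp: tuples_def list_all2_conv_all_nth)
    then have "pr M P (map (tval M e) ts) \<in> {plow L P..pupp L P}"
      using M 2(1) unfolding is_struct_def by blast
    then show ?thesis by auto
  qed
  then show ?case by blast
next
  case (3 u \<psi>s \<Gamma>)
  then have "\<forall>\<psi>\<in>set \<psi>s. \<exists>c. \<forall>e\<in>tuples M \<Gamma>. \<bar>fval M e \<psi>\<bar> \<le> c" by blast
  from bchoice[OF this] obtain c where c: "\<And>\<psi> e. \<psi> \<in> set \<psi>s \<Longrightarrow> e \<in> tuples M \<Gamma> \<Longrightarrow> \<bar>fval M e \<psi>\<bar> \<le> c \<psi>" by auto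
  define k where "k = Max (insert 0 (c ` set \<psi>s))"
  have k: "0 \<le> k" "\<And>\<psi>. \<psi> \<in> set \<psi>s \<Longrightarrow> c \<psi> \<le> k" by (simp_all add: k_def)
  obtain K where K: "\<And>s. (\<And>i. \<bar>s i\<bar> \<le> k) \<Longrightarrow> \<bar>u s\<bar> \<le> K"
    using continuous_cube_bounded[OF 3(1), of k] by metis
  have "\<bar>fval M e (Conn u \<psi>s)\<bar> \<le> K" if e: "e \<in> tuples M \<Gamma>" for e
    unfolding fval.simps
  proof (rule K)
    fix i
    show "\<bar>if i < length \<psi>s then map (fval M e) \<psi>s ! i else 0\<bar> \<le> k"
      using c[OF nth_mem e, of i] k(1) k(2)[OF nth_mem, of i] by auto
  qed
  then show ?case by blast
next
  case (4 s \<Gamma> \<psi>)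
  then obtain c where c: "\<forall>e\<in>tuples M (s # \<Gamma>). \<bar>fval M e \<psi>\<bar> \<le> c" by blast
  have ne: "univ M s \<noteq> {}" using M 4(1) unfolding is_struct_def by blast
  have "\<bar>fval M e (Infm s \<psi>)\<bar> \<le> c" if e: "e \<in> tuples M \<Gamma>" for e
    unfolding fval.simps using c e by (intro cInf_abs_ge) (auto simp: ne)
  then show ?case by blast
next
  case (5 s \<Gamma> \<psi>)
  then obtain c where c: "\<forall>e\<in>tuples M (s # \<Gamma>). \<bar>fval M e \<psi>\<bar> \<le> c" by blast
  have ne: "univ M s \<noteq> {}" using M 5(1) unfolding is_struct_def by blast
  have "\<bar>fval M e (Supm s \<psi>)\<bar> \<le> c" if e: "e \<in> tuples M \<Gamma>" for e
    unfolding fval.simps using c e by (intro cSup_abs_le) (auto simp: ne)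
  then show ?case by blast
qed

section \<open>Definable functions and open conditions\<close>

text \<open>One formula has to serve all structures at once; this is what permits transfer. Later
  conditions are composed as functions of structure and tuple, without writing formulas.\<close>

definition definable :: "('s, 'f, 'p) lang \<Rightarrow> 's list \<Rightarrow>
    (('s, 'f, 'p, 'u) struct \<Rightarrow> 'u list \<Rightarrow> real) \<Rightarrow> bool" where
  "definable L \<Gamma> F \<longleftrightarrow> (\<exists>\<psi>. is_fm L \<Gamma> \<psi> \<and> (\<forall>M e. is_struct L M \<longrightarrow> e \<in> tuples M \<Gamma> \<longrightarrow> F M e = fval M e \<psi>))"

text \<open>Strict inequalities, because \<open>INF < 0\<close> has a witness even if the infimum is not attained.\<close>

definition open_cond :: "('s, 'f, 'p) lang \<Rightarrow> 's list \<Rightarrow>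
    (('s, 'f, 'p, 'u) struct \<Rightarrow> 'u list \<Rightarrow> bool) \<Rightarrow> bool" where
  "open_cond L \<Gamma> P \<longleftrightarrow> (\<exists>F. definable L \<Gamma> F \<and> (\<forall>M e. is_struct L M \<longrightarrow> e \<in> tuples M \<Gamma> \<longrightarrow> (P M e \<longleftrightarrow> F M e < 0)))"

lemma definable_bounded:
  assumes "definable L \<Gamma> F" "is_struct L M"
  obtains c where "\<And>e. e \<in> tuples M \<Gamma> \<Longrightarrow> \<bar>F M e\<bar> \<le> c"
proof -
  obtain \<psi> where \<psi>: "is_fm L \<Gamma> \<psi>" "\<And>e. e \<in> tuples M \<Gamma> \<Longrightarrow> F M e = fval M e \<psi>"
    using assms unfolding definable_def by metis
  obtain c where "\<forall>e\<in>tuples M \<Gamma>. \<bar>fval M e \<psi>\<bar> \<le> c" using fval_bounded[OF assms(2) \<psi>(1)] by blast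
  then show ?thesis using that[of c] \<psi>(2) by simp
qed

lemma definable_fval_subst:
  fixes \<psi> :: "('s, 'f, 'p) fm"
  assumes \<psi>: "is_fm L \<Gamma>' \<psi>" and ts: "list_all2 (is_tm L \<Gamma>) ts \<Gamma>'"
  shows "definable L \<Gamma> (\<lambda>M :: ('s, 'f, 'p, 'u) struct. \<lambda>e. fval M (map (tval M e) ts) \<psi>)"
proof -
  have len: "length ts = length \<Gamma>'" using ts by (rule list_all2_lengthD)
  have "is_fm L \<Gamma> (subst_fm \<psi> (\<lambda>i. ts ! i))"
  proof (rule is_fm_subst[OF \<psi>])
    show "is_tm L \<Gamma> (ts ! i) (\<Gamma>' ! i)" if "i < length \<Gamma>'" for i using list_all2_nthD2[OF ts that] .
  qed
  moreover have "map (\<lambda>i. tval M e (ts ! i)) [0..<length \<Gamma>'] = map (tval M e) ts" for M :: "('s, 'f, 'p, 'u) struct" and e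
    unfolding len[symmetric] by (rule nth_equalityI) simp_all
  ultimately show ?thesis
    unfolding definable_def by (intro exI[of _ "subst_fm \<psi> (\<lambda>i. ts ! i)"]) (simp add: fval_subst[OF \<psi>])
qed

lemma definable_conn:
  fixes u :: "real \<Rightarrow> real \<Rightarrow> real"
  assumes u: "continuous_on UNIV (\<lambda>s :: nat \<Rightarrow> real. u (s 0) (s 1))"
    and F: "definable L \<Gamma> F" and F': "definable L \<Gamma> F'"
  shows "definable L \<Gamma> (\<lambda>M e. u (F M e) (F' M e))"
proof -
  obtain \<psi> where \<psi>: "is_fm L \<Gamma> \<psi>" "\<And>M e. is_struct L M \<Longrightarrow> e \<in> tuples M \<Gamma> \<Longrightarrow> F M e = fval M e \<psi>"
    using F unfolding definable_def by metis
  obtain \<psi>' where \<psi>': "is_fm L \<Gamma> \<psi>'" "\<And>M e. is_struct L M \<Longrightarrow> e \<in> tuples M \<Gamma> \<Longrightarrow> F' M e = fval M e \<psi>'"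
    using F' unfolding definable_def by metis
  have "is_fm L \<Gamma> (Conn (\<lambda>s. u (s 0) (s 1)) [\<psi>, \<psi>'])"
    using \<psi>(1) \<psi>'(1) by (intro is_fm.intros(3)[OF u]) simp
  then show ?thesis
    unfolding definable_def
    by (intro exI[of _ "Conn (\<lambda>s. u (s 0) (s 1)) [\<psi>, \<psi>']"]) (simp add: \<psi>(2) \<psi>'(2))
qed

lemma definable_const: "definable L \<Gamma> (\<lambda>M e. r)"
  unfolding definable_def
  by (intro exI[of _ "Conn (\<lambda>_. r) []"]) (simp add: is_fm.intros(3))

lemma definable_max: "definable L \<Gamma> F \<Longrightarrow> definable L \<Gamma> F' \<Longrightarrow> definable L \<Gamma> (\<lambda>M e. max (F M e) (F' M e))"
  by (rule definable_conn) (intro continuous_on_max continuous_on_product_coordinates)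

lemma definable_min: "definable L \<Gamma> F \<Longrightarrow> definable L \<Gamma> F' \<Longrightarrow> definable L \<Gamma> (\<lambda>M e. min (F M e) (F' M e))"
  by (rule definable_conn) (intro continuous_on_min continuous_on_product_coordinates)

lemma definable_minus: "definable L \<Gamma> F \<Longrightarrow> definable L \<Gamma> F' \<Longrightarrow> definable L \<Gamma> (\<lambda>M e. F M e - F' M e)"
  by (rule definable_conn) (intro continuous_on_diff continuous_on_product_coordinates)

lemma definable_abs: "definable L \<Gamma> F \<Longrightarrow> definable L \<Gamma> (\<lambda>M e. \<bar>F M e\<bar>)"
  by (rule definable_conn[of "\<lambda>x _. \<bar>x\<bar>"])
    (intro continuous_on_rabs continuous_on_product_coordinates)

lemma definable_INF:
  fixes F :: "('s, 'f, 'p, 'u) struct \<Rightarrow> 'u list \<Rightarrow> real"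
  assumes s: "s \<in> sorts L" and F: "definable L (s # \<Gamma>) F"
  shows "definable L \<Gamma> (\<lambda>M e. INF a\<in>univ M s. F M (a # e))"
proof -
  obtain \<psi> where \<psi>: "is_fm L (s # \<Gamma>) \<psi>" "\<And>M e. is_struct L M \<Longrightarrow> e \<in> tuples M (s # \<Gamma>) \<Longrightarrow> F M e = fval M e \<psi>"
    using F unfolding definable_def by metis
  show ?thesis unfolding definable_def
  proof (intro exI[of _ "Infm s \<psi>"] conjI allI impI)
    show "is_fm L \<Gamma> (Infm s \<psi>)" using s \<psi>(1) by (rule is_fm.intros(4))
    fix M :: "('s, 'f, 'p, 'u) struct" and e assume "is_struct L M" "e \<in> tuples M \<Gamma>"
    then have "F M (a # e) = fval M (a # e) \<psi>" if "a \<in> univ M s" for a using that by (simp add: \<psi>(2))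
    then show "(INF a\<in>univ M s. F M (a # e)) = fval M e (Infm s \<psi>)" by (simp cong: INF_cong_simp)
  qed
qed

lemma definable_SUP:
  fixes F :: "('s, 'f, 'p, 'u) struct \<Rightarrow> 'u list \<Rightarrow> real"
  assumes s: "s \<in> sorts L" and F: "definable L (s # \<Gamma>) F"
  shows "definable L \<Gamma> (\<lambda>M e. SUP a\<in>univ M s. F M (a # e))"
proof -
  obtain \<psi> where \<psi>: "is_fm L (s # \<Gamma>) \<psi>" "\<And>M e. is_struct L M \<Longrightarrow> e \<in> tuples M (s # \<Gamma>) \<Longrightarrow> F M e = fval M e \<psi>"
    using F unfolding definable_def by metis
  show ?thesis unfolding definable_def
  proof (intro exI[of _ "Supm s \<psi>"] conjI allI impI)
    show "is_fm L \<Gamma> (Supm s \<psi>)" using s \<psi>(1) by (rule is_fm.intros(5))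
    fix M :: "('s, 'f, 'p, 'u) struct" and e assume "is_struct L M" "e \<in> tuples M \<Gamma>"
    then have "F M (a # e) = fval M (a # e) \<psi>" if "a \<in> univ M s" for a using that by (simp add: \<psi>(2))
    then show "(SUP a\<in>univ M s. F M (a # e)) = fval M e (Supm s \<psi>)" by (simp cong: SUP_cong_simp)
  qed
qed

lemma open_cond_less: "definable L \<Gamma> F \<Longrightarrow> open_cond L \<Gamma> (\<lambda>M e. F M e < r)"
  unfolding open_cond_def
  by (intro exI[of _ "\<lambda>M e. F M e - r"] conjI definable_minus definable_const) simp_all

lemma open_cond_conj:
  assumes "open_cond L \<Gamma> P" "open_cond L \<Gamma> P'"
  shows "open_cond L \<Gamma> (\<lambda>M e. P M e \<and> P' M e)"
proof -
  obtain F F' where "definable L \<Gamma> F" "\<And>M e. is_struct L M \<Longrightarrow> e \<in> tuples M \<Gamma> \<Longrightarrow> P M e \<longleftrightarrow> F M e < 0"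
    "definable L \<Gamma> F'" "\<And>M e. is_struct L M \<Longrightarrow> e \<in> tuples M \<Gamma> \<Longrightarrow> P' M e \<longleftrightarrow> F' M e < 0"
    using assms unfolding open_cond_def by metis
  then show ?thesis unfolding open_cond_def
    by (intro exI[of _ "\<lambda>M e. max (F M e) (F' M e)"]) (simp add: definable_max)
qed

lemma open_cond_ball:
  assumes "finite I" "\<And>i. i \<in> I \<Longrightarrow> open_cond L \<Gamma> (P i)"
  shows "open_cond L \<Gamma> (\<lambda>M e. \<forall>i\<in>I. P i M e)"
  using assms
proof (induction I rule: finite_induct)
  case empty
  show ?case unfolding open_cond_def
    by (intro exI[of _ "\<lambda>M e. -1"]) (simp add: definable_const)
next
  case (insert i I)
  have "open_cond L \<Gamma> (\<lambda>M e. P i M e \<and> (\<forall>i\<in>I. P i M e))"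
    using insert by (intro open_cond_conj) simp_all
  then show ?case by simp
qed

lemma open_cond_ex:
  fixes P :: "('s, 'f, 'p, 'u) struct \<Rightarrow> 'u list \<Rightarrow> bool"
  assumes s: "s \<in> sorts L" and P: "open_cond L (s # \<Gamma>) P"
  shows "open_cond L \<Gamma> (\<lambda>M e. \<exists>a\<in>univ M s. P M (a # e))"
proof -
  obtain F where F: "definable L (s # \<Gamma>) F"
      "\<And>M e. is_struct L M \<Longrightarrow> e \<in> tuples M (s # \<Gamma>) \<Longrightarrow> P M e \<longleftrightarrow> F M e < 0"
    using P unfolding open_cond_def by metis
  show ?thesis unfolding open_cond_def
  proof (intro exI[of _ "\<lambda>M e. INF a\<in>univ M s. F M (a # e)"] conjI definable_INF s F(1) allI impI)
    fix M :: "('s, 'f, 'p, 'u) struct" and e assume M: "is_struct L M" and e: "e \<in> tuples M \<Gamma>"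
    obtain c where c: "\<And>e. e \<in> tuples M (s # \<Gamma>) \<Longrightarrow> \<bar>F M e\<bar> \<le> c"
      using definable_bounded[OF F(1) M] by metis
    have ne: "univ M s \<noteq> {}" using M s unfolding is_struct_def by blast
    have bdd: "bdd_below ((\<lambda>a. F M (a # e)) ` univ M s)"
    proof (rule bdd_belowI[of _ "- c"])
      fix y assume "y \<in> (\<lambda>a. F M (a # e)) ` univ M s"
      then obtain a where "a \<in> univ M s" "y = F M (a # e)" by (rule imageE)
      then show "- c \<le> y" using c[of "a # e"] e by simp
    qed
    show "(\<exists>a\<in>univ M s. P M (a # e)) \<longleftrightarrow> (INF a\<in>univ M s. F M (a # e)) < 0"
      unfolding cINF_less_iff[OF ne bdd] using F(2)[OF M] e by simp
  qed
qed

lemma open_cond_exs: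
  fixes P :: "('s, 'f, 'p, 'u) struct \<Rightarrow> 'u list \<Rightarrow> bool"
  assumes "set \<Delta> \<subseteq> sorts L" and "open_cond L (\<Delta> @ \<Gamma>) P"
  shows "open_cond L \<Gamma> (\<lambda>M e. \<exists>as\<in>tuples M \<Delta>. P M (as @ e))"
  using assms
proof (induction \<Delta> arbitrary: P)
  case Nil
  have "(\<lambda>M e. \<exists>as\<in>tuples M []. P M (as @ e)) = P" by (intro ext) (simp add: Bex_def)
  then show ?case using Nil by simp
next
  case (Cons s \<Delta>)
  have "open_cond L (\<Delta> @ \<Gamma>) (\<lambda>M e. \<exists>a\<in>univ M s. P M (a # e))"
    using Cons.prems by (intro open_cond_ex) simp_all
  then have "open_cond L \<Gamma> (\<lambda>M e. \<exists>as\<in>tuples M \<Delta>. \<exists>a\<in>univ M s. P M (a # (as @ e)))"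
    using Cons.prems(1) by (intro Cons.IH) simp_all
  moreover have "(\<lambda>M e. \<exists>as\<in>tuples M \<Delta>. \<exists>a\<in>univ M s. P M (a # (as @ e))) =
      (\<lambda>M e. \<exists>as\<in>tuples M (s # \<Delta>). P M (as @ e))"
  proof (intro ext iffI)
    fix M e assume "\<exists>as\<in>tuples M \<Delta>. \<exists>a\<in>univ M s. P M (a # (as @ e))"
    then obtain as a where "as \<in> tuples M \<Delta>" "a \<in> univ M s" "P M (a # (as @ e))"
      by (elim bexE) (rule that)
    then show "\<exists>as\<in>tuples M (s # \<Delta>). P M (as @ e)" by (intro bexI[of _ "a # as"]) simp_all
  next
    fix M e assume "\<exists>as\<in>tuples M (s # \<Delta>). P M (as @ e)"
    then obtain as where as: "as \<in> tuples M (s # \<Delta>)" "P M (as @ e)" by (rule bexE)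
    then obtain a bs where "as = a # bs" "a \<in> univ M s" "bs \<in> tuples M \<Delta>"
      unfolding tuples_Cons by blast
    with as(2) show "\<exists>as\<in>tuples M \<Delta>. \<exists>a\<in>univ M s. P M (a # (as @ e))"
      by (intro bexI[of _ bs] bexI[of _ a]) simp_all
  qed
  ultimately show ?case by simp
qed

text \<open>A universal quantifier over a strict inequality is not open. The uniform margin
  \<open>\<delta> < \<epsilon>\<close> turns it into \<open>SUP < \<epsilon>\<close>, which
  is.\<close>

lemma open_cond_SUP:
  fixes F :: "('s, 'f, 'p, 'u) struct \<Rightarrow> 'u list \<Rightarrow> real"
  assumes s: "s \<in> sorts L" and F: "definable L (s # \<Gamma>) F"
  shows "open_cond L \<Gamma> (\<lambda>M e. \<exists>\<delta><\<epsilon>. \<forall>a\<in>univ M s. F M (a # e) \<le> \<delta>)"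
proof -
  have "open_cond L \<Gamma> (\<lambda>M e. (SUP a\<in>univ M s. F M (a # e)) < \<epsilon>)"
    by (rule open_cond_less[OF definable_SUP[OF s F]])
  moreover have "(\<exists>\<delta><\<epsilon>. \<forall>a\<in>univ M s. F M (a # e) \<le> \<delta>) \<longleftrightarrow> (SUP a\<in>univ M s. F M (a # e)) < \<epsilon>"
    if M: "is_struct L M" and e: "e \<in> tuples M \<Gamma>" for M e
  proof -
    obtain c where c: "\<And>e. e \<in> tuples M (s # \<Gamma>) \<Longrightarrow> \<bar>F M e\<bar> \<le> c"
      using definable_bounded[OF F M] by metis
    have ne: "univ M s \<noteq> {}" using M s unfolding is_struct_def by blast
    have bdd: "bdd_above ((\<lambda>a. F M (a # e)) ` univ M s)"
    proof (rule bdd_aboveI[of _ c])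
      fix y assume "y \<in> (\<lambda>a. F M (a # e)) ` univ M s"
      then obtain a where "a \<in> univ M s" "y = F M (a # e)" by (rule imageE)
      then show "y \<le> c" using c[of "a # e"] e by simp
    qed
    show ?thesis
    proof
      assume "\<exists>\<delta><\<epsilon>. \<forall>a\<in>univ M s. F M (a # e) \<le> \<delta>"
      then obtain \<delta> where "\<delta> < \<epsilon>" "\<And>a. a \<in> univ M s \<Longrightarrow> F M (a # e) \<le> \<delta>" by blast
      then show "(SUP a\<in>univ M s. F M (a # e)) < \<epsilon>" using cSUP_least[OF ne, of "\<lambda>a. F M (a # e)" \<delta>] by simp
    next
      assume "(SUP a\<in>univ M s. F M (a # e)) < \<epsilon>"
      then show "\<exists>\<delta><\<epsilon>. \<forall>a\<in>univ M s. F M (a # e) \<le> \<delta>"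
        using cSUP_upper[OF _ bdd] by (intro exI[of _ "SUP a\<in>univ M s. F M (a # e)"]) simp
    qed
  qed
  ultimately show ?thesis unfolding open_cond_def by auto
qed

text \<open>The empty maximum is taken to be 0, hence the restriction to
  \<open>0 \<le> \<delta>\<close>.\<close>

lemma definable_Max:
  assumes "\<And>j. j < k \<Longrightarrow> definable L \<Gamma> (F j)"
  shows "\<exists>H. definable L \<Gamma> H \<and> (\<forall>M e \<delta>. (0::real) \<le> \<delta> \<longrightarrow> (H M e \<le> \<delta> \<longleftrightarrow> (\<forall>j<k::nat. F j M e \<le> \<delta>)))"
  using assms
proof (induction k)
  case 0
  show ?case by (intro exI[of _ "\<lambda>M e. 0"]) (simp add: definable_const)
next
  case (Suc k)
  then obtain H where H: "definable L \<Gamma> H" "\<forall>M e \<delta>. (0::real) \<le> \<delta> \<longrightarrow> (H M e \<le> \<delta> \<longleftrightarrow> (\<forall>j<k. F j M e \<le> \<delta>))"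
    by (metis less_Suc_eq)
  show ?case
    using H(2) definable_max[OF H(1) Suc.prems[of k]]
    by (intro exI[of _ "\<lambda>M e. max (H M e) (F k M e)"]) (auto simp: less_Suc_eq)
qed

text \<open>The empty minimum is taken to be \<epsilon>, hence the restriction to
  \<open>\<delta> < \<epsilon>\<close>.\<close>

lemma definable_Min:
  assumes "\<And>i. i < n \<Longrightarrow> definable L \<Gamma> (F i)"
  shows "\<exists>H. definable L \<Gamma> H \<and> (\<forall>M e \<delta>. \<delta> < (\<epsilon>::real) \<longrightarrow> (H M e \<le> \<delta> \<longleftrightarrow> (\<exists>i<n::nat. F i M e \<le> \<delta>)))"
  using assms
proof (induction n)
  case 0
  show ?case by (intro exI[of _ "\<lambda>M e. \<epsilon>"]) (simp add: definable_const)
next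
  case (Suc n)
  then obtain H where H: "definable L \<Gamma> H" "\<forall>M e \<delta>. \<delta> < (\<epsilon>::real) \<longrightarrow> (H M e \<le> \<delta> \<longleftrightarrow> (\<exists>i<n. F i M e \<le> \<delta>))"
    by (metis less_Suc_eq)
  show ?case
    using H(2) definable_min[OF H(1) Suc.prems[of n]]
    by (intro exI[of _ "\<lambda>M e. min (H M e) (F n M e)"]) (auto simp: less_Suc_eq min_le_iff_disj)
qed

section \<open>Transfer of open conditions\<close>

lemma open_cond_elem_equiv:
  fixes P :: "('s, 'f, 'p, 'u) struct \<Rightarrow> 'u list \<Rightarrow> bool"
  assumes "open_cond L [] P" "elem_equiv L M N" "is_struct L M" "is_struct L N"
  shows "P M [] \<longleftrightarrow> P N []"
proof -
  obtain F where F: "definable L [] F" "\<And>M e. is_struct L M \<Longrightarrow> e \<in> tuples M [] \<Longrightarrow> P M e \<longleftrightarrow> F M e < 0"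
    using assms(1) unfolding open_cond_def by metis
  obtain \<psi> where \<psi>: "is_fm L [] \<psi>" "\<And>M e. is_struct L M \<Longrightarrow> e \<in> tuples M [] \<Longrightarrow> F M e = fval M e \<psi>"
    using F(1) unfolding definable_def by metis
  have "fval M [] \<psi> = fval N [] \<psi>" using assms(2) \<psi>(1) unfolding elem_equiv_def by blast
  then show ?thesis using F(2) \<psi>(2) assms(3,4) by simp
qed

lemma elem_substruct_univ: "elem_substruct L M N \<Longrightarrow> s \<in> sorts L \<Longrightarrow> univ M s \<subseteq> univ N s"
  unfolding elem_substruct_def substruct_def by blast

lemma elem_substruct_tuples:
  assumes "elem_substruct L M N" "set \<Gamma> \<subseteq> sorts L"
  shows "tuples M \<Gamma> \<subseteq> tuples N \<Gamma>"
proof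
  fix e assume "e \<in> tuples M \<Gamma>"
  moreover have "univ M (\<Gamma> ! i) \<subseteq> univ N (\<Gamma> ! i)" if "i < length \<Gamma>" for i
    using elem_substruct_univ[OF assms(1)] assms(2) that by (meson nth_mem subsetD)
  ultimately show "e \<in> tuples N \<Gamma>"
    unfolding tuples_def list_all2_conv_all_nth mem_Collect_eq by (metis subsetD)
qed

lemma open_cond_elem_substruct:
  fixes P :: "('s, 'f, 'p, 'u) struct \<Rightarrow> 'u list \<Rightarrow> bool"
  assumes "open_cond L \<Gamma> P" "elem_substruct L M N" "is_struct L M" "is_struct L N"
    and \<Gamma>: "set \<Gamma> \<subseteq> sorts L" and e: "e \<in> tuples M \<Gamma>"
  shows "P M e \<longleftrightarrow> P N e"
proof -
  obtain F where F: "definable L \<Gamma> F" "\<And>M e. is_struct L M \<Longrightarrow> e \<in> tuples M \<Gamma> \<Longrightarrow> P M e \<longleftrightarrow> F M e < 0"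
    using assms(1) unfolding open_cond_def by metis
  obtain \<psi> where \<psi>: "is_fm L \<Gamma> \<psi>" "\<And>M e. is_struct L M \<Longrightarrow> e \<in> tuples M \<Gamma> \<Longrightarrow> F M e = fval M e \<psi>"
    using F(1) unfolding definable_def by metis
  have "fval M e \<psi> = fval N e \<psi>" using assms(2) \<Gamma> e \<psi>(1) unfolding elem_substruct_def by blast
  moreover have "e \<in> tuples N \<Gamma>" using elem_substruct_tuples[OF assms(2) \<Gamma>] e by blast
  ultimately show ?thesis using F(2) \<psi>(2) assms(3,4) e by simp
qed

section \<open>Genericity as an open condition\<close>

lemma nth_concat_uniform:
  "\<lbrakk>\<And>b. b \<in> set bs \<Longrightarrow> length b = l; j < length bs; t < l\<rbrakk> \<Longrightarrow> concat bs ! (j * l + t) = bs ! j ! t"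
proof (induction bs arbitrary: j)
  case (Cons b bs)
  have b: "length b = l" using Cons.prems(1) by simp
  show ?case
  proof (cases j)
    case 0
    then show ?thesis using b Cons.prems(3) by (simp add: nth_append)
  next
    case (Suc i)
    have "concat bs ! (i * l + t) = bs ! i ! t" using Cons.prems Suc by (intro Cons.IH) simp_all
    then show ?thesis using b Suc by (simp add: nth_append add.assoc)
  qed
qed simp

lemma length_concat_uniform: "(\<And>b. b \<in> set bs \<Longrightarrow> length b = l) \<Longrightarrow> length (concat bs) = length bs * l"
  by (induction bs) simp_all

lemma block_index_less: "j < k \<Longrightarrow> t < l \<Longrightarrow> j * l + t < k * (l::nat)"
proof -
  assume "j < k" "t < l"
  then have "j * l + t < Suc j * l" by simp
  also have "\<dots> \<le> k * l" using \<open>j < k\<close> by (intro mult_le_mono1) simp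
  finally show ?thesis .
qed

definition block :: "nat \<Rightarrow> nat \<Rightarrow> 'u list \<Rightarrow> 'u list" where
  "block l j e = map (\<lambda>t. e ! (j * l + t)) [0..<l]"

abbreviation copies :: "nat \<Rightarrow> 's list \<Rightarrow> 's list" where
  "copies k zs \<equiv> concat (replicate k zs)"

lemma length_copies: "length (copies k zs) = k * length zs"
  by (subst length_concat_uniform[where l = "length zs"]) auto

lemma nth_copies:
  assumes "j < k" "t < length zs"
  shows "(copies k zs @ \<Gamma>') ! (j * length zs + t) = zs ! t"
proof -
  have "copies k zs ! (j * length zs + t) = replicate k zs ! j ! t"
    using assms by (intro nth_concat_uniform) auto
  then show ?thesis
    using assms block_index_less[OF assms] by (simp add: nth_append length_copies)
qed

lemma concat_in_tuples:
  "(\<And>b. b \<in> set bs \<Longrightarrow> b \<in> tuples M zs) \<Longrightarrow> concat bs \<in> tuples M (copies (length bs) zs)"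
  by (induction bs) (simp_all add: tuples_append)

lemma block_concat:
  assumes "\<And>b. b \<in> set bs \<Longrightarrow> length b = l" "j < length bs"
  shows "block l j (concat bs @ as) = bs ! j"
proof (rule nth_equalityI)
  show "length (block l j (concat bs @ as)) = length (bs ! j)" using assms by (simp add: block_def)
  fix t assume "t < length (block l j (concat bs @ as))"
  then have t: "t < l" by (simp add: block_def)
  have "length (concat bs) = length bs * l" by (rule length_concat_uniform[OF assms(1)])
  moreover have "concat bs ! (j * l + t) = bs ! j ! t" by (rule nth_concat_uniform[OF assms t])
  ultimately show "block l j (concat bs @ as) ! t = bs ! j ! t"
    using t block_index_less[OF assms(2) t] by (simp add: block_def nth_append)
qed

lemma block_in_tuples:
  assumes e: "e \<in> tuples M (copies k zs @ \<Gamma>')" and j: "j < k"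
  shows "block (length zs) j e \<in> tuples M zs"
  unfolding tuples_def list_all2_conv_all_nth mem_Collect_eq
proof (intro conjI allI impI)
  show "length (block (length zs) j e) = length zs" by (simp add: block_def)
  fix t assume "t < length (block (length zs) j e)"
  then have t: "t < length zs" by (simp add: block_def)
  have "j * length zs + t < length (copies k zs @ \<Gamma>')"
    using block_index_less[OF j t] by (simp add: length_copies)
  from tuples_nth[OF e this] show "block (length zs) j e ! t \<in> univ M (zs ! t)"
    using t unfolding nth_copies[OF j t] by (simp add: block_def)
qed

text \<open>The offset \<open>d\<close> leaves room for variables in front of the blocks, such as
  the group elements in \<open>generic_at\<close>.\<close>

lemma is_tm_block:
  assumes j: "j < k" and pre: "\<And>t. t < length (copies k zs) \<Longrightarrow> d + t < length \<Delta> \<and> \<Delta> ! (d + t) = copies k zs ! t"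
  shows "list_all2 (is_tm L \<Delta>) (map (\<lambda>t. Var (d + (j * length zs + t))) [0..<length zs]) zs"
  unfolding list_all2_conv_all_nth
proof (intro conjI allI impI)
  fix t assume "t < length (map (\<lambda>t. Var (d + (j * length zs + t))) [0..<length zs])"
  then have t: "t < length zs" by simp
  have "j * length zs + t < length (copies k zs)" using block_index_less[OF j t] by (simp add: length_copies)
  from pre[OF this] have "d + (j * length zs + t) < length \<Delta>" "\<Delta> ! (d + (j * length zs + t)) = zs ! t"
    using nth_copies[OF j t, of "[]"] by simp_all
  then show "is_tm L \<Delta> (map (\<lambda>t. Var (d + (j * length zs + t))) [0..<length zs] ! t) (zs ! t)"
    using is_tm.intros(1)[of "d + (j * length zs + t)" \<Delta> L] t by simp
qed simp

lemma open_cond_congr: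
  assumes "open_cond L \<Gamma> P"
    "\<And>M e. is_struct L M \<Longrightarrow> e \<in> tuples M \<Gamma> \<Longrightarrow> P M e \<longleftrightarrow> Q M e"
  shows "open_cond L \<Gamma> Q"
  using assms unfolding open_cond_def by auto

text \<open>
  \<open>k\<close> tuples of parameters are coded by the blocks of a single list \<open>e\<close>, which may have further
  entries behind these blocks.
\<close>

definition generic_at :: "('s, 'f, 'p, 'u) struct \<Rightarrow> 's \<Rightarrow> 'f \<Rightarrow> 's list \<Rightarrow> ('s, 'f, 'p) fm \<Rightarrow>
    nat \<Rightarrow> nat \<Rightarrow> (nat \<Rightarrow> real) \<Rightarrow> real \<Rightarrow> 'u list \<Rightarrow> bool" where
  "generic_at M G m zs \<phi> n k r \<epsilon> e \<longleftrightarrow> (\<exists>hs\<in>tuples M (replicate n G). \<exists>\<delta>. 0 \<le> \<delta> \<and> \<delta> < \<epsilon> \<and>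
     (\<forall>x\<in>univ M G. \<exists>i<n. \<forall>j<k. \<bar>phi_val M \<phi> (fn M m [hs ! i, x]) (block (length zs) j e) - r j\<bar> \<le> \<delta>))"

text \<open>The number \<open>n\<close> of translates is fixed, since its mere existence would be an
  infinite disjunction. The bound \<open>\<delta>\<close>, uniform in \<open>x\<close>, allows the
  universal quantifier to become a supremum below \<epsilon>; the translates themselves are
  existentially quantified.\<close>

lemma open_cond_generic_at:
  fixes L :: "('s, 'f, 'p) lang"
  assumes G: "G \<in> sorts L" and m: "m \<in> funs L" "fdom L m = [G, G]" "fcod L m = G"
    and \<phi>: "is_fm L (G # zs) \<phi>" and eps: "\<epsilon> > 0"
  shows "open_cond L (copies k zs @ \<Gamma>')
    (\<lambda>(M :: ('s, 'f, 'p, 'u) struct) e. generic_at M G m zs \<phi> n k r \<epsilon> e)"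
proof -
  define \<Gamma> where "\<Gamma> = replicate n G @ copies k zs @ \<Gamma>'"
  \<comment> \<open>De Bruijn indices: \<open>x\<close> is variable 0, the translates are 1 to
    \<open>n\<close>, and the blocks start at \<open>Suc n\<close>.\<close>
  define ts where "ts = (\<lambda>i j. Fn m [Var (Suc i), Var 0] # map (\<lambda>t. Var (Suc n + (j * length zs + t))) [0..<length zs])"
  have typed: "list_all2 (is_tm L (G # \<Gamma>)) (ts i j) (G # zs)" if "i < n" "j < k" for i j
  proof -
    have "is_tm L (G # \<Gamma>) (Var (Suc i)) G" "is_tm L (G # \<Gamma>) (Var 0) G"
      using is_tm.intros(1)[of "Suc i" "G # \<Gamma>" L] is_tm.intros(1)[of 0 "G # \<Gamma>" L] that(1)
      by (simp_all add: \<Gamma>_def nth_append)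
    then have "is_tm L (G # \<Gamma>) (Fn m [Var (Suc i), Var 0]) G"
      using is_tm.intros(2)[of m L "G # \<Gamma>" "[Var (Suc i), Var 0]"] m by simp
    moreover have "list_all2 (is_tm L (G # \<Gamma>))
        (map (\<lambda>t. Var (Suc n + (j * length zs + t))) [0..<length zs]) zs"
      by (rule is_tm_block[OF that(2)]) (simp add: \<Gamma>_def nth_append)
    ultimately show ?thesis unfolding ts_def by simp
  qed
  define F where "F = (\<lambda>i j (M :: ('s, 'f, 'p, 'u) struct) e. \<bar>fval M (map (tval M e) (ts i j)) \<phi> - r j\<bar>)"
  have F: "definable L (G # \<Gamma>) (F i j)" if "i < n" "j < k" for i j
    unfolding F_def
    by (intro definable_abs definable_minus definable_const definable_fval_subst[OF \<phi> typed[OF that]])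
  have "\<forall>i. \<exists>H. i < n \<longrightarrow> definable L (G # \<Gamma>) H \<and> (\<forall>M e \<delta>. 0 \<le> \<delta> \<longrightarrow> (H M e \<le> \<delta> \<longleftrightarrow> (\<forall>j<k. F i j M e \<le> \<delta>)))"
  proof
    fix i
    show "\<exists>H. i < n \<longrightarrow> definable L (G # \<Gamma>) H \<and> (\<forall>M e \<delta>. 0 \<le> \<delta> \<longrightarrow> (H M e \<le> \<delta> \<longleftrightarrow> (\<forall>j<k. F i j M e \<le> \<delta>)))"
    proof (cases "i < n")
      case True
      have "\<exists>H. definable L (G # \<Gamma>) H \<and> (\<forall>M e \<delta>. 0 \<le> \<delta> \<longrightarrow> (H M e \<le> \<delta> \<longleftrightarrow> (\<forall>j<k. F i j M e \<le> \<delta>)))"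
        by (rule definable_Max) (rule F[OF True])
      then show ?thesis by (elim exE) (intro exI impI)
    qed simp
  qed
  from choice[OF this] obtain H where "\<forall>i. i < n \<longrightarrow> definable L (G # \<Gamma>) (H i) \<and>
      (\<forall>M e \<delta>. 0 \<le> \<delta> \<longrightarrow> (H i M e \<le> \<delta> \<longleftrightarrow> (\<forall>j<k. F i j M e \<le> \<delta>)))" by (rule exE)
  then have H: "definable L (G # \<Gamma>) (H i)"
      "0 \<le> \<delta> \<Longrightarrow> H i M e \<le> \<delta> \<longleftrightarrow> (\<forall>j<k. F i j M e \<le> \<delta>)" if "i < n" for i M e \<delta>
    using that by simp_all
  have "\<exists>K. definable L (G # \<Gamma>) K \<and>
      (\<forall>M e \<delta>. \<delta> < \<epsilon> \<longrightarrow> (K M e \<le> \<delta> \<longleftrightarrow> (\<exists>i<n. H i M e \<le> \<delta>)))"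
    by (rule definable_Min) (rule H(1))
  then obtain K where K: "definable L (G # \<Gamma>) K"
      "\<forall>M e \<delta>. \<delta> < \<epsilon> \<longrightarrow> (K M e \<le> \<delta> \<longleftrightarrow> (\<exists>i<n. H i M e \<le> \<delta>))"
    by (elim exE conjE) (rule that)
  have "open_cond L (copies k zs @ \<Gamma>')
     (\<lambda>M e. \<exists>hs\<in>tuples M (replicate n G). \<exists>\<delta><\<epsilon>. \<forall>x\<in>univ M G. K M (x # hs @ e) \<le> \<delta>)"
    using open_cond_SUP[OF G K(1), of \<epsilon>] G unfolding \<Gamma>_def by (intro open_cond_exs) auto
  then show ?thesis
  proof (rule open_cond_congr)
    fix M :: "('s, 'f, 'p, 'u) struct" and e
    have val: "map (tval M (x # hs @ e)) (ts i j) = fn M m [hs ! i, x] # block (length zs) j e"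
      if "hs \<in> tuples M (replicate n G)" "i < n" for hs x i j
      using tuples_length[OF that(1)] that(2) by (simp add: ts_def block_def nth_append)
    have Kval: "K M (x # hs @ e) \<le> \<delta> \<longleftrightarrow>
        (\<exists>i<n. \<forall>j<k. \<bar>phi_val M \<phi> (fn M m [hs ! i, x]) (block (length zs) j e) - r j\<bar> \<le> \<delta>)"
      if "hs \<in> tuples M (replicate n G)" "0 \<le> \<delta>" "\<delta> < \<epsilon>" for hs x \<delta>
    proof -
      have "K M (x # hs @ e) \<le> \<delta> \<longleftrightarrow> (\<exists>i<n. H i M (x # hs @ e) \<le> \<delta>)" using K(2) that(3) by simp
      also have "\<dots> \<longleftrightarrow> (\<exists>i<n. \<forall>j<k. F i j M (x # hs @ e) \<le> \<delta>)" using H(2) that(2) by auto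
      finally show ?thesis unfolding F_def using val[OF that(1)] by auto
    qed
    show "(\<exists>hs\<in>tuples M (replicate n G). \<exists>\<delta><\<epsilon>. \<forall>x\<in>univ M G. K M (x # hs @ e) \<le> \<delta>) \<longleftrightarrow>
        generic_at M G m zs \<phi> n k r \<epsilon> e"
      unfolding generic_at_def
    proof (intro bex_cong refl iffI)
      fix hs assume hs: "hs \<in> tuples M (replicate n G)" and "\<exists>\<delta><\<epsilon>. \<forall>x\<in>univ M G. K M (x # hs @ e) \<le> \<delta>"
      then obtain \<delta> where \<delta>: "\<delta> < \<epsilon>" "\<forall>x\<in>univ M G. K M (x # hs @ e) \<le> \<delta>" by blast
      \<comment> \<open>\<open>definable_Max\<close> interprets nonnegative bounds only, so a
        negative \<delta> is raised to 0, which is still below \<epsilon>.\<close>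
      then have "\<forall>x\<in>univ M G. K M (x # hs @ e) \<le> max \<delta> 0" by auto
      then show "\<exists>\<delta>. 0 \<le> \<delta> \<and> \<delta> < \<epsilon> \<and> (\<forall>x\<in>univ M G. \<exists>i<n. \<forall>j<k.
          \<bar>phi_val M \<phi> (fn M m [hs ! i, x]) (block (length zs) j e) - r j\<bar> \<le> \<delta>)"
        using \<delta>(1) eps Kval[OF hs, of "max \<delta> 0"] by (intro exI[of _ "max \<delta> 0"]) simp
    next
      fix hs assume hs: "hs \<in> tuples M (replicate n G)" 
        and "\<exists>\<delta>. 0 \<le> \<delta> \<and> \<delta> < \<epsilon> \<and> (\<forall>x\<in>univ M G. \<exists>i<n. \<forall>j<k.
          \<bar>phi_val M \<phi> (fn M m [hs ! i, x]) (block (length zs) j e) - r j\<bar> \<le> \<delta>)"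
      then obtain \<delta> where \<delta>: "0 \<le> \<delta>" "\<delta> < \<epsilon>" "\<forall>x\<in>univ M G. \<exists>i<n. \<forall>j<k.
          \<bar>phi_val M \<phi> (fn M m [hs ! i, x]) (block (length zs) j e) - r j\<bar> \<le> \<delta>"
        by (elim exE conjE) (rule that)
      then show "\<exists>\<delta><\<epsilon>. \<forall>x\<in>univ M G. K M (x # hs @ e) \<le> \<delta>"
        using Kval[OF hs \<delta>(1,2)] by (intro exI[of _ \<delta>]) simp
    qed
  qed
qed

text \<open>The element of sort \<open>G\<close> is an entry behind the blocks: it stays free, to be
  filled by a named element of \<open>M\<close>, when the blocks are quantified away.\<close>

lemma open_cond_value_at:
  fixes L :: "('s, 'f, 'p) lang"
  assumes \<phi>: "is_fm L (G # zs) \<phi>" and i: "i < length \<Gamma>'" "\<Gamma>' ! i = G" and j: "j < k"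
  shows "open_cond L (copies k zs @ \<Gamma>') (\<lambda>(M :: ('s, 'f, 'p, 'u) struct) e.
    \<bar>phi_val M \<phi> (e ! (k * length zs + i)) (block (length zs) j e) - v\<bar> < \<delta>)"
proof -
  define ts :: "'f tm list" where "ts = Var (k * length zs + i) # map (\<lambda>t. Var (0 + (j * length zs + t))) [0..<length zs]"
  have "is_tm L (copies k zs @ \<Gamma>') (Var (k * length zs + i)) G"
    using is_tm.intros(1)[of "k * length zs + i" "copies k zs @ \<Gamma>'" L] i by (simp add: length_copies nth_append)
  moreover have "list_all2 (is_tm L (copies k zs @ \<Gamma>')) (map (\<lambda>t. Var (0 + (j * length zs + t))) [0..<length zs]) zs"
    by (rule is_tm_block[OF j]) (simp add: nth_append)
  ultimately have "list_all2 (is_tm L (copies k zs @ \<Gamma>')) ts (G # zs)" unfolding ts_def by simp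
  then have "open_cond L (copies k zs @ \<Gamma>')
      (\<lambda>(M :: ('s, 'f, 'p, 'u) struct) e. \<bar>fval M (map (tval M e) ts) \<phi> - v\<bar> < \<delta>)"
    by (intro open_cond_less definable_abs definable_minus definable_const definable_fval_subst[OF \<phi>])
  then show ?thesis by (simp add: ts_def block_def comp_def)
qed

section \<open>Definitions of stable types\<close>

text \<open>\<open>r\<close> is the limit of \<open>p b\<close> as the type of \<open>b\<close>
  tends to \<open>y\<close>. Compactness of the interval gives a cluster point, and
  \<open>stable_type_determined\<close> makes the oscillation of \<open>p\<close> near
  \<open>y\<close> arbitrarily small.\<close>

lemma stable_type_limit:
  fixes f :: "'a \<Rightarrow> 'b \<Rightarrow> real"
  assumes st: "stable_fun A B f" and bd: "\<And>a b. a \<in> A \<Longrightarrow> b \<in> B \<Longrightarrow> \<bar>f a b\<bar> \<le> c"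
    and p: "p \<in> local_types A B f" and y: "y \<in> local_types B A (\<lambda>b a. f a b)"
  shows "\<exists>r. \<forall>\<epsilon>>0. \<exists>F \<delta>. finite F \<and> F \<subseteq> A \<and> \<delta> > 0 \<and>
    (\<forall>b\<in>B. (\<forall>a\<in>F. \<bar>f a b - y a\<bar> < \<delta>) \<longrightarrow> \<bar>p b - r\<bar> \<le> \<epsilon>)"
proof -
  define nb where "nb = (\<lambda>(F, \<delta>). {b \<in> B. \<forall>a\<in>F. \<bar>f a b - y a\<bar> < (\<delta> :: real)})"
  define I where "I = {(F, \<delta>). finite F \<and> F \<subseteq> A \<and> (\<delta> :: real) > 0}"
  have pb: "\<bar>p b\<bar> \<le> c" if "b \<in> B" for b by (rule local_types_bounded[OF bd p that])
  have "{-c..c} \<inter> \<Inter>((\<lambda>i. closure (p ` nb i)) ` I) \<noteq> {}"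
  proof (rule compact_imp_fip)
    show "compact {-c..c}" by simp
    show "closed T" if "T \<in> (\<lambda>i. closure (p ` nb i)) ` I" for T using that by (rule imageE) simp
    fix \<F> assume F: "finite \<F>" "\<F> \<subseteq> (\<lambda>i. closure (p ` nb i)) ` I"
    obtain J where J: "J \<subseteq> I" "finite J" "\<F> = (\<lambda>i. closure (p ` nb i)) ` J"
      using finite_subset_image[OF F] by (elim exE conjE) (rule that)
    define E where "E = \<Union>(fst ` J)"
    define d where "d = Min (insert 1 (snd ` J))"
    have JI: "finite (fst i) \<and> fst i \<subseteq> A \<and> snd i > 0" if "i \<in> J" for i
      using subsetD[OF J(1) that] by (cases i) (simp add: I_def)
    have E: "finite E" unfolding E_def using J(2) JI by (intro finite_Union) auto
    have EA: "E \<subseteq> A" unfolding E_def using JI by (intro Union_least) auto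
    have d: "d > 0" unfolding d_def using J(2) JI by simp
    obtain b where b: "b \<in> B" "\<And>a. a \<in> E \<Longrightarrow> \<bar>f a b - y a\<bar> < d"
      using local_types_approx[OF y E EA d] by metis
    have "p b \<in> closure (p ` nb i)" if i: "i \<in> J" for i
    proof -
      have "d \<le> snd i" unfolding d_def using J(2) i by simp
      moreover have "\<bar>f a b - y a\<bar> < d" if "a \<in> fst i" for a
        by (rule b(2)) (use i that in \<open>auto simp: E_def\<close>)
      ultimately have "b \<in> nb i" unfolding nb_def using b(1) by (cases i) fastforce
      then show ?thesis by (intro subsetD[OF closure_subset] imageI)
    qed
    then have "p b \<in> \<Inter>\<F>" unfolding J(3) by simp
    moreover have "p b \<in> {-c..c}" using pb[OF b(1)] by auto
    ultimately show "{-c..c} \<inter> \<Inter>\<F> \<noteq> {}" by (metis IntI emptyE)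
  qed
  then obtain r where r: "r \<in> \<Inter>((\<lambda>i. closure (p ` nb i)) ` I)" by (metis Int_iff ex_in_conv)
  have "\<exists>F \<delta>. finite F \<and> F \<subseteq> A \<and> \<delta> > 0 \<and>
      (\<forall>b\<in>B. (\<forall>a\<in>F. \<bar>f a b - y a\<bar> < \<delta>) \<longrightarrow> \<bar>p b - r\<bar> \<le> \<epsilon>)" if e: "\<epsilon> > 0" for \<epsilon>
  proof -
    have e2: "\<epsilon> / 2 > 0" using e by simp
    obtain F \<delta> where F: "finite F" "F \<subseteq> A" "\<delta> > 0"
        "\<forall>b\<in>B. \<forall>b'\<in>B. (\<forall>a\<in>F. \<bar>f a b - f a b'\<bar> < \<delta>) \<longrightarrow> \<bar>p b - p b'\<bar> \<le> \<epsilon> / 2"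
      using stable_type_determined[OF st p e2] by (elim exE conjE) (rule that)
    have "\<bar>p b - r\<bar> \<le> \<epsilon>" if b: "b \<in> B" "\<forall>a\<in>F. \<bar>f a b - y a\<bar> < \<delta> / 2" for b
    proof -
      have "(F, \<delta> / 2) \<in> I" using F by (simp add: I_def)
      then have "r \<in> closure (p ` nb (F, \<delta> / 2))" using r by (rule INT_D[rotated])
      from this[unfolded closure_approachable, rule_format, OF e2] obtain z where z: "z \<in> p ` nb (F, \<delta> / 2)" "dist z r < \<epsilon> / 2" by (rule bexE)
      from z(1) obtain b' where "z = p b'" "b' \<in> nb (F, \<delta> / 2)" by (rule imageE)
      with z(2) have b': "b' \<in> nb (F, \<delta> / 2)" "\<bar>p b' - r\<bar> < \<epsilon> / 2" by (simp_all add: dist_real_def)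
      have b'B: "b' \<in> B" "\<forall>a\<in>F. \<bar>f a b' - y a\<bar> < \<delta> / 2" using b'(1) by (simp_all add: nb_def)
      have "\<bar>f a b - f a b'\<bar> < \<delta>" if "a \<in> F" for a
        using bspec[OF b(2) that] bspec[OF b'B(2) that] by linarith
      then have "\<bar>p b - p b'\<bar> \<le> \<epsilon> / 2" using F(4) b(1) b'B(1) by simp
      with b'(2) show ?thesis by linarith
    qed
    with F(1-3) show ?thesis by (intro exI[of _ F] exI[of _ "\<delta> / 2"]) simp
  qed
  then show ?thesis by (intro exI[of _ r]) simp
qed

text \<open>\<open>d y\<close> is the limit from \<open>stable_type_limit\<close>. It is continuous
  because a parameter approximating a type \<open>z\<close> near \<open>y\<close> closely enough
  also lies near \<open>y\<close>. At a realized type the parameter itself lies in every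
  neighbourhood, so \<open>d\<close> returns the value of \<open>p\<close>.\<close>

lemma stable_type_definition:
  fixes f :: "'a \<Rightarrow> 'b \<Rightarrow> real"
  assumes st: "stable_fun A B f" and bd: "\<And>a b. a \<in> A \<Longrightarrow> b \<in> B \<Longrightarrow> \<bar>f a b\<bar> \<le> c"
    and p: "p \<in> local_types A B f"
  shows "\<exists>d. continuous_map (local_type_space B A (\<lambda>b a. f a b)) euclideanreal d \<and>
    (\<forall>b\<in>B. p b = d (\<lambda>a\<in>A. f a b))"
proof -
  define Y where "Y = local_types B A (\<lambda>b a. f a b)"
  have "\<forall>y\<in>Y. \<exists>r. \<forall>\<epsilon>>0. \<exists>F \<delta>. finite F \<and> F \<subseteq> A \<and> \<delta> > 0 \<and>
      (\<forall>b\<in>B. (\<forall>a\<in>F. \<bar>f a b - y a\<bar> < \<delta>) \<longrightarrow> \<bar>p b - r\<bar> \<le> \<epsilon>)"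
    unfolding Y_def using stable_type_limit[OF st bd p] by (intro ballI)
  from bchoice[OF this] obtain d where d: "\<forall>y\<in>Y. \<forall>\<epsilon>>0. \<exists>F \<delta>. finite F \<and> F \<subseteq> A \<and> \<delta> > 0 \<and>
      (\<forall>b\<in>B. (\<forall>a\<in>F. \<bar>f a b - y a\<bar> < \<delta>) \<longrightarrow> \<bar>p b - d y\<bar> \<le> \<epsilon>)" by (rule exE)
  have near: "\<exists>F \<delta>. finite F \<and> F \<subseteq> A \<and> \<delta> > 0 \<and>
      (\<forall>b\<in>B. (\<forall>a\<in>F. \<bar>f a b - y a\<bar> < \<delta>) \<longrightarrow> \<bar>p b - d y\<bar> \<le> \<epsilon>)" if "y \<in> Y" "\<epsilon> > 0" for y \<epsilon>
    using bspec[OF d that(1)] that(2) by simp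
  have top: "topspace (local_type_space B A (\<lambda>b a. f a b)) = Y"
    using closedin_subset[OF closedin_local_types[of A B "\<lambda>b a. f a b"]]
    unfolding Y_def local_type_space_def by (simp add: Int_absorb1)
  have "continuous_map (local_type_space B A (\<lambda>b a. f a b)) Met_TC.mtopology d"
    unfolding Met_TC.continuous_map_to_metric top
  proof (intro ballI allI impI)
    fix y and \<epsilon> :: real assume y: "y \<in> Y" and e: "\<epsilon> > 0"
    have e3: "\<epsilon> / 3 > 0" using e by simp
    obtain F \<delta> where F: "finite F" "F \<subseteq> A" "\<delta> > 0"
        "\<forall>b\<in>B. (\<forall>a\<in>F. \<bar>f a b - y a\<bar> < \<delta>) \<longrightarrow> \<bar>p b - d y\<bar> \<le> \<epsilon> / 3"
      using near[OF y e3] by (elim exE conjE) (rule that)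
    define U where "U = Y \<inter> {q \<in> extensional A. \<forall>a\<in>F. \<bar>q a - y a\<bar> < \<delta> / 2}"
    have "openin (local_type_space B A (\<lambda>b a. f a b)) U"
      unfolding U_def local_type_space_def Y_def
      by (rule openin_subtopology_Int2) (rule openin_powertop_box[OF F(1,2)])
    moreover have "y \<in> U" using y F(3) local_types_ext unfolding U_def Y_def by auto
    moreover have "d z \<in> Met_TC.mball (d y) \<epsilon>" if z: "z \<in> U" for z
    proof -
      have zY: "z \<in> Y" and zy: "\<forall>a\<in>F. \<bar>z a - y a\<bar> < \<delta> / 2" using z by (simp_all add: U_def)
      obtain F' \<delta>' where F': "finite F'" "F' \<subseteq> A" "\<delta>' > 0"
          "\<forall>b\<in>B. (\<forall>a\<in>F'. \<bar>f a b - z a\<bar> < \<delta>') \<longrightarrow> \<bar>p b - d z\<bar> \<le> \<epsilon> / 3"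
        using near[OF zY e3] by (elim exE conjE) (rule that)
      have "finite (F \<union> F')" "F \<union> F' \<subseteq> A" "min (\<delta> / 2) \<delta>' > 0" using F F' by simp_all
      then obtain b where b: "b \<in> B" "\<And>a. a \<in> F \<union> F' \<Longrightarrow> \<bar>f a b - z a\<bar> < min (\<delta> / 2) \<delta>'"
        using local_types_approx[OF zY[unfolded Y_def], of "F \<union> F'"] by metis
      have "\<forall>a\<in>F'. \<bar>f a b - z a\<bar> < \<delta>'" using b(2) by simp
      then have 1: "\<bar>p b - d z\<bar> \<le> \<epsilon> / 3" using F'(4) b(1) by simp
      have "\<bar>f a b - y a\<bar> < \<delta>" if a: "a \<in> F" for a
      proof -
        have "\<bar>f a b - z a\<bar> < \<delta> / 2" using b(2)[of a] a by simp
        with bspec[OF zy a] show ?thesis by linarith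
      qed
      then have "\<bar>p b - d y\<bar> \<le> \<epsilon> / 3" using F(4) b(1) by simp
      with 1 e have "dist (d y) (d z) < \<epsilon>" unfolding dist_real_def by linarith
      then show ?thesis by simp
    qed
    ultimately show "\<exists>U. openin (local_type_space B A (\<lambda>b a. f a b)) U \<and> y \<in> U \<and> (\<forall>z\<in>U. d z \<in> Met_TC.mball (d y) \<epsilon>)"
      by (intro exI[of _ U]) simp
  qed
  moreover have "p b = d (\<lambda>a\<in>A. f a b)" if b: "b \<in> B" for b
  proof -
    have bY: "(\<lambda>a\<in>A. f a b) \<in> Y" unfolding Y_def using realized_local_type[OF b, of "\<lambda>b a. f a b" A] .
    have "\<bar>p b - d (\<lambda>a\<in>A. f a b)\<bar> \<le> 0"
    proof (rule field_le_epsilon)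
      fix \<epsilon> :: real assume e: "\<epsilon> > 0"
      from near[OF bY e] obtain F \<delta> where F: "F \<subseteq> A" "\<delta> > 0"
          "\<forall>b'\<in>B. (\<forall>a\<in>F. \<bar>f a b' - (\<lambda>a\<in>A. f a b) a\<bar> < \<delta>) \<longrightarrow> \<bar>p b' - d (\<lambda>a\<in>A. f a b)\<bar> \<le> \<epsilon>"
        by (elim exE conjE) (rule that)
      have "\<forall>a\<in>F. \<bar>f a b - (\<lambda>a\<in>A. f a b) a\<bar> < \<delta>" using F(1,2) by auto
      with F(3) b have "\<bar>p b - d (\<lambda>a\<in>A. f a b)\<bar> \<le> \<epsilon>" by blast
      then show "\<bar>p b - d (\<lambda>a\<in>A. f a b)\<bar> \<le> 0 + \<epsilon>" by simp
    qed
    then show ?thesis by simp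
  qed
  ultimately show ?thesis by (intro exI[of _ d]) simp
qed

section \<open>The minimal subflow of a model\<close>

lemma tuples_nonempty:
  assumes "is_struct L M" "set \<Gamma> \<subseteq> sorts L"
  shows "tuples M \<Gamma> \<noteq> {}"
  using assms(2)
proof (induction \<Gamma>)
  case (Cons s \<Gamma>)
  have "univ M s \<noteq> {}" using assms(1) Cons.prems unfolding is_struct_def by simp
  then obtain a where "a \<in> univ M s" by blast
  moreover obtain as where "as \<in> tuples M \<Gamma>" using Cons by auto
  ultimately have "a # as \<in> tuples M (s # \<Gamma>)" by simp
  then show ?case by blast
qed auto

locale stable_left_invariant =
  fixes L :: "('s, 'f, 'p) lang" and T :: "('s, 'f, 'p) fm set"
    and G :: 's and m :: 'f and zs :: "'s list" and \<phi> :: "('s, 'f, 'p) fm" and U :: "'u itself"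
  assumes lang: "is_lang L"
    and complete: "complete_theory U L T"
    and grp: "expands_group U L T G m"
    and zs: "set zs \<subseteq> sorts L" and \<phi>: "is_fm L (G # zs) \<phi>"
    and invar: "left_invariant U L T G m zs \<phi>"
    and stab: "stable_in U L T G zs \<phi>"
begin

lemma mult_symbol: "m \<in> funs L" "fdom L m = [G, G]" "fcod L m = G" "G \<in> sorts L"
proof -
  show m: "m \<in> funs L" "fdom L m = [G, G]" "fcod L m = G" using grp unfolding expands_group_def by simp_all
  have "fcod L m \<in> sorts L" using lang m(1) unfolding is_lang_def by blast
  then show "G \<in> sorts L" using m(3) by simp
qed

definition gp :: "('s, 'f, 'p, 'u) struct \<Rightarrow> 'u \<Rightarrow> 'u monoid" where
  "gp M e = \<lparr>carrier = univ M G, mult = (\<lambda>g h. fn M m [g, h]), one = e\<rparr>"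

lemma gp_simps [simp]: "carrier (gp M e) = univ M G" "mult (gp M e) = (\<lambda>g h. fn M m [g, h])"
  by (simp_all add: gp_def)

definition Cset :: "('s, 'f, 'p, 'u) struct \<Rightarrow> ('u list \<Rightarrow> real) set" where
  "Cset M = (THE C. minimal_subflow M G m zs \<phi> C)"

lemma model_struct: "is_model L T M \<Longrightarrow> is_struct L M"
  by (simp add: is_model_def)

lemma phi_bounded:
  assumes "is_struct L M"
  obtains c where "\<And>a b. a \<in> univ M G \<Longrightarrow> b \<in> tuples M zs \<Longrightarrow> \<bar>phi_val M \<phi> a b\<bar> \<le> c"
proof -
  obtain c where c: "\<forall>e\<in>tuples M (G # zs). \<bar>fval M e \<phi>\<bar> \<le> c" using fval_bounded[OF assms \<phi>] by blast
  show ?thesis using c by (intro that[of c]) simp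
qed

lemma phi_stable:
  fixes M :: "('s, 'f, 'p, 'u) struct"
  assumes M: "is_model L T M"
  shows "stable_fun (univ M G) (tuples M zs) (phi_val M \<phi>)"
  unfolding stable_fun_def
proof (intro allI impI notI)
  fix \<epsilon> :: real
  assume e: "\<epsilon> > 0" and "\<exists>a b. range a \<subseteq> univ M G \<and> range b \<subseteq> tuples M zs \<and>
     (\<forall>i j :: nat. i < j \<longrightarrow> \<epsilon> \<le> \<bar>phi_val M \<phi> (a i) (b j) - phi_val M \<phi> (a j) (b i)\<bar>)"
  then obtain a b where ab: "range a \<subseteq> univ M G" "range b \<subseteq> tuples M zs"
     "\<forall>i j :: nat. i < j \<longrightarrow> \<epsilon> \<le> \<bar>phi_val M \<phi> (a i) (b j) - phi_val M \<phi> (a j) (b i)\<bar>"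
    by (elim exE conjE) (rule that)
  obtain k :: "real \<Rightarrow> nat" where k: "\<forall>M :: ('s, 'f, 'p, 'u) struct. is_model L T M \<longrightarrow> (\<forall>\<epsilon>>0.
          \<not> (\<exists>a b. (\<forall>i\<in>{1..k \<epsilon>}. a i \<in> univ M G \<and> b i \<in> tuples M zs) \<and>
                (\<forall>i\<in>{1..k \<epsilon>}. \<forall>j\<in>{1..k \<epsilon>}. i < j \<longrightarrow>
                   \<bar>phi_val M \<phi> (a i) (b j) - phi_val M \<phi> (a j) (b i)\<bar> \<ge> \<epsilon>)))"
    using stab unfolding stable_in_def by (elim exE conjE) (rule that)
  have "\<exists>a b. (\<forall>i\<in>{1..k \<epsilon>}. a i \<in> univ M G \<and> b i \<in> tuples M zs) \<and>
      (\<forall>i\<in>{1..k \<epsilon>}. \<forall>j\<in>{1..k \<epsilon>}. i < j \<longrightarrow>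
         \<bar>phi_val M \<phi> (a i) (b j) - phi_val M \<phi> (a j) (b i)\<bar> \<ge> \<epsilon>)"
    using ab by (intro exI[of _ a] exI[of _ b]) (simp add: range_subsetD)
  with k[rule_format, OF M e] show False by (rule notE)
qed

text \<open>The identity and the bound on \<phi> exist only model by model. With them the abstract
  notions coincide with those of the statement, so the description \<open>Cset M\<close> denotes the
  unique minimal flow \<open>Cmin\<close>.\<close>

lemma model_flow:
  fixes M :: "('s, 'f, 'p, 'u) struct"
  assumes M: "is_model L T M"
  obtains e c where "stable_flow (gp M e) (tuples M zs) (phi_val M \<phi>) c"
    "stable_flow.Cmin (gp M e) (tuples M zs) (phi_val M \<phi>) = Cset M"
proof -
  obtain e where e: "group (gp M e)"
    using grp M unfolding expands_group_def gp_def by blast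
  obtain c where c: "\<And>a b. a \<in> univ M G \<Longrightarrow> b \<in> tuples M zs \<Longrightarrow> \<bar>phi_val M \<phi> a b\<bar> \<le> c"
    using phi_bounded[OF model_struct[OF M]] by metis
  have sf: "stable_flow (gp M e) (tuples M zs) (phi_val M \<phi>) c"
  proof (intro stable_flow.intro stable_flow_axioms.intro e)
    show "\<bar>phi_val M \<phi> a b\<bar> \<le> c" if "a \<in> carrier (gp M e)" "b \<in> tuples M zs" for a b
      using that c by simp
    show "\<exists>b'\<in>tuples M zs. \<forall>x\<in>carrier (gp M e). phi_val M \<phi> (g \<otimes>\<^bsub>gp M e\<^esub> x) b = phi_val M \<phi> x b'"
      if "b \<in> tuples M zs" "g \<in> carrier (gp M e)" for b g
      using invar M that unfolding left_invariant_def is_translate_def by simp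
    show "stable_fun (carrier (gp M e)) (tuples M zs) (phi_val M \<phi>)"
      using phi_stable[OF M] by simp
  qed
  interpret F: stable_flow "gp M e" "tuples M zs" "phi_val M \<phi>" c by (rule sf)
  have "F.act = type_act M G m zs \<phi>"
    unfolding F.act_def[abs_def] type_act_def[abs_def] F.tr_def[abs_def] is_translate_def by simp
  then have "F.flow = subflow M G m zs \<phi>"
    unfolding F.flow_def[abs_def] subflow_def[abs_def] S_phi_def by simp
  then have "F.minimal_flow = minimal_subflow M G m zs \<phi>"
    unfolding F.minimal_flow_def[abs_def] minimal_subflow_def[abs_def] by simp
  then have "F.Cmin = Cset M" unfolding F.Cmin_def Cset_def by simp
  with sf show ?thesis by (rule that)
qed

lemma Cset_facts:
  fixes M :: "('s, 'f, 'p, 'u) struct"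
  assumes M: "is_model L T M"
  shows Cset_types: "Cset M \<subseteq> local_types (univ M G) (tuples M zs) (phi_val M \<phi>)"
    and Cset_ext: "Cset M \<subseteq> extensional (tuples M zs)"
    and Cset_closedin: "closedin (powertop_real (tuples M zs)) (Cset M)"
    and Cset_compactin: "compactin (powertop_real (tuples M zs)) (Cset M)"
    and Cset_totally_bounded: "sup_totally_bounded (tuples M zs) (Cset M)"
proof -
  obtain e c where "stable_flow (gp M e) (tuples M zs) (phi_val M \<phi>) c"
    and C: "stable_flow.Cmin (gp M e) (tuples M zs) (phi_val M \<phi>) = Cset M"
    using model_flow[OF M] .
  then interpret F: stable_flow "gp M e" "tuples M zs" "phi_val M \<phi>" c by simp
  show *: "Cset M \<subseteq> local_types (univ M G) (tuples M zs) (phi_val M \<phi>)"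
    using F.Cmin_subset by (simp add: C)
  show "Cset M \<subseteq> extensional (tuples M zs)"
  proof
    fix p assume "p \<in> Cset M"
    then show "p \<in> extensional (tuples M zs)" using local_types_ext[OF subsetD[OF *]] by simp
  qed
  show "closedin (powertop_real (tuples M zs)) (Cset M)"
    using F.flow_Cmin by (simp add: F.flow_iff C)
  show "compactin (powertop_real (tuples M zs)) (Cset M)"
    using F.flow_compactin[OF F.flow_Cmin] by (simp add: C)
  show "sup_totally_bounded (tuples M zs) (Cset M)"
    unfolding sup_totally_bounded_def
  proof (intro allI impI)
    fix \<epsilon> :: real assume "\<epsilon> > 0"
    then obtain P where "finite P" "P \<subseteq> F.Cmin"
        "\<And>p. p \<in> F.Cmin \<Longrightarrow> \<exists>q\<in>P. \<forall>b\<in>tuples M zs. \<bar>p b - q b\<bar> \<le> \<epsilon>"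
      using F.minimal_flow_totally_bounded[OF F.minimal_flow_Cmin] by metis
    then show "\<exists>P. finite P \<and> P \<subseteq> Cset M \<and> (\<forall>p\<in>Cset M. \<exists>q\<in>P. \<forall>b\<in>tuples M zs. \<bar>p b - q b\<bar> \<le> \<epsilon>)"
      unfolding C by (intro exI[of _ P]) simp
  qed
qed

lemma C_phi_eq:
  fixes M :: "('s, 'f, 'p, 'u) struct"
  assumes M: "is_model L T M"
  shows "C_phi M G m zs \<phi> = subtopology (powertop_real (tuples M zs)) (Cset M)"
proof -
  have "local_types (univ M G) (tuples M zs) (phi_val M \<phi>) \<inter> Cset M = Cset M"
    using Cset_types[OF M] by blast
  then show ?thesis
    unfolding C_phi_def S_phi_def local_type_space_def Cset_def[symmetric] subtopology_subtopology by simp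
qed

text \<open>\<open>n\<close> does not depend on the trailing \<open>as\<close>, which leaves room
  for the named elements that \<open>pull_back\<close> puts behind the blocks.\<close>

lemma Cset_generic_at:
  fixes M :: "('s, 'f, 'p, 'u) struct"
  assumes M: "is_model L T M" and p: "p \<in> Cset M" and bs: "set bs \<subseteq> tuples M zs" and eps: "\<epsilon> > 0"
  shows "\<exists>n. \<forall>as. generic_at M G m zs \<phi> n (length bs) (\<lambda>j. p (bs ! j)) \<epsilon> (concat bs @ as)"
proof -
  obtain e c where "stable_flow (gp M e) (tuples M zs) (phi_val M \<phi>) c"
    and C: "stable_flow.Cmin (gp M e) (tuples M zs) (phi_val M \<phi>) = Cset M"
    using model_flow[OF M] .
  then interpret F: stable_flow "gp M e" "tuples M zs" "phi_val M \<phi>" c by simp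
  have im: "(!) bs ` {..<length bs} \<subseteq> tuples M zs"
    using bs nth_mem by (intro image_subsetI) (auto dest: subsetD)
  \<comment> \<open>Half of \<epsilon> serves as the uniform margin that \<open>generic_at\<close>
    demands.\<close>
  have e2: "\<epsilon> / 2 > 0" using eps by simp
  have "F.generic {..<length bs} ((!) bs) (\<lambda>j. p (bs ! j)) (\<epsilon> / 2)"
    using F.generic_Cmin[OF p[folded C] finite_lessThan im e2] .
  then obtain K where K: "finite K" "K \<subseteq> univ M G"
      "\<forall>x\<in>univ M G. \<exists>h\<in>K. \<forall>j\<in>{..<length bs}. \<bar>phi_val M \<phi> (fn M m [h, x]) (bs ! j) - p (bs ! j)\<bar> < \<epsilon> / 2"
    unfolding F.generic_def gp_simps by (elim exE conjE) (rule that)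
  obtain hs where hs: "set hs = K" using finite_list[OF K(1)] by blast
  have hsG: "hs \<in> tuples M (replicate (length hs) G)"
    using hs K(2) unfolding tuples_def list_all2_conv_all_nth by (auto dest: nth_mem)
  have bl: "block (length zs) j (concat bs @ as) = bs ! j" if "j < length bs" for j as
    using bs tuples_length that by (intro block_concat) blast+
  have "generic_at M G m zs \<phi> (length hs) (length bs) (\<lambda>j. p (bs ! j)) \<epsilon> (concat bs @ as)" for as
    unfolding generic_at_def
  proof (intro bexI[OF _ hsG] exI[of _ "\<epsilon> / 2"] conjI ballI)
    fix x assume "x \<in> univ M G"
    with K(3) obtain h where h: "h \<in> K"
        "\<forall>j\<in>{..<length bs}. \<bar>phi_val M \<phi> (fn M m [h, x]) (bs ! j) - p (bs ! j)\<bar> < \<epsilon> / 2" by blast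
    obtain i where i: "i < length hs" "hs ! i = h" using h(1) unfolding hs[symmetric] in_set_conv_nth by blast
    have "\<bar>phi_val M \<phi> (fn M m [hs ! i, x]) (block (length zs) j (concat bs @ as)) - p (bs ! j)\<bar> \<le> \<epsilon> / 2"
      if j: "j < length bs" for j
      using h(2) j unfolding bl[OF j] i(2) by (auto intro: less_imp_le)
    with i(1) show "\<exists>i<length hs. \<forall>j<length bs.
        \<bar>phi_val M \<phi> (fn M m [hs ! i, x]) (block (length zs) j (concat bs @ as)) - p (bs ! j)\<bar> \<le> \<epsilon> / 2"
      by blast
  qed (use eps in simp_all)
  then show ?thesis by (intro exI[of _ "length hs"] allI)
qed

lemma generic_at_Cset:
  fixes M :: "('s, 'f, 'p, 'u) struct"
  assumes M: "is_model L T M" and g: "generic_at M G m zs \<phi> n k r \<epsilon> e'"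
    and e': "e' \<in> tuples M (copies k zs @ \<Gamma>')"
  shows "\<exists>p\<in>Cset M. \<forall>j<k. \<bar>p (block (length zs) j e') - r j\<bar> \<le> \<epsilon>"
proof -
  obtain e c where "stable_flow (gp M e) (tuples M zs) (phi_val M \<phi>) c"
    and C: "stable_flow.Cmin (gp M e) (tuples M zs) (phi_val M \<phi>) = Cset M"
    using model_flow[OF M] .
  then interpret F: stable_flow "gp M e" "tuples M zs" "phi_val M \<phi>" c by simp
  obtain hs \<delta> where hs: "hs \<in> tuples M (replicate n G)" "\<delta> < \<epsilon>" "\<forall>x\<in>univ M G. \<exists>i<n. \<forall>j<k.
      \<bar>phi_val M \<phi> (fn M m [hs ! i, x]) (block (length zs) j e') - r j\<bar> \<le> \<delta>"
    using g unfolding generic_at_def by (elim bexE exE conjE) (rule that)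
  define bl where "bl = (\<lambda>j. block (length zs) j e')"
  have "F.generic {..<k} bl r \<epsilon>"
    unfolding F.generic_def gp_simps
  proof (intro exI[of _ "set hs"] conjI ballI)
    show "set hs \<subseteq> univ M G"
      using hs(1) unfolding tuples_def list_all2_conv_all_nth by (auto simp: in_set_conv_nth)
    fix x assume "x \<in> univ M G"
    with hs(3) obtain i where i: "i < n" "\<forall>j<k. \<bar>phi_val M \<phi> (fn M m [hs ! i, x]) (block (length zs) j e') - r j\<bar> \<le> \<delta>"
      by blast
    have "i < length hs" using i(1) tuples_length[OF hs(1)] by simp
    then have "hs ! i \<in> set hs" by simp
    then show "\<exists>h\<in>set hs. \<forall>j\<in>{..<k}. \<bar>phi_val M \<phi> (fn M m [h, x]) (bl j) - r j\<bar> < \<epsilon>"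
      using i(2) hs(2) unfolding bl_def by (intro bexI[of _ "hs ! i"]) fastforce+
  qed simp
  moreover have "bl ` {..<k} \<subseteq> tuples M zs"
    unfolding bl_def using block_in_tuples[OF e'] by (intro image_subsetI) simp
  ultimately obtain p where "p \<in> F.Cmin" "\<And>j. j \<in> {..<k} \<Longrightarrow> \<bar>p (bl j) - r j\<bar> \<le> \<epsilon>"
    using F.generic_imp_flow_value[OF F.flow_Cmin] by (metis finite_lessThan)
  then show ?thesis unfolding C bl_def by (intro bexI[of _ p]) simp
qed

end

section \<open>Comparison of two models\<close>

context stable_left_invariant
begin

lemma open_cond_generic:
  "\<epsilon> > 0 \<Longrightarrow> open_cond L (copies k zs @ \<Gamma>')
    (\<lambda>(M :: ('s, 'f, 'p, 'u) struct) e. generic_at M G m zs \<phi> n k r \<epsilon> e)"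
  by (rule open_cond_generic_at[OF mult_symbol(4,1-3) \<phi>])

text \<open>For each pair in \<open>S\<close> pick a parameter that nearly attains its distance.
  That some parameters make the value vectors of all \<open>p \<in> S\<close> generic is a sentence,
  so \<open>N\<close> has such parameters and types of \<open>Cset N\<close> with nearly the same
  values there. Parameters of \<open>N\<close> outside this list may separate these types further,
  hence the inequality in one direction only.\<close>

lemma Cset_approximate_expansion:
  fixes M N :: "('s, 'f, 'p, 'u) struct"
  assumes M: "is_model L T M" and N: "is_model L T N"
    and S: "finite S" "S \<subseteq> Cset M" and eps: "\<epsilon> > 0"
  shows "\<exists>h. \<forall>p\<in>S. h p \<in> Cset N \<and>
    (\<forall>q\<in>S. sup_dist (tuples M zs) p q \<le> sup_dist (tuples N zs) (h p) (h q) + \<epsilon>)"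
proof -
  define e where "e = \<epsilon> / 3"
  have e: "e > 0" "\<epsilon> = 3 * e" using eps by (simp_all add: e_def)
  have ne: "tuples M zs \<noteq> {}" by (rule tuples_nonempty[OF model_struct[OF M] zs])
  define w where "w = (\<lambda>p q. SOME b. b \<in> tuples M zs \<and> sup_dist (tuples M zs) p q \<le> min 1 \<bar>p b - q b\<bar> + e)"
  have w: "w p q \<in> tuples M zs" "sup_dist (tuples M zs) p q \<le> min 1 \<bar>p (w p q) - q (w p q)\<bar> + e" for p q
  proof -
    have "\<exists>b. b \<in> tuples M zs \<and> sup_dist (tuples M zs) p q \<le> min 1 \<bar>p b - q b\<bar> + e"
      using sup_dist_attained[OF ne e(1), of p q] by (metis (no_types))
    from someI_ex[OF this, folded w_def]
    show "w p q \<in> tuples M zs" "sup_dist (tuples M zs) p q \<le> min 1 \<bar>p (w p q) - q (w p q)\<bar> + e"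
      unfolding w_def by (rule conjunct1, rule conjunct2)
  qed
  have "finite ((\<lambda>(p, q). w p q) ` (S \<times> S))" using S(1) by simp
  then obtain bs where bs: "set bs = (\<lambda>(p, q). w p q) ` (S \<times> S)" using finite_list by blast
  have bsM: "set bs \<subseteq> tuples M zs" unfolding bs using w(1) by auto
  define k where "k = length bs"
  have "\<forall>p\<in>S. \<exists>n. \<forall>as. generic_at M G m zs \<phi> n k (\<lambda>j. p (bs ! j)) e (concat bs @ as)"
    unfolding k_def using Cset_generic_at[OF M _ bsM e(1)] S(2) by blast
  from bchoice[OF this] obtain n where n:
    "\<forall>p\<in>S. \<forall>as. generic_at M G m zs \<phi> (n p) k (\<lambda>j. p (bs ! j)) e (concat bs @ as)" by (rule exE)
  define P where "P = (\<lambda>(M :: ('s, 'f, 'p, 'u) struct) e'.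
    \<forall>p\<in>S. generic_at M G m zs \<phi> (n p) k (\<lambda>j. p (bs ! j)) e e')"
  have "open_cond L (copies k zs @ []) P"
    unfolding P_def by (rule open_cond_ball[OF S(1)]) (rule open_cond_generic[OF e(1)])
  then have oc: "open_cond L [] (\<lambda>M e'. \<exists>as\<in>tuples M (copies k zs). P M (as @ e'))"
    using zs by (intro open_cond_exs) auto
  have "concat bs \<in> tuples M (copies k zs)" unfolding k_def using bsM by (intro concat_in_tuples) blast
  then have "\<exists>as\<in>tuples M (copies k zs). P M (as @ [])" using n unfolding P_def by blast
  \<comment> \<open>Completeness of \<open>T\<close> enters here.\<close>
  moreover have "elem_equiv L M N" using complete M N unfolding complete_theory_def by blast
  ultimately have "\<exists>as\<in>tuples N (copies k zs). P N (as @ [])"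
    using open_cond_elem_equiv[OF oc _ model_struct[OF M] model_struct[OF N]] by simp
  then obtain as where as: "as \<in> tuples N (copies k zs)" "P N (as @ [])" by (rule bexE)
  have as': "as @ [] \<in> tuples N (copies k zs @ [])" using as(1) by simp
  define bl where "bl = (\<lambda>j. block (length zs) j (as @ []))"
  have bl: "bl j \<in> tuples N zs" if "j < k" for j unfolding bl_def by (rule block_in_tuples[OF as' that])
  have "\<forall>p\<in>S. \<exists>q. q \<in> Cset N \<and> (\<forall>j<k. \<bar>q (bl j) - p (bs ! j)\<bar> \<le> e)"
  proof
    fix p assume "p \<in> S"
    with as(2) have "generic_at N G m zs \<phi> (n p) k (\<lambda>j. p (bs ! j)) e (as @ [])" by (simp add: P_def)
    from generic_at_Cset[OF N this as']
    show "\<exists>q. q \<in> Cset N \<and> (\<forall>j<k. \<bar>q (bl j) - p (bs ! j)\<bar> \<le> e)" unfolding bl_def by (simp only: Bex_def)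
  qed
  from bchoice[OF this] obtain h where h: "\<forall>p\<in>S. h p \<in> Cset N \<and> (\<forall>j<k. \<bar>h p (bl j) - p (bs ! j)\<bar> \<le> e)"
    by (rule exE)
  show ?thesis
  proof (intro exI[of _ h] ballI conjI)
    fix p assume p: "p \<in> S"
    show "h p \<in> Cset N" using h p by simp
    fix q assume q: "q \<in> S"
    have "w p q \<in> set bs" unfolding bs using p q by (intro image_eqI[of _ _ "(p, q)"]) simp_all
    then obtain j where j: "j < k" "bs ! j = w p q" unfolding k_def in_set_conv_nth by blast
    have "\<bar>h p (bl j) - p (w p q)\<bar> \<le> e" "\<bar>h q (bl j) - q (w p q)\<bar> \<le> e"
      using h p q j(1) unfolding j(2)[symmetric] by simp_all
    then have "min 1 \<bar>p (w p q) - q (w p q)\<bar> \<le> min 1 \<bar>h p (bl j) - h q (bl j)\<bar> + 2 * e"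
      using e(1) by (simp add: min_def) argo
    with w(2)[of p q] sup_dist_upper[OF bl[OF j(1)], of "h p" "h q"] e(2)
    show "sup_dist (tuples M zs) p q \<le> sup_dist (tuples N zs) (h p) (h q) + \<epsilon>" by linarith
  qed
qed

lemma C_phi_homeomorphic:
  fixes M N :: "('s, 'f, 'p, 'u) struct"
  assumes M: "is_model L T M" and N: "is_model L T N"
  shows "C_phi M G m zs \<phi> homeomorphic_space C_phi N G m zs \<phi>"
  unfolding C_phi_eq[OF M] C_phi_eq[OF N]
proof (rule homeomorphic_by_approximate_expansions)
  show "tuples M zs \<noteq> {}" by (rule tuples_nonempty[OF model_struct[OF M] zs])
  show "tuples N zs \<noteq> {}" by (rule tuples_nonempty[OF model_struct[OF N] zs])
  show "\<exists>h. \<forall>p\<in>S. h p \<in> Cset N \<and>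
      (\<forall>q\<in>S. sup_dist (tuples M zs) p q \<le> sup_dist (tuples N zs) (h p) (h q) + \<epsilon>)"
    if "finite S" "S \<subseteq> Cset M" "\<epsilon> > 0" for S \<epsilon> by (rule Cset_approximate_expansion[OF M N that])
  show "\<exists>h. \<forall>p\<in>S. h p \<in> Cset M \<and>
      (\<forall>q\<in>S. sup_dist (tuples N zs) p q \<le> sup_dist (tuples M zs) (h p) (h q) + \<epsilon>)"
    if "finite S" "S \<subseteq> Cset N" "\<epsilon> > 0" for S \<epsilon> by (rule Cset_approximate_expansion[OF N M that])
qed (rule Cset_ext[OF M] Cset_ext[OF N] Cset_totally_bounded[OF M] Cset_totally_bounded[OF N]
      Cset_compactin[OF M] Cset_compactin[OF N])+

end

section \<open>Restriction and definable extension for elementary substructures\<close>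

locale elementary_extension = stable_left_invariant L T G m zs \<phi> U
  for L :: "('s, 'f, 'p) lang" and T :: "('s, 'f, 'p) fm set"
    and G :: 's and m :: 'f and zs :: "'s list" and \<phi> :: "('s, 'f, 'p) fm" and U :: "'u itself" +
  fixes M N :: "('s, 'f, 'p, 'u) struct"
  assumes M: "is_model L T M" and N: "is_model L T N" and MN: "elem_substruct L M N"
begin

lemma tuples_subset: "tuples M zs \<subseteq> tuples N zs"
  by (rule elem_substruct_tuples[OF MN zs])

lemma univ_subset: "univ M G \<subseteq> univ N G"
  by (rule elem_substruct_univ[OF MN mult_symbol(4)])

lemma phi_val_eq:
  assumes "a \<in> univ M G" "b \<in> tuples M zs"
  shows "phi_val M \<phi> a b = phi_val N \<phi> a b"
proof -
  have "set (G # zs) \<subseteq> sorts L" "a # b \<in> tuples M (G # zs)" using assms zs mult_symbol(4) by simp_all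
  then show ?thesis using MN \<phi> unfolding elem_substruct_def by blast
qed

lemma transfer:
  fixes P :: "('s, 'f, 'p, 'u) struct \<Rightarrow> 'u list \<Rightarrow> bool"
  assumes "open_cond L \<Gamma> P" "set \<Gamma> \<subseteq> sorts L" "e \<in> tuples M \<Gamma>"
  shows "P M e \<longleftrightarrow> P N e"
  by (rule open_cond_elem_substruct[OF assms(1) MN model_struct[OF M] model_struct[OF N] assms(2,3)])

text \<open>With the parameters taken in \<open>M\<close>, genericity of given values holds in
  \<open>M\<close> iff it holds in \<open>N\<close>. Both directions are needed: from
  \<open>N\<close> to \<open>M\<close> for restrictions to land in \<open>Cset M\<close>, from
  \<open>M\<close> to \<open>N\<close> for their density there.\<close>

lemma Cset_values:
  assumes K: "K1 = M \<and> K2 = N \<or> K1 = N \<and> K2 = M"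
    and p: "p \<in> Cset K1" and F: "finite F" "F \<subseteq> tuples M zs" and eps: "\<epsilon> > 0"
  shows "\<exists>q\<in>Cset K2. \<forall>b\<in>F. \<bar>q b - p b\<bar> \<le> \<epsilon>"
proof -
  have K1: "is_model L T K1" and K2: "is_model L T K2" using K M N by auto
  obtain bs where bs: "set bs = F" using finite_list[OF F(1)] by blast
  have bsM: "b \<in> tuples M zs" if "b \<in> set bs" for b using bs F(2) that by blast
  have bsK: "set bs \<subseteq> tuples K1 zs" using K bs F(2) tuples_subset by auto
  obtain n where "\<forall>as. generic_at K1 G m zs \<phi> n (length bs) (\<lambda>j. p (bs ! j)) \<epsilon> (concat bs @ as)"
    using Cset_generic_at[OF K1 p bsK eps] by (rule exE)
  then have g1: "generic_at K1 G m zs \<phi> n (length bs) (\<lambda>j. p (bs ! j)) \<epsilon> (concat bs @ [])" by (rule spec)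
  have e: "concat bs @ [] \<in> tuples M (copies (length bs) zs @ [])"
    using concat_in_tuples[of bs M zs] bsM by simp
  have s: "set (copies (length bs) zs @ []) \<subseteq> sorts L" using zs by auto
  have eq: "generic_at M G m zs \<phi> n (length bs) (\<lambda>j. p (bs ! j)) \<epsilon> (concat bs @ []) \<longleftrightarrow>
      generic_at N G m zs \<phi> n (length bs) (\<lambda>j. p (bs ! j)) \<epsilon> (concat bs @ [])"
    by (rule transfer[OF open_cond_generic[OF eps] s e])
  have g2: "generic_at K2 G m zs \<phi> n (length bs) (\<lambda>j. p (bs ! j)) \<epsilon> (concat bs @ [])"
    using K g1 eq by auto
  have e2: "concat bs @ [] \<in> tuples K2 (copies (length bs) zs @ [])"
    using K e elem_substruct_tuples[OF MN s] by auto
  obtain q where q: "q \<in> Cset K2"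
      "\<forall>j<length bs. \<bar>q (block (length zs) j (concat bs @ [])) - p (bs ! j)\<bar> \<le> \<epsilon>"
    using generic_at_Cset[OF K2 g2 e2] by (rule bexE)
  have "\<bar>q b - p b\<bar> \<le> \<epsilon>" if bF: "b \<in> F" for b
  proof -
    obtain j where j: "j < length bs" "bs ! j = b" using bF unfolding bs[symmetric] in_set_conv_nth by blast
    have "block (length zs) j (concat bs @ []) = bs ! j"
      using tuples_length[OF bsM] j(1) by (rule block_concat)
    with q(2) j show ?thesis by force
  qed
  with q(1) show ?thesis by (intro bexI[of _ q] ballI)
qed

lemma restr_in_Cset:
  assumes q: "q \<in> Cset N"
  shows "restr_type M zs q \<in> Cset M"
proof -
  have "restr_type M zs q \<in> powertop_real (tuples M zs) closure_of Cset M"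
    unfolding in_closure_of
  proof (intro conjI allI impI)
    show "restr_type M zs q \<in> topspace (powertop_real (tuples M zs))" by (simp add: restr_type_def)
    fix V assume V: "restr_type M zs q \<in> V \<and> openin (powertop_real (tuples M zs)) V"
    obtain F \<epsilon> where F: "finite F" "F \<subseteq> tuples M zs" "\<epsilon> > 0"
        "\<And>p. p \<in> extensional (tuples M zs) \<Longrightarrow> \<forall>b\<in>F. \<bar>p b - restr_type M zs q b\<bar> < \<epsilon> \<Longrightarrow> p \<in> V"
      using powertop_nbhd[OF conjunct2[OF V] conjunct1[OF V]] by metis
    have "\<epsilon> / 2 > 0" using F(3) by simp
    from Cset_values[OF disjI2[OF conjI[OF refl refl]] q F(1,2) this]
    obtain p where p: "p \<in> Cset M" "\<forall>b\<in>F. \<bar>p b - q b\<bar> \<le> \<epsilon> / 2" by (rule bexE)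
    have "p \<in> V"
    proof (rule F(4))
      show "p \<in> extensional (tuples M zs)" using p(1) Cset_ext[OF M] by blast
      show "\<forall>b\<in>F. \<bar>p b - restr_type M zs q b\<bar> < \<epsilon>"
      proof
        fix b assume "b \<in> F"
        then show "\<bar>p b - restr_type M zs q b\<bar> < \<epsilon>"
          using p(2) F(3) subsetD[OF F(2)] by (fastforce simp: restr_type_def)
      qed
    qed
    with p(1) show "\<exists>y. y \<in> Cset M \<and> y \<in> V" by (intro exI[of _ p]) simp
  qed
  then show ?thesis using Cset_closedin[OF M] by (simp add: closure_of_closedin)
qed

lemma continuous_map_restr:
  "continuous_map (powertop_real (tuples N zs)) (powertop_real (tuples M zs)) (restr_type M zs)"
  unfolding continuous_map_componentwise
proof (intro conjI ballI)
  show "restr_type M zs ` topspace (powertop_real (tuples N zs)) \<subseteq> extensional (tuples M zs)"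
    by (auto simp: restr_type_def)
  fix b assume b: "b \<in> tuples M zs"
  have "continuous_map (powertop_real (tuples N zs)) euclideanreal (\<lambda>q. q b)"
    using continuous_map_product_coordinates[OF subsetD[OF tuples_subset b], of "\<lambda>_. euclideanreal"] .
  then show "continuous_map (powertop_real (tuples N zs)) euclideanreal (\<lambda>q. restr_type M zs q b)"
    using b by (simp add: restr_type_def)
qed

text \<open>The image is dense in \<open>Cset M\<close> by \<open>Cset_values\<close>, and closed as
  a compact subset of a Hausdorff space.\<close>

lemma restr_image: "restr_type M zs ` Cset N = Cset M"
proof
  show "restr_type M zs ` Cset N \<subseteq> Cset M" using restr_in_Cset by (rule image_subsetI)
  have "compactin (powertop_real (tuples M zs)) (restr_type M zs ` Cset N)"
    by (rule image_compactin[OF Cset_compactin[OF N] continuous_map_restr])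
  moreover have "Hausdorff_space (powertop_real (tuples M zs))"
    by (simp add: Hausdorff_space_product_topology)
  ultimately have cl: "closedin (powertop_real (tuples M zs)) (restr_type M zs ` Cset N)"
    by (rule compactin_imp_closedin[rotated])
  show "Cset M \<subseteq> restr_type M zs ` Cset N"
  proof
    fix p assume p: "p \<in> Cset M"
    have "p \<in> powertop_real (tuples M zs) closure_of (restr_type M zs ` Cset N)"
      unfolding in_closure_of
    proof (intro conjI allI impI)
      show "p \<in> topspace (powertop_real (tuples M zs))"
        using closedin_subset[OF Cset_closedin[OF M]] p by blast
      fix V assume V: "p \<in> V \<and> openin (powertop_real (tuples M zs)) V"
      obtain F \<epsilon> where F: "finite F" "F \<subseteq> tuples M zs" "\<epsilon> > 0"
          "\<And>q. q \<in> extensional (tuples M zs) \<Longrightarrow> \<forall>b\<in>F. \<bar>q b - p b\<bar> < \<epsilon> \<Longrightarrow> q \<in> V"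
        using powertop_nbhd[OF conjunct2[OF V] conjunct1[OF V]] by metis
      have "\<epsilon> / 2 > 0" using F(3) by simp
      from Cset_values[OF disjI1[OF conjI[OF refl refl]] p F(1,2) this]
      obtain q where q: "q \<in> Cset N" "\<forall>b\<in>F. \<bar>q b - p b\<bar> \<le> \<epsilon> / 2" by (rule bexE)
      have "restr_type M zs q \<in> V"
      proof (rule F(4))
        show "restr_type M zs q \<in> extensional (tuples M zs)" by (simp add: restr_type_def)
        show "\<forall>b\<in>F. \<bar>restr_type M zs q b - p b\<bar> < \<epsilon>"
        proof
          fix b assume "b \<in> F"
          then show "\<bar>restr_type M zs q b - p b\<bar> < \<epsilon>"
            using q(2) F(3) subsetD[OF F(2)] by (fastforce simp: restr_type_def)
        qed
      qed
      with q(1) show "\<exists>y. y \<in> restr_type M zs ` Cset N \<and> y \<in> V"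
        by (intro exI[of _ "restr_type M zs q"]) simp
    qed
    then show "p \<in> restr_type M zs ` Cset N" using cl by (simp add: closure_of_closedin)
  qed
qed

text \<open>The elements of \<open>A0\<close> remain as free variables behind the blocks, the tuples
  \<open>bs\<close> are quantified existentially, and their values at \<open>A0\<close> enter as
  real constants. The resulting open condition on elements of \<open>M\<close> holds in
  \<open>N\<close>, hence in \<open>M\<close>.\<close>

lemma pull_back:
  assumes bs: "set bs \<subseteq> tuples N zs" and A0: "finite A0" "A0 \<subseteq> univ M G" and \<delta>: "\<delta> > 0"
    and P: "open_cond L (copies (length bs) zs @ replicate (card A0) G) P"
      "\<And>as. P N (concat bs @ as)"
  shows "\<exists>e\<in>tuples M (copies (length bs) zs @ replicate (card A0) G). P M e \<and>
    (\<forall>a\<in>A0. \<forall>j<length bs.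
      \<bar>phi_val M \<phi> a (block (length zs) j e) - phi_val N \<phi> a (bs ! j)\<bar> < \<delta>)"
proof -
  obtain as where as: "set as = A0" "distinct as" using finite_distinct_list[OF A0(1)] by blast
  define k l where "k = length bs" and "l = card A0"
  have las: "length as = l" using as distinct_card unfolding l_def by metis
  have asM: "as \<in> tuples M (replicate l G)"
    using las as(1) A0(2) unfolding tuples_def list_all2_conv_all_nth by (auto dest: nth_mem)
  have asN: "as \<in> tuples N (replicate l G)"
    using las as(1) A0(2) univ_subset unfolding tuples_def list_all2_conv_all_nth by (auto dest: nth_mem)
  define R where "R = (\<lambda>(M :: ('s, 'f, 'p, 'u) struct) e. \<forall>(i, j)\<in>{..<l} \<times> {..<k}.
    \<bar>phi_val M \<phi> (e ! (k * length zs + i)) (block (length zs) j e) - phi_val N \<phi> (as ! i) (bs ! j)\<bar> < \<delta>)"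
  have "open_cond L (copies k zs @ replicate l G) (\<lambda>M e. P M e \<and> R M e)"
    unfolding R_def
  proof (intro open_cond_conj open_cond_ball)
    show "open_cond L (copies k zs @ replicate l G) P" using P(1) by (simp add: k_def l_def)
    fix x assume x: "x \<in> {..<l} \<times> {..<k}"
    obtain i j where ij: "x = (i, j)" "i < l" "j < k" using x by auto
    show "open_cond L (copies k zs @ replicate l G) (\<lambda>(M :: ('s, 'f, 'p, 'u) struct) e. case x of (i, j) \<Rightarrow>
      \<bar>phi_val M \<phi> (e ! (k * length zs + i)) (block (length zs) j e) - phi_val N \<phi> (as ! i) (bs ! j)\<bar> < \<delta>)"
      unfolding ij(1) prod.case by (rule open_cond_value_at[OF \<phi> _ _ ij(3)]) (use ij(2) in simp_all)
  qed simp
  then have oc: "open_cond L (replicate l G) (\<lambda>M as. \<exists>e\<in>tuples M (copies k zs). P M (e @ as) \<and> R M (e @ as))"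
    using zs by (intro open_cond_exs) auto
  have lcb: "length b = length zs" if "b \<in> set bs" for b using tuples_length bs that by blast
  have ccN: "concat bs \<in> tuples N (copies k zs)" unfolding k_def using bs by (intro concat_in_tuples) blast
  have nth_end: "(e @ as) ! (k * length zs + i) = as ! i"
    if "e \<in> tuples K (copies k zs)" for e i and K :: "('s, 'f, 'p, 'u) struct"
    using tuples_length[OF that] by (simp add: nth_append length_copies)
  have sl: "set (replicate l G) \<subseteq> sorts L" using mult_symbol(4) by (simp add: set_replicate_conv_if)
  have "R N (concat bs @ as)"
    unfolding R_def using nth_end[OF ccN] block_concat[OF lcb] \<delta> by (auto simp: k_def)
  then have "\<exists>e\<in>tuples N (copies k zs). P N (e @ as) \<and> R N (e @ as)" using ccN P(2) by blast
  then have "\<exists>e\<in>tuples M (copies k zs). P M (e @ as) \<and> R M (e @ as)"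
    using transfer[OF oc sl asM] by simp
  then obtain e where e: "e \<in> tuples M (copies k zs)" "P M (e @ as)" "R M (e @ as)" by blast
  show ?thesis
  proof (intro bexI[of _ "e @ as"] conjI ballI allI impI)
    show "e @ as \<in> tuples M (copies (length bs) zs @ replicate (card A0) G)"
      using tuples_append[OF e(1) asM] by (simp add: k_def l_def)
    show "P M (e @ as)" by (rule e(2))
    fix a j assume a: "a \<in> A0" and j: "j < length bs"
    obtain i where i: "i < l" "as ! i = a" using a las unfolding as(1)[symmetric] in_set_conv_nth by blast
    have "(i, j) \<in> {..<l} \<times> {..<k}" using i(1) j by (simp add: k_def)
    with e(3) show "\<bar>phi_val M \<phi> a (block (length zs) j (e @ as)) - phi_val N \<phi> a (bs ! j)\<bar> < \<delta>"
      unfolding R_def nth_end[OF e(1)] i(2)[symmetric] by fast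
  qed
qed

lemma tuple_approx:
  assumes b: "b \<in> tuples N zs" and A0: "finite A0" "A0 \<subseteq> univ M G" and \<delta>: "\<delta> > 0"
  obtains b' where "b' \<in> tuples M zs" "\<And>a. a \<in> A0 \<Longrightarrow> \<bar>phi_val M \<phi> a b' - phi_val N \<phi> a b\<bar> < \<delta>"
proof -
  \<comment> \<open>An empty conjunction, as a trivially true open condition: only the values at
    \<open>A0\<close> are to be copied.\<close>
  define Q where "Q = (\<lambda>(M :: ('s, 'f, 'p, 'u) struct) (e :: 'u list). \<forall>i\<in>({} :: nat set). False)"
  have oc: "open_cond L (copies (length [b]) zs @ replicate (card A0) G) Q"
    unfolding Q_def by (rule open_cond_ball) simp_all
  have bN: "set [b] \<subseteq> tuples N zs" using b by simp
  have "Q N (concat [b] @ as)" for as by (simp add: Q_def)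
  from pull_back[OF bN A0 \<delta> oc this]
  obtain e where e: "e \<in> tuples M (copies (length [b]) zs @ replicate (card A0) G)"
      "\<forall>a\<in>A0. \<forall>j<length [b]. \<bar>phi_val M \<phi> a (block (length zs) j e) - phi_val N \<phi> a ([b] ! j)\<bar> < \<delta>"
    by (elim bexE conjE) (rule that)
  show ?thesis
  proof (rule that)
    show "block (length zs) 0 e \<in> tuples M zs" by (rule block_in_tuples[OF e(1)]) simp
    show "\<bar>phi_val M \<phi> a (block (length zs) 0 e) - phi_val N \<phi> a b\<bar> < \<delta>" if "a \<in> A0" for a
      using e(2) that by simp
  qed
qed

text \<open>
  As the sup metric on \<open>Cset M\<close> is totally bounded, finitely many elements of \<open>M\<close> determine the
  values of all its members up to \<open>\<epsilon>\<close>; a failure for a member of \<open>Cset N\<close> could be pulled back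
  to \<open>M\<close>, because membership is witnessed by genericity.
\<close>

lemma Cset_determined:
  assumes eps: "\<epsilon> > 0"
  shows "\<exists>A0 \<delta>. finite A0 \<and> A0 \<subseteq> univ M G \<and> \<delta> > 0 \<and>
    (\<forall>q\<in>Cset N. \<forall>b\<in>tuples N zs. \<forall>b'\<in>tuples N zs.
      (\<forall>a\<in>A0. \<bar>phi_val N \<phi> a b - phi_val N \<phi> a b'\<bar> < \<delta>) \<longrightarrow> \<bar>q b - q b'\<bar> \<le> \<epsilon>)"
proof -
  \<comment> \<open>\<open>3 * e\<close> is the oscillation allowed for a type in
    \<open>Cset M\<close>, one \<open>e\<close> from the net point and two from the distance to it;
    the transfer costs \<open>e / 2\<close> at each of the two tuples.\<close>
  define e where "e = \<epsilon> / 4"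
  have e: "e > 0" "\<epsilon> = 4 * e" using eps by (simp_all add: e_def)
  have e2: "e / 2 > 0" using e by simp
  obtain P where P: "finite P" "P \<subseteq> Cset M" "\<forall>p\<in>Cset M. \<exists>q\<in>P. \<forall>b\<in>tuples M zs. \<bar>p b - q b\<bar> \<le> e"
    using Cset_totally_bounded[OF M] e(1) unfolding sup_totally_bounded_def by meson
  have "\<forall>p\<in>P. \<exists>x. finite (fst x) \<and> fst x \<subseteq> univ M G \<and> snd x > 0 \<and>
      (\<forall>b\<in>tuples M zs. \<forall>b'\<in>tuples M zs.
        (\<forall>a\<in>fst x. \<bar>phi_val M \<phi> a b - phi_val M \<phi> a b'\<bar> < snd x) \<longrightarrow> \<bar>p b - p b'\<bar> \<le> e)"
  proof
    fix p assume "p \<in> P"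
    then have "p \<in> local_types (univ M G) (tuples M zs) (phi_val M \<phi>)" using P(2) Cset_types[OF M] by blast
    from stable_type_determined[OF phi_stable[OF M] this e(1)]
    show "\<exists>x. finite (fst x) \<and> fst x \<subseteq> univ M G \<and> snd x > 0 \<and>
      (\<forall>b\<in>tuples M zs. \<forall>b'\<in>tuples M zs.
        (\<forall>a\<in>fst x. \<bar>phi_val M \<phi> a b - phi_val M \<phi> a b'\<bar> < snd x) \<longrightarrow> \<bar>p b - p b'\<bar> \<le> e)"
      by (simp only: split_paired_Ex fst_conv snd_conv)
  qed
  from bchoice[OF this] obtain x where x: "\<forall>p\<in>P. finite (fst (x p)) \<and> fst (x p) \<subseteq> univ M G \<and> snd (x p) > 0 \<and>
      (\<forall>b\<in>tuples M zs. \<forall>b'\<in>tuples M zs.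
        (\<forall>a\<in>fst (x p). \<bar>phi_val M \<phi> a b - phi_val M \<phi> a b'\<bar> < snd (x p)) \<longrightarrow> \<bar>p b - p b'\<bar> \<le> e)"
    by (rule exE)
  define A0 where "A0 = (\<Union>p\<in>P. fst (x p))"
  define d where "d = Min (insert 1 ((\<lambda>p. snd (x p)) ` P))"
  have A0: "finite A0" "A0 \<subseteq> univ M G" unfolding A0_def using P(1) x by auto
  have d: "d > 0" unfolding d_def using P(1) x by simp
  have d_le: "d \<le> snd (x p)" if "p \<in> P" for p unfolding d_def using P(1) that by simp
  have detM: "\<bar>p b - p b'\<bar> \<le> 3 * e"
    if p: "p \<in> Cset M" and b: "b \<in> tuples M zs" "b' \<in> tuples M zs"
      and cl: "\<forall>a\<in>A0. \<bar>phi_val M \<phi> a b - phi_val M \<phi> a b'\<bar> < d" for p b b'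
  proof -
    obtain q where q: "q \<in> P" "\<forall>b\<in>tuples M zs. \<bar>p b - q b\<bar> \<le> e" using bspec[OF P(3) p] by (rule bexE)
    have "\<forall>a\<in>fst (x q). \<bar>phi_val M \<phi> a b - phi_val M \<phi> a b'\<bar> < snd (x q)"
      using cl q(1) d_le[OF q(1)] unfolding A0_def by fastforce
    then have "\<bar>q b - q b'\<bar> \<le> e" using x q(1) b by blast
    with bspec[OF q(2) b(1)] bspec[OF q(2) b(2)] show ?thesis by linarith
  qed
  \<comment> \<open>The copies in \<open>M\<close> of \<open>b\<close> and \<open>b'\<close> are
    each off by up to \<open>d / 3\<close>; a third \<open>d / 3\<close> between \<open>b\<close>
    and \<open>b'\<close> keeps the sum below \<open>d\<close>.\<close>
  have d3: "d / 3 > 0" using d by simp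
  have main: "\<bar>q b - q b'\<bar> \<le> \<epsilon>"
    if q: "q \<in> Cset N" and b: "b \<in> tuples N zs" "b' \<in> tuples N zs"
      and cl: "\<forall>a\<in>A0. \<bar>phi_val N \<phi> a b - phi_val N \<phi> a b'\<bar> < d / 3" for q b b'
  proof -
    have bsN: "set [b, b'] \<subseteq> tuples N zs" using b by simp
    obtain n where n: "\<forall>as. generic_at N G m zs \<phi> n (length [b, b']) (\<lambda>j. q ([b, b'] ! j)) (e / 2) (concat [b, b'] @ as)"
      using Cset_generic_at[OF N q bsN e2] by (rule exE)
    define Q where "Q = (\<lambda>M :: ('s, 'f, 'p, 'u) struct. generic_at M G m zs \<phi> n (length [b, b']) (\<lambda>j. q ([b, b'] ! j)) (e / 2))"
    have oc: "open_cond L (copies (length [b, b']) zs @ replicate (card A0) G) Q"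
      unfolding Q_def by (rule open_cond_generic[OF e2])
    have "Q N (concat [b, b'] @ as)" for as unfolding Q_def by (rule spec[OF n])
    from pull_back[OF bsN A0 d3 oc this]
    obtain e' where e': "e' \<in> tuples M (copies (length [b, b']) zs @ replicate (card A0) G)"
        "Q M e'"
        "\<forall>a\<in>A0. \<forall>j<length [b, b'].
          \<bar>phi_val M \<phi> a (block (length zs) j e') - phi_val N \<phi> a ([b, b'] ! j)\<bar> < d / 3"
      by (elim bexE conjE) (rule that)
    obtain p where p: "p \<in> Cset M"
        "\<forall>j<length [b, b']. \<bar>p (block (length zs) j e') - q ([b, b'] ! j)\<bar> \<le> e / 2"
      using generic_at_Cset[OF M e'(2)[unfolded Q_def] e'(1)] by (rule bexE)
    have bl: "block (length zs) 0 e' \<in> tuples M zs" "block (length zs) 1 e' \<in> tuples M zs"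
      using block_in_tuples[OF e'(1)] by simp_all
    have "\<bar>phi_val M \<phi> a (block (length zs) 0 e') - phi_val M \<phi> a (block (length zs) 1 e')\<bar> < d" if a: "a \<in> A0" for a
    proof -
      have "\<bar>phi_val M \<phi> a (block (length zs) 0 e') - phi_val N \<phi> a b\<bar> < d / 3"
        "\<bar>phi_val M \<phi> a (block (length zs) 1 e') - phi_val N \<phi> a b'\<bar> < d / 3"
        using bspec[OF e'(3) a, rule_format, of 0] bspec[OF e'(3) a, rule_format, of 1] by simp_all
      with bspec[OF cl a] show ?thesis by linarith
    qed
    then have "\<bar>p (block (length zs) 0 e') - p (block (length zs) 1 e')\<bar> \<le> 3 * e"
      using detM[OF p(1) bl] by simp
    moreover have "\<bar>p (block (length zs) 0 e') - q b\<bar> \<le> e / 2" using p(2)[rule_format, of 0] by simp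
    moreover have "\<bar>p (block (length zs) 1 e') - q b'\<bar> \<le> e / 2" using p(2)[rule_format, of 1] by simp
    ultimately show ?thesis using e(2) by linarith
  qed
  show ?thesis using A0 d3 main by (intro exI[of _ A0] exI[of _ "d / 3"]) simp
qed

lemma topspace_S_phi_star:
  "topspace (S_phi_star M G zs \<phi>) = local_types (tuples M zs) (univ M G) (\<lambda>b a. phi_val M \<phi> a b)"
  unfolding S_phi_star_def local_type_space_def
  using closedin_subset[OF closedin_local_types[of "univ M G" "tuples M zs" "\<lambda>b a. phi_val M \<phi> a b"]]
  by (simp add: Int_absorb1)

lemma tp_star_in:
  assumes b: "b \<in> tuples N zs"
  shows "tp_star N M G \<phi> b \<in> local_types (tuples M zs) (univ M G) (\<lambda>b a. phi_val M \<phi> a b)"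
  unfolding local_types_def
proof (intro CollectI conjI allI impI)
  show "tp_star N M G \<phi> b \<in> extensional (univ M G)" by (simp add: tp_star_def)
  fix F and \<epsilon> :: real assume F: "finite F" "F \<subseteq> univ M G" "\<epsilon> > 0"
  obtain b' where b': "b' \<in> tuples M zs" "\<And>a. a \<in> F \<Longrightarrow> \<bar>phi_val M \<phi> a b' - phi_val N \<phi> a b\<bar> < \<epsilon>"
    using tuple_approx[OF b F] by metis
  have "\<bar>phi_val M \<phi> a b' - tp_star N M G \<phi> b a\<bar> < \<epsilon>" if "a \<in> F" for a
    using b'(2)[OF that] subsetD[OF F(2) that] by (simp add: tp_star_def)
  with b'(1) show "\<exists>b'\<in>tuples M zs. \<forall>a\<in>F. \<bar>phi_val M \<phi> a b' - tp_star N M G \<phi> b a\<bar> < \<epsilon>"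
    by (intro bexI[of _ b'] ballI)
qed

text \<open>Approximate \<open>b\<close> by a tuple \<open>b'\<close> of \<open>M\<close> at the
  finitely many elements that control \<open>q\<close> by \<open>Cset_determined\<close> together
  with those that control the continuous definition \<open>d\<close> near the type of
  \<open>b\<close>. At \<open>b'\<close> the two agree, so they agree at \<open>b\<close> up to
  \<epsilon>. This also yields injectivity of restriction.\<close>

lemma def_ext_restr:
  assumes q: "q \<in> Cset N"
  shows "def_ext M N G zs \<phi> (restr_type M zs q) = q"
proof -
  define p where "p = restr_type M zs q"
  have pX: "p \<in> local_types (univ M G) (tuples M zs) (phi_val M \<phi>)"
    using restr_in_Cset[OF q] Cset_types[OF M] unfolding p_def by blast
  obtain c where c: "\<And>a b. a \<in> univ M G \<Longrightarrow> b \<in> tuples M zs \<Longrightarrow> \<bar>phi_val M \<phi> a b\<bar> \<le> c"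
    using phi_bounded[OF model_struct[OF M]] by metis
  define d where "d = (SOME d. defines_type M G zs \<phi> p d)"
  have "\<exists>d. defines_type M G zs \<phi> p d"
    unfolding defines_type_def S_phi_star_def tp_star_def
    by (rule stable_type_definition[OF phi_stable[OF M] c pX])
  from someI_ex[OF this, folded d_def]
  have d: "continuous_map (S_phi_star M G zs \<phi>) euclideanreal d"
      "\<And>b. b \<in> tuples M zs \<Longrightarrow> p b = d (tp_star M M G \<phi> b)"
    unfolding defines_type_def by simp_all
  have "d (tp_star N M G \<phi> b) = q b" if b: "b \<in> tuples N zs" for b
  proof -
    define y where "y = tp_star N M G \<phi> b"
    have y: "y \<in> topspace (S_phi_star M G zs \<phi>)" unfolding topspace_S_phi_star y_def by (rule tp_star_in[OF b])
    have "\<bar>d y - q b\<bar> \<le> 0"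
    proof (rule field_le_epsilon)
      fix \<epsilon> :: real assume "\<epsilon> > 0"
      then have e2: "\<epsilon> / 2 > 0" by simp
      obtain A0 \<delta> where A0: "finite A0" "A0 \<subseteq> univ M G" "\<delta> > 0"
        "\<forall>q\<in>Cset N. \<forall>b\<in>tuples N zs. \<forall>b'\<in>tuples N zs.
          (\<forall>a\<in>A0. \<bar>phi_val N \<phi> a b - phi_val N \<phi> a b'\<bar> < \<delta>) \<longrightarrow> \<bar>q b - q b'\<bar> \<le> \<epsilon> / 2"
        using Cset_determined[OF e2] by (elim exE conjE) (rule that)
      define W where "W = {z \<in> topspace (S_phi_star M G zs \<phi>). d z \<in> ball (d y) (\<epsilon> / 2)}"
      have "openin (S_phi_star M G zs \<phi>) W"
        unfolding W_def by (rule openin_continuous_map_preimage[OF d(1)]) simp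
      then obtain V where V: "openin (powertop_real (univ M G)) V"
          "W = V \<inter> local_types (tuples M zs) (univ M G) (\<lambda>b a. phi_val M \<phi> a b)"
        unfolding S_phi_star_def local_type_space_def openin_subtopology by (elim exE conjE) (rule that)
      have "y \<in> W" using y e2 by (simp add: W_def)
      then have "y \<in> V" unfolding V(2) by simp
      from powertop_nbhd[OF V(1) this] obtain F \<eta> where F: "finite F" "F \<subseteq> univ M G" "\<eta> > 0"
        "\<And>z. z \<in> extensional (univ M G) \<Longrightarrow> \<forall>a\<in>F. \<bar>z a - y a\<bar> < \<eta> \<Longrightarrow> z \<in> V" by metis
      have fin: "finite (A0 \<union> F)" "A0 \<union> F \<subseteq> univ M G" "min \<delta> \<eta> > 0" using A0 F by simp_all
      obtain b' where b': "b' \<in> tuples M zs"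
          "\<And>a. a \<in> A0 \<union> F \<Longrightarrow> \<bar>phi_val M \<phi> a b' - phi_val N \<phi> a b\<bar> < min \<delta> \<eta>"
        using tuple_approx[OF b fin] by metis
      have b'N: "b' \<in> tuples N zs" using b'(1) tuples_subset by blast
      have "\<bar>phi_val N \<phi> a b' - phi_val N \<phi> a b\<bar> < \<delta>" if "a \<in> A0" for a
        using b'(2)[of a] that phi_val_eq[OF subsetD[OF A0(2) that] b'(1)] by simp
      then have 1: "\<bar>q b' - q b\<bar> \<le> \<epsilon> / 2" using A0(4) q b'N b by simp
      define z where "z = tp_star M M G \<phi> b'"
      have "z \<in> V"
      proof (rule F(4))
        show "z \<in> extensional (univ M G)" by (simp add: z_def tp_star_def)
        show "\<forall>a\<in>F. \<bar>z a - y a\<bar> < \<eta>"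
          using b'(2) subsetD[OF F(2)] by (simp add: z_def y_def tp_star_def)
      qed
      moreover have "z \<in> local_types (tuples M zs) (univ M G) (\<lambda>b a. phi_val M \<phi> a b)"
        unfolding z_def tp_star_def using realized_local_type[OF b'(1), of "\<lambda>b a. phi_val M \<phi> a b"] .
      ultimately have "z \<in> W" unfolding V(2) by simp
      then have "\<bar>d y - d z\<bar> < \<epsilon> / 2" by (simp add: W_def dist_real_def)
      moreover have "d z = q b'" using d(2)[OF b'(1)] b'(1) by (simp add: z_def p_def restr_type_def)
      ultimately show "\<bar>d y - q b\<bar> \<le> 0 + \<epsilon>" using 1 by linarith
    qed
    then show ?thesis by (simp add: y_def)
  qed
  then have "def_ext M N G zs \<phi> p b = q b" if "b \<in> tuples N zs" for b
    using that by (simp add: def_ext_def d_def)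
  moreover have "def_ext M N G zs \<phi> p \<in> extensional (tuples N zs)" by (simp add: def_ext_def)
  moreover have "q \<in> extensional (tuples N zs)" using q Cset_ext[OF N] by blast
  ultimately show ?thesis unfolding p_def by (intro extensionalityI)
qed

text \<open>Restriction is a continuous bijection from a compact to a Hausdorff space, hence a
  homeomorphism. The continuity of \<open>def_ext\<close> follows by identifying it with the
  inverse.\<close>

lemma restr_homeomorphic_maps:
  "homeomorphic_maps (C_phi N G m zs \<phi>) (C_phi M G m zs \<phi>) (restr_type M zs) (def_ext M N G zs \<phi>)"
proof -
  have topN: "topspace (C_phi N G m zs \<phi>) = Cset N"
    unfolding C_phi_eq[OF N] using closedin_subset[OF Cset_closedin[OF N]] by (simp add: Int_absorb1)
  have topM: "topspace (C_phi M G m zs \<phi>) = Cset M"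
    unfolding C_phi_eq[OF M] using closedin_subset[OF Cset_closedin[OF M]] by (simp add: Int_absorb1)
  have "homeomorphic_map (C_phi N G m zs \<phi>) (C_phi M G m zs \<phi>) (restr_type M zs)"
  proof (rule continuous_imp_homeomorphic_map)
    show "continuous_map (C_phi N G m zs \<phi>) (C_phi M G m zs \<phi>) (restr_type M zs)"
      unfolding C_phi_eq[OF M] continuous_map_in_subtopology
    proof
      show "continuous_map (C_phi N G m zs \<phi>) (powertop_real (tuples M zs)) (restr_type M zs)"
        unfolding C_phi_eq[OF N] by (rule continuous_map_from_subtopology[OF continuous_map_restr])
      show "restr_type M zs \<in> topspace (C_phi N G m zs \<phi>) \<rightarrow> Cset M"
        unfolding topN using restr_in_Cset by (intro Pi_I)
    qed
    show "compact_space (C_phi N G m zs \<phi>)"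
      unfolding C_phi_eq[OF N] by (rule compact_space_subtopology[OF Cset_compactin[OF N]])
    show "Hausdorff_space (C_phi M G m zs \<phi>)"
      unfolding C_phi_eq[OF M]
      by (rule Hausdorff_space_subtopology) (simp add: Hausdorff_space_product_topology)
    show "restr_type M zs ` topspace (C_phi N G m zs \<phi>) = topspace (C_phi M G m zs \<phi>)"
      unfolding topN topM by (rule restr_image)
    show "inj_on (restr_type M zs) (topspace (C_phi N G m zs \<phi>))"
      unfolding topN by (rule inj_on_inverseI[of _ "def_ext M N G zs \<phi>"]) (rule def_ext_restr)
  qed
  then obtain g where g: "homeomorphic_maps (C_phi N G m zs \<phi>) (C_phi M G m zs \<phi>) (restr_type M zs) g"
    unfolding homeomorphic_map_maps by (rule exE)
  show ?thesis
  proof (rule homeomorphic_maps_eq[OF g refl])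
    fix p assume "p \<in> topspace (C_phi M G m zs \<phi>)"
    then obtain q where q: "q \<in> Cset N" "p = restr_type M zs q"
      unfolding topM restr_image[symmetric] by (rule imageE)
    have "g p = q" using g q unfolding homeomorphic_maps_def topN by simp
    then show "g p = def_ext M N G zs \<phi> p" using def_ext_restr[OF q(1)] q(2) by simp
  qed
qed

end

theorem theorem6p4:
  fixes L :: "('s, 'f, 'p) lang" and T :: "('s, 'f, 'p) fm set"
    and G :: 's and m :: 'f and zs :: "'s list" and \<phi> :: "('s, 'f, 'p) fm"
    and M N :: "('s, 'f, 'p, 'u) struct"
  assumes "is_lang L" and "is_theory L T"
    and "complete_theory TYPE('u) L T"
    and "expands_group TYPE('u) L T G m"
    and "set zs \<subseteq> sorts L" and "is_fm L (G # zs) \<phi>"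
    and "left_invariant TYPE('u) L T G m zs \<phi>"
    and "stable_in TYPE('u) L T G zs \<phi>"
    and "is_model L T M" and "is_model L T N"
  shows "C_phi M G m zs \<phi> homeomorphic_space C_phi N G m zs \<phi> \<and>
    (elem_substruct L M N \<longrightarrow>
       homeomorphic_maps (C_phi N G m zs \<phi>) (C_phi M G m zs \<phi>)
         (restr_type M zs) (def_ext M N G zs \<phi>))"
proof (intro conjI impI)
  interpret stable_left_invariant L T G m zs \<phi> "TYPE('u)"
    by unfold_locales (fact assms)+
  show "C_phi M G m zs \<phi> homeomorphic_space C_phi N G m zs \<phi>"
    by (rule C_phi_homeomorphic) (fact assms)+
  assume MN: "elem_substruct L M N"
  interpret elementary_extension L T G m zs \<phi> "TYPE('u)" M N
    by unfold_locales (fact assms MN)+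
  show "homeomorphic_maps (C_phi N G m zs \<phi>) (C_phi M G m zs \<phi>)
      (restr_type M zs) (def_ext M N G zs \<phi>)"
    by (rule restr_homeomorphic_maps)
qed

end
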